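(* Let $S$ be a semitopological semigroup. (i) Every second countable wap $S$-flow $X$ is Eberlein. (ii) Every second countable RN-approximable $S$-flow $X$ is an RN flow.
   Context: A semitopological semigroup is a semigroup with a topology for which multiplication is separately continuous. An $S$-flow is a topological space $X$ with a separately continuous left action $S\times X\to X$; if $S$ is a monoid, its identity acts as the identity transformation. A flow is second countable if the space $X$ is. Banach spaces are real. $C(X)$ is the Banach algebra of bounded continuous real functions on $X$ with the sup norm; $(fs)(x)=f(sx)$, $fS=\{fs:s\in S\}$. $\mathrm{WAP}_S(X)$ is the set of $f\in C(X)$ such that $fS$ is relatively weakly compact in $C(X)$. $X$ is wap if $\mathrm{WAP}_S(X)$ separates points and closed subsets of $X$ (it separates the points of $X$, and for every closed $F\subset X$ and $x\notin F$ there is $f\in\mathrm{WAP}_S(X)$ with $f(x)\notin\overline{f(F)}$). For a Banach space $V$: $\Theta(V)=\{\sigma\in L(V,V):\|\sigma\|\le1\}$; $B(V^* )$ is the closed unit ball of $V^*$ with the weak$^*$ topology. A $V$-representation of $(S,X)$ is a pair $(h,\alpha)$ where $h:S\to\Theta(V)$ is an antihomomorphism ($h(st)=h(t)h(s)$) continuous for the weak operator topology and $\alpha:X\to B(V^* )$ is weak$^*$ continuous and equivariant: $\langle v,\alpha(sx)\rangle=\langle h(s)v,\alpha(x)\rangle$. It is faithful if $\alpha$ is a topological embedding. $(S,X)$ is Eberlein (respectively RN, i.e. Radon–Nikodým) if it admits a faithful $V$-representation with $V$ reflexive (respectively Asplund). It is RN-approximable if there is a family of representations $(h_i,\alpha_i)$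 of $(S,X)$ in Asplund spaces $V_i$ separating points and closed subsets of $X$ (the $\alpha_i$ separate the points of $X$, and for closed $F$, $x\notin F$, some $\alpha_i(x)\notin\overline{\alpha_i(F)}$); equivalently, $X$ is a subflow of a product of RN $S$-flows. A Banach space is Asplund if every separable Banach subspace of it has separable dual. *)

theory Defs
  imports "HOL-Analysis.Analysis"
begin

class semitopological_semigroup = semigroup_mult + topological_space +
  assumes open_vimage_mult_left: "open U \<Longrightarrow> open ((\<lambda>x. a * x) -` U)"
    and open_vimage_mult_right: "open U \<Longrightarrow> open ((\<lambda>x. x * a) -` U)"

definition flow ::
  "('s::semitopological_semigroup \<Rightarrow> 'x::topological_space \<Rightarrow> 'x) \<Rightarrow> bool" where
  "flow act \<longleftrightarrow>
     (\<forall>s t x. act (s * t) x = act s (act t x)) \<and>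
     (\<forall>s. continuous_on UNIV (\<lambda>x. act s x)) \<and>
     (\<forall>x. continuous_on UNIV (\<lambda>s. act s x)) \<and>
     (\<forall>e. (\<forall>s. e * s = s \<and> s * e = s) \<longrightarrow> (\<forall>x. act e x = x))"

text \<open>The coarsest topology on \<open>A\<close> making all functions in \<open>G\<close> continuous on \<open>A\<close>;
  inserting \<open>A\<close> itself only matters for empty \<open>G\<close>.\<close>

definition initial_topology :: "'a set \<Rightarrow> ('a \<Rightarrow> real) set \<Rightarrow> 'a topology" where
  "initial_topology A G =
     topology_generated_by (insert A {{a \<in> A. g a \<in> U} | g U. g \<in> G \<and> open U})"

definition weak_topology :: "'b::real_normed_vector topology" where
  "weak_topology = initial_topology UNIV {\<phi>. bounded_linear \<phi>}"

definition relatively_weakly_compact :: "'b::real_normed_vector set \<Rightarrow> bool" where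
  "relatively_weakly_compact A \<longleftrightarrow> compactin weak_topology (weak_topology closure_of A)"

definition translate ::
  "('s \<Rightarrow> 'x \<Rightarrow> 'x) \<Rightarrow> ('x::topological_space \<Rightarrow>\<^sub>C real) \<Rightarrow> 's \<Rightarrow> ('x \<Rightarrow>\<^sub>C real)" where
  "translate act f s = Bcontfun (\<lambda>x. apply_bcontfun f (act s x))"

definition WAP :: "('s \<Rightarrow> 'x \<Rightarrow> 'x) \<Rightarrow> ('x::topological_space \<Rightarrow>\<^sub>C real) set" where
  "WAP act = {f. relatively_weakly_compact (range (translate act f))}"

definition wap :: "('s \<Rightarrow> 'x \<Rightarrow> 'x::topological_space) \<Rightarrow> bool" where
  "wap act \<longleftrightarrow>
     (\<forall>x y. x \<noteq> y \<longrightarrow> (\<exists>f\<in>WAP act. apply_bcontfun f x \<noteq> apply_bcontfun f y)) \<and>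
     (\<forall>F x. closed F \<and> x \<notin> F \<longrightarrow>
        (\<exists>f\<in>WAP act. apply_bcontfun f x \<notin> closure (apply_bcontfun f ` F)))"

text \<open>Being Eberlein or RN involves an existential quantifier over Banach spaces.  In order to
  quantify over them, a Banach space is rendered as a pair of a linear subspace \<open>V\<close> of a real
  vector space and a norm \<open>N\<close> on \<open>V\<close>.  The ambient type only supplies the vector space
  operations; \<open>N\<close> need not be related to any norm on it.  Functionals and operators on \<open>V\<close> are
  made \<open>extensional\<close>, so that equality is equality on \<open>V\<close>.\<close>

text \<open>The distances are cut off outside the carrier because \<open>Metric_space\<close> demands
  nonnegativity and symmetry also there.\<close>

definition norm_dist :: "'v::real_vector set \<Rightarrow> ('v \<Rightarrow> real) \<Rightarrow> 'v \<Rightarrow> 'v \<Rightarrow> real" where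
  "norm_dist V N u v = (if u \<in> V \<and> v \<in> V then N (u - v) else 0)"

locale banach_on =
  fixes V :: "'v::real_vector set" and N :: "'v \<Rightarrow> real"
  assumes subspace: "subspace V"
    and norm_nonneg: "v \<in> V \<Longrightarrow> 0 \<le> N v"
    and norm_eq_zero: "v \<in> V \<Longrightarrow> N v = 0 \<longleftrightarrow> v = 0"
    and norm_scaleR: "v \<in> V \<Longrightarrow> N (c *\<^sub>R v) = \<bar>c\<bar> * N v"
    and norm_triangle: "u \<in> V \<Longrightarrow> v \<in> V \<Longrightarrow> N (u + v) \<le> N u + N v"
    and complete: "Metric_space.mcomplete V (norm_dist V N)"

definition dual :: "'v::real_vector set \<Rightarrow> ('v \<Rightarrow> real) \<Rightarrow> ('v \<Rightarrow> real) set" where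
  "dual V N = {\<phi> \<in> extensional V.
     (\<forall>u\<in>V. \<forall>v\<in>V. \<phi> (u + v) = \<phi> u + \<phi> v) \<and>
     (\<forall>c. \<forall>v\<in>V. \<phi> (c *\<^sub>R v) = c * \<phi> v) \<and>
     (\<exists>C. \<forall>v\<in>V. \<bar>\<phi> v\<bar> \<le> C * N v)}"

definition dual_norm :: "'v set \<Rightarrow> ('v \<Rightarrow> real) \<Rightarrow> ('v \<Rightarrow> real) \<Rightarrow> real" where
  "dual_norm V N \<phi> = (SUP v\<in>{v \<in> V. N v \<le> 1}. \<bar>\<phi> v\<bar>)"

definition dual_dist ::
  "'v::real_vector set \<Rightarrow> ('v \<Rightarrow> real) \<Rightarrow> ('v \<Rightarrow> real) \<Rightarrow> ('v \<Rightarrow> real) \<Rightarrow> real" where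
  "dual_dist V N \<phi> \<psi> =
     (if \<phi> \<in> dual V N \<and> \<psi> \<in> dual V N then dual_norm V N (\<lambda>v\<in>V. \<phi> v - \<psi> v) else 0)"

definition bidual ::
  "'v::real_vector set \<Rightarrow> ('v \<Rightarrow> real) \<Rightarrow> (('v \<Rightarrow> real) \<Rightarrow> real) set" where
  "bidual V N = {F \<in> extensional (dual V N).
     (\<forall>\<phi>\<in>dual V N. \<forall>\<psi>\<in>dual V N. F (\<lambda>v\<in>V. \<phi> v + \<psi> v) = F \<phi> + F \<psi>) \<and>
     (\<forall>c. \<forall>\<phi>\<in>dual V N. F (\<lambda>v\<in>V. c * \<phi> v) = c * F \<phi>) \<and>
     (\<exists>C. \<forall>\<phi>\<in>dual V N. \<bar>F \<phi>\<bar> \<le> C * dual_norm V N \<phi>)}"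

definition reflexive_on :: "'v::real_vector set \<Rightarrow> ('v \<Rightarrow> real) \<Rightarrow> bool" where
  "reflexive_on V N \<longleftrightarrow> banach_on V N \<and> (\<lambda>v. \<lambda>\<phi>\<in>dual V N. \<phi> v) ` V = bidual V N"

definition asplund_on :: "'v::real_vector set \<Rightarrow> ('v \<Rightarrow> real) \<Rightarrow> bool" where
  "asplund_on V N \<longleftrightarrow> banach_on V N \<and>
     (\<forall>W. W \<subseteq> V \<and> banach_on W N \<and>
        separable_space (Metric_space.mtopology W (norm_dist W N)) \<longrightarrow>
        separable_space (Metric_space.mtopology (dual W N) (dual_dist W N)))"

definition contractions :: "'v::real_vector set \<Rightarrow> ('v \<Rightarrow> real) \<Rightarrow> ('v \<Rightarrow> 'v) set" where
  "contractions V N = {\<sigma> \<in> V \<rightarrow>\<^sub>E V.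
     (\<forall>u\<in>V. \<forall>v\<in>V. \<sigma> (u + v) = \<sigma> u + \<sigma> v) \<and>
     (\<forall>c. \<forall>v\<in>V. \<sigma> (c *\<^sub>R v) = c *\<^sub>R \<sigma> v) \<and>
     (\<forall>v\<in>V. N (\<sigma> v) \<le> N v)}"

definition weak_operator_topology ::
  "'v::real_vector set \<Rightarrow> ('v \<Rightarrow> real) \<Rightarrow> ('v \<Rightarrow> 'v) topology" where
  "weak_operator_topology V N =
     initial_topology (contractions V N) {\<lambda>\<sigma>. \<phi> (\<sigma> v) | \<phi> v. \<phi> \<in> dual V N \<and> v \<in> V}"

definition weak_star_ball ::
  "'v::real_vector set \<Rightarrow> ('v \<Rightarrow> real) \<Rightarrow> ('v \<Rightarrow> real) topology" where
  "weak_star_ball V N =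
     initial_topology {\<phi> \<in> dual V N. dual_norm V N \<phi> \<le> 1} {\<lambda>\<phi>. \<phi> v | v. v \<in> V}"

definition representation ::
  "'v::real_vector set \<Rightarrow> ('v \<Rightarrow> real) \<Rightarrow>
   ('s::semitopological_semigroup \<Rightarrow> 'x::topological_space \<Rightarrow> 'x) \<Rightarrow>
   ('s \<Rightarrow> 'v \<Rightarrow> 'v) \<Rightarrow> ('x \<Rightarrow> 'v \<Rightarrow> real) \<Rightarrow> bool" where
  "representation V N act h \<alpha> \<longleftrightarrow>
     (\<forall>s t. \<forall>v\<in>V. h (s * t) v = h t (h s v)) \<and>
     continuous_map euclidean (weak_operator_topology V N) h \<and>
     continuous_map euclidean (weak_star_ball V N) \<alpha> \<and>
     (\<forall>s x. \<forall>v\<in>V. \<alpha> (act s x) v = \<alpha> x (h s v))"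

definition faithful_representation ::
  "'v::real_vector set \<Rightarrow> ('v \<Rightarrow> real) \<Rightarrow>
   ('s::semitopological_semigroup \<Rightarrow> 'x::topological_space \<Rightarrow> 'x) \<Rightarrow>
   ('s \<Rightarrow> 'v \<Rightarrow> 'v) \<Rightarrow> ('x \<Rightarrow> 'v \<Rightarrow> real) \<Rightarrow> bool" where
  "faithful_representation V N act h \<alpha> \<longleftrightarrow>
     representation V N act h \<alpha> \<and> embedding_map euclidean (weak_star_ball V N) \<alpha>"

text \<open>In the next two definitions it suffices to quantify over Banach spaces \<open>V\<close> whose vectors
  are bounded continuous functions on \<open>X\<close> (with an arbitrary complete norm).  Indeed, let
  \<open>(h, \<alpha>)\<close> be a faithful representation in any Banach space \<open>V\<close>, and let \<open>K\<close> be the set of those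
  \<open>v\<close> in \<open>V\<close> on which all \<open>\<alpha> x\<close> vanish.  By equivariance \<open>K\<close> is a closed \<open>h\<close>-invariant subspace,
  so \<open>(h, \<alpha>)\<close> induces a faithful representation in \<open>V / K\<close>, which is again reflexive
  (respectively Asplund), and \<open>v \<mapsto> (\<lambda>x. \<alpha> x v)\<close> identifies \<open>V / K\<close> with a linear subspace of
  \<open>C(X)\<close>, to which the quotient norm is transported.\<close>

definition eberlein_flow ::
  "('s::semitopological_semigroup \<Rightarrow> 'x::topological_space \<Rightarrow> 'x) \<Rightarrow> bool" where
  "eberlein_flow act \<longleftrightarrow>
     (\<exists>(V :: ('x \<Rightarrow>\<^sub>C real) set) N h \<alpha>. reflexive_on V N \<and> faithful_representation V N act h \<alpha>)"

definition RN_flow ::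
  "('s::semitopological_semigroup \<Rightarrow> 'x::topological_space \<Rightarrow> 'x) \<Rightarrow> bool" where
  "RN_flow act \<longleftrightarrow>
     (\<exists>(V :: ('x \<Rightarrow>\<^sub>C real) set) N h \<alpha>. asplund_on V N \<and> faithful_representation V N act h \<alpha>)"

text \<open>The family of representations is a set \<open>R\<close> of tuples \<open>(V, N, h, \<alpha>)\<close>.  The spaces \<open>V\<close> are
  subspaces of a common real vector space \<open>'v\<close>; since they carry independent norms and every
  family of vector spaces embeds into its direct sum, this covers all families as \<open>'v\<close> varies.\<close>

definition RN_approximable ::
  "'v::real_vector itself \<Rightarrow>
   ('s::semitopological_semigroup \<Rightarrow> 'x::topological_space \<Rightarrow> 'x) \<Rightarrow> bool" where
  "RN_approximable (_ :: 'v itself) act \<longleftrightarrow>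
     (\<exists>R :: ('v set \<times> ('v \<Rightarrow> real) \<times> ('s \<Rightarrow> 'v \<Rightarrow> 'v) \<times> ('x \<Rightarrow> 'v \<Rightarrow> real)) set.
        (\<forall>(V, N, h, \<alpha>)\<in>R. asplund_on V N \<and> representation V N act h \<alpha>) \<and>
        (\<forall>x y. x \<noteq> y \<longrightarrow> (\<exists>(V, N, h, \<alpha>)\<in>R. \<alpha> x \<noteq> \<alpha> y)) \<and>
        (\<forall>F x. closed F \<and> x \<notin> F \<longrightarrow>
           (\<exists>(V, N, h, \<alpha>)\<in>R. \<alpha> x \<notin> weak_star_ball V N closure_of (\<alpha> ` F))))"

end

theory Submission
  imports Defs "HOL-Complex_Analysis.Great_Picard"
begin

text \<open>For both parts, a countable subfamily of the given functions (respectively representations)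
  already generates the topology, since the space is second countable.

  For (i), suitably small multiples of the translates of countably many wap functions form a
  translation invariant set with Grothendieck's double limit property.  By Krein's theorem its
  absolutely convex hull \<open>W\<close> has this property as well, and therefore the interpolation space of
  Davis, Figiel, Johnson and Pelczynski for \<open>W\<close> is reflexive: a functional on the dual of that
  space is a weak* limit of elements that are nearly multiples of elements of \<open>W\<close>, and the double
  limit property first makes the pointwise limit continuous and then shows that it represents the
  functional.  The space consists of functions and is translation invariant, so the flow is
  represented on it by translations and evaluations.

  For (ii), a quotient of the \<open>c\<^sub>0\<close>-sum of countably many Asplund spaces is used, which is again
  Asplund because functionals on a \<open>c\<^sub>0\<close>-sum have small tails.\<close>

section \<open>Sublinear functionals\<close>

text \<open>The space X need not be compact or Hausdorff, so a functional on C(X) is not given by a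
  measure on X, and dominated convergence is not at hand. Two devices take its place. Finite
  combinations of evaluations are weak* dense in the dual ball
  (\<open>eval_ball_weak_star_dense\<close>), and iterated limits are compared by choosing elements
  and functionals alternately (\<open>ladder_le\<close>). This comparison recurs four times: for
  convex hulls, for the continuity of a weak* limit, for its representation, and for the weak
  continuity of s |-> fs, where the separate continuity of the action yields only continuity at each
  point of X.

  The definitions of Eberlein and RN flows ask for a space of functions on X with a norm of its own.
  Hence both constructions take place inside C(X), the representation always consists of
  translations and evaluations, and only the norm has to be designed. In both cases its functionals
  are controlled up to a small error by simpler ones: by functionals on C(X) for the interpolation
  space, by finitely many coordinates for the sum. Reflexivity, separability of duals and continuity
  in the weak operator topology are all reduced to these.\<close>

definition sublinear_on :: "'a::real_vector set \<Rightarrow> ('a \<Rightarrow> real) \<Rightarrow> bool" where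
  "sublinear_on V p \<longleftrightarrow>
     (\<forall>u\<in>V. \<forall>v\<in>V. p (u + v) \<le> p u + p v) \<and> (\<forall>c>0. \<forall>v\<in>V. p (c *\<^sub>R v) \<le> c * p v)"

definition functional_on :: "'a::real_vector set \<Rightarrow> ('a \<Rightarrow> real) \<Rightarrow> bool" where
  "functional_on V f \<longleftrightarrow>
     (\<forall>u\<in>V. \<forall>v\<in>V. f (u + v) = f u + f v) \<and> (\<forall>c. \<forall>v\<in>V. f (c *\<^sub>R v) = c * f v)"

lemma functional_onD:
  assumes "functional_on V f"
  shows "u \<in> V \<Longrightarrow> v \<in> V \<Longrightarrow> f (u + v) = f u + f v"
    and "v \<in> V \<Longrightarrow> f (c *\<^sub>R v) = c * f v"
  using assms by (auto simp: functional_on_def)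

lemma functional_on_minus: "functional_on V f \<Longrightarrow> v \<in> V \<Longrightarrow> f (- v) = - f v"
  using functional_onD(2)[of V f v "-1"] by simp

lemma functional_on_diff:
  assumes "functional_on V f" "subspace V" "u \<in> V" "v \<in> V"
  shows "f (u - v) = f u - f v"
  using functional_onD(1)[OF assms(1,3) subspace_neg[OF assms(2,4)]]
    functional_on_minus[OF assms(1,4)] by simp

lemma sublinear_onD:
  assumes "sublinear_on V p"
  shows "u \<in> V \<Longrightarrow> v \<in> V \<Longrightarrow> p (u + v) \<le> p u + p v"
    and "v \<in> V \<Longrightarrow> 0 < c \<Longrightarrow> p (c *\<^sub>R v) \<le> c * p v"
  using assms by (auto simp: sublinear_on_def)

lemma sublinear_on_scale:
  assumes "sublinear_on V p" "subspace V" "v \<in> V" "0 < c"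
  shows "p (c *\<^sub>R v) = c * p v"
proof (rule antisym)
  have "p ((1 / c) *\<^sub>R c *\<^sub>R v) \<le> (1 / c) * p (c *\<^sub>R v)"
    using assms by (intro sublinear_onD(2)) (auto intro: subspace_scale)
  with assms(4) show "c * p v \<le> p (c *\<^sub>R v)" by (simp add: field_simps)
qed (rule sublinear_onD(2)[OF assms(1,3,4)])

lemma sublinear_on_0:
  assumes "sublinear_on V p" "subspace V"
  shows "p 0 = 0"
  using sublinear_on_scale[OF assms subspace_0[OF assms(2)], of 2] by simp

lemma sublinear_on_minus:
  assumes "sublinear_on V p" "subspace V" "v \<in> V"
  shows "- p (- v) \<le> p v"
  using sublinear_onD(1)[OF assms(1,3) subspace_neg[OF assms(2,3)]] sublinear_on_0[OF assms(1,2)]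
  by simp

text \<open>A minimal sublinear functional is linear.\<close>

lemma functional_below_sublinear:
  fixes p :: "'a::real_vector \<Rightarrow> real"
  assumes V: "subspace V" and p: "sublinear_on V p"
  shows "\<exists>g. functional_on V g \<and> (\<forall>v\<in>V. g v \<le> p v)"
proof -
  \<comment> \<open>Values outside \<open>V\<close> are fixed, so that minimality on
    \<open>V\<close> yields equality of functions. The order \<open>P\<close> is reversed because
    Zorn's lemma provides maximal elements.\<close>
  define S where "S = {q. sublinear_on V q \<and> (\<forall>v\<in>V. q v \<le> p v) \<and> (\<forall>v. v \<notin> V \<longrightarrow> q v = 0)}"
  define P where "P = (\<lambda>q q' :: 'a \<Rightarrow> real. q' \<le> q)"
  have lower: "- p (- v) \<le> q v" if "q \<in> S" "v \<in> V" for q v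
  proof -
    have "- q (- v) \<le> q v" "q (- v) \<le> p (- v)"
      using that V by (auto simp: S_def intro: sublinear_on_minus subspace_neg)
    then show ?thesis by linarith
  qed
  have "\<exists>m\<in>S. \<forall>a\<in>S. P m a \<longrightarrow> a = m"
  proof (rule predicate_Zorn)
    show "partial_order_on S (relation_of P S)"
      by (rule partial_order_on_relation_ofI) (auto simp: P_def)
  next
    fix C assume C: "C \<in> Chains (relation_of P S)"
    then have CS: "C \<subseteq> S" and chain: "\<And>a b. a \<in> C \<Longrightarrow> b \<in> C \<Longrightarrow> a \<le> b \<or> b \<le> a"
      by (auto simp: Chains_def relation_of_def P_def)
    show "\<exists>u\<in>S. \<forall>a\<in>C. P a u"
    proof (cases "C = {}")
      case True
      have "(\<lambda>v. if v \<in> V then p v else 0) \<in> S"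
        using p V by (auto simp: S_def sublinear_on_def subspace_add subspace_scale)
      with True show ?thesis by auto
    next
      case False
      define r where "r v = (if v \<in> V then INF q\<in>C. q v else 0)" for v
      have bdd: "bdd_below ((\<lambda>q. q v) ` C)" if "v \<in> V" for v
        using lower CS that by (intro bdd_belowI2[of _ "- p (- v)"]) auto
      have rle: "r v \<le> q v" if "q \<in> C" "v \<in> V" for q v
        using that bdd by (auto simp: r_def intro: cINF_lower)
      have rge: "c \<le> r v" if "v \<in> V" "\<And>q. q \<in> C \<Longrightarrow> c \<le> q v" for c v
        using that False by (auto simp: r_def intro: cINF_greatest)
      have "sublinear_on V r"
        unfolding sublinear_on_def
      proof (intro conjI ballI allI impI)
        fix u v assume uv: "u \<in> V" "v \<in> V"
        have "r (u + v) - q v \<le> r u" if q: "q \<in> C" for q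
        proof (rule rge)
          fix q' assume q': "q' \<in> C"
          \<comment> \<open>A chain is directed downwards: subadditivity of the smaller of two
            members bounds the infimum at \<open>u + v\<close> by the values of both.\<close>
          obtain q0 where q0: "q0 \<in> C" "q0 \<le> q" "q0 \<le> q'"
            using chain[OF q q'] q q' by blast
          have "r (u + v) \<le> q0 (u + v)" using q0 uv V by (auto intro: rle subspace_add)
          also have "\<dots> \<le> q0 u + q0 v"
            using q0(1) CS uv by (auto simp: S_def intro: sublinear_onD)
          also have "\<dots> \<le> q' u + q v" using q0 by (auto simp: le_fun_def intro: add_mono)
          finally show "r (u + v) - q v \<le> q' u" by simp
        qed (use uv in auto)
        then have "r (u + v) - r u \<le> r v" using uv by (intro rge) (auto simp: algebra_simps)
        then show "r (u + v) \<le> r u + r v" by simp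
      next
        fix c :: real and v assume c: "0 < c" and v: "v \<in> V"
        have "r (c *\<^sub>R v) / c \<le> r v"
        proof (rule rge[OF v])
          fix q assume q: "q \<in> C"
          have "r (c *\<^sub>R v) \<le> q (c *\<^sub>R v)" using q v V by (auto intro: rle subspace_scale)
          also have "\<dots> \<le> c * q v" using q CS v c by (auto simp: S_def intro: sublinear_onD)
          finally show "r (c *\<^sub>R v) / c \<le> q v" using c by (simp add: field_simps)
        qed
        then show "r (c *\<^sub>R v) \<le> c * r v" using c by (simp add: field_simps)
      qed
      moreover have "r v \<le> p v" if v: "v \<in> V" for v
      proof -
        obtain q where "q \<in> C" using False by auto
        then have "r v \<le> q v" "q v \<le> p v" using rle[OF _ v] CS v by (auto simp: S_def)
        then show ?thesis by linarith
      qed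
      ultimately have "r \<in> S" by (auto simp: S_def r_def)
      moreover have "r \<le> q" if "q \<in> C" for q
      proof (rule le_funI)
        fix v show "r v \<le> q v"
          using rle[OF that] that CS by (cases "v \<in> V") (auto simp: r_def S_def)
      qed
      ultimately show ?thesis by (auto simp: P_def)
    qed
  qed
  then obtain q where q: "q \<in> S" and min: "\<And>a. a \<in> S \<Longrightarrow> a \<le> q \<Longrightarrow> a = q"
    by (auto simp: P_def)
  then have sub: "sublinear_on V q" and qp: "\<And>v. v \<in> V \<Longrightarrow> q v \<le> p v"
    and q0: "\<And>v. v \<notin> V \<Longrightarrow> q v = 0" by (auto simp: S_def)
  note subD = sublinear_onD[OF sub] and V_simps = subspace_add[OF V] subspace_scale[OF V] subspace_neg[OF V]
  have super: "q v + q u \<le> q (v + u)" if u: "u \<in> V" and v: "v \<in> V" for u v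
  proof -
    \<comment> \<open>This \<open>r\<close> lies below \<open>q\<close> (take \<open>t = 0\<close>)
      and is again sublinear, because nonnegative multiples of \<open>u\<close> add up. Minimality
      gives \<open>r = q\<close>, and \<open>t = 1\<close> then reads as superadditivity.\<close>
    define r where "r v = (if v \<in> V then INF t\<in>{0..}. q (v + t *\<^sub>R u) - t * q u else 0)" for v
    have bd: "- q (- v) \<le> q (v + t *\<^sub>R u) - t * q u" if "v \<in> V" "0 \<le> t" for v t
    proof -
      have "t * q u = q (t *\<^sub>R u)"
        using sublinear_on_scale[OF sub V u, of t] that sublinear_on_0[OF sub V]
        by (cases "t = 0") auto
      also have "\<dots> \<le> q (v + t *\<^sub>R u) + q (- v)"
        using subD(1)[of "v + t *\<^sub>R u" "- v"] that u by (simp add: V_simps)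
      finally show ?thesis by simp
    qed
    have bdd: "bdd_below ((\<lambda>t. q (v + t *\<^sub>R u) - t * q u) ` {0..})" if "v \<in> V" for v
      using bd that by (intro bdd_belowI2) auto
    have rle: "r v \<le> q (v + t *\<^sub>R u) - t * q u" if "v \<in> V" "0 \<le> t" for v t
      using that bdd[OF that(1)] by (auto simp: r_def intro: cINF_lower)
    have rge: "c \<le> r v" if "v \<in> V" "\<And>t. 0 \<le> t \<Longrightarrow> c \<le> q (v + t *\<^sub>R u) - t * q u" for c v
      using that by (auto simp: r_def intro: cINF_greatest)
    have "sublinear_on V r"
      unfolding sublinear_on_def
    proof (intro conjI ballI allI impI)
      fix v w assume vw: "v \<in> V" "w \<in> V"
      have "r (v + w) - (q (w + t *\<^sub>R u) - t * q u) \<le> r v" if t: "0 \<le> t" for t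
      proof (rule rge[OF vw(1)])
        fix t' :: real assume t': "0 \<le> t'"
        have "r (v + w) \<le> q ((v + w) + (t' + t) *\<^sub>R u) - (t' + t) * q u"
          using t t' vw by (intro rle) (auto intro: V_simps)
        also have "(v + w) + (t' + t) *\<^sub>R u = (v + t' *\<^sub>R u) + (w + t *\<^sub>R u)"
          by (simp add: algebra_simps)
        also have "q \<dots> \<le> q (v + t' *\<^sub>R u) + q (w + t *\<^sub>R u)"
          using vw u by (intro subD) (auto intro: V_simps)
        finally show "r (v + w) - (q (w + t *\<^sub>R u) - t * q u) \<le> q (v + t' *\<^sub>R u) - t' * q u"
          by (simp add: algebra_simps)
      qed
      then have "r (v + w) - r v \<le> r w" using vw by (intro rge) (auto simp: algebra_simps)
      then show "r (v + w) \<le> r v + r w" by simp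
    next
      fix c :: real and v assume c: "0 < c" and v: "v \<in> V"
      have "r (c *\<^sub>R v) / c \<le> r v"
      proof (rule rge[OF v])
        fix t :: real assume t: "0 \<le> t"
        have "r (c *\<^sub>R v) \<le> q (c *\<^sub>R v + (c * t) *\<^sub>R u) - (c * t) * q u"
          using t c v by (intro rle) (auto intro: V_simps)
        also have "c *\<^sub>R v + (c * t) *\<^sub>R u = c *\<^sub>R (v + t *\<^sub>R u)" by (simp add: algebra_simps)
        also have "q \<dots> \<le> c * q (v + t *\<^sub>R u)"
          using v u c by (intro subD) (auto intro: V_simps)
        finally show "r (c *\<^sub>R v) / c \<le> q (v + t *\<^sub>R u) - t * q u"
          using c by (simp add: field_simps)
      qed
      then show "r (c *\<^sub>R v) \<le> c * r v" using c by (simp add: field_simps)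
    qed
    moreover have rq: "r w \<le> q w" for w
      using rle[of w 0] q0 by (cases "w \<in> V") (auto simp: r_def)
    ultimately have "r \<in> S"
      using qp order_trans by (fastforce simp: S_def r_def)
    then have "r = q" using min rq by (auto simp: le_fun_def)
    then show ?thesis using rle[OF v, of 1] by simp
  qed
  have add: "q (u + v) = q u + q v" if "u \<in> V" "v \<in> V" for u v
    using super[OF that(2,1)] subD(1)[OF that] by simp
  have neg: "q (- v) = - q v" if "v \<in> V" for v
    using add[of v "- v"] that sublinear_on_0[OF sub V] by (simp add: V_simps)
  have "q (c *\<^sub>R v) = c * q v" if v: "v \<in> V" for c v
  proof (cases "0 < c")
    case False
    then show ?thesis
    proof (cases "c = 0")
      case False
      with \<open>\<not> 0 < c\<close> have "0 < - c" by simp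
      have "q (- c *\<^sub>R v) = - c * q v"
        by (rule sublinear_on_scale[OF sub V v \<open>0 < - c\<close>])
      moreover have "q (- c *\<^sub>R v) = - q (c *\<^sub>R v)" using neg[of "c *\<^sub>R v"] v by (simp add: V_simps)
      ultimately show ?thesis by simp
    qed (simp add: sublinear_on_0[OF sub V])
  qed (simp add: sublinear_on_scale[OF sub V v])
  with add qp show ?thesis by (intro exI[of _ q]) (simp add: functional_on_def)
qed

text \<open>The function \<open>r\<close>, an infimal convolution of \<open>p\<close> and
  \<open>f\<close>, is sublinear; a linear functional below it lies below \<open>p\<close> (take
  \<open>w = 0\<close>) and above \<open>f\<close> (evaluate at \<open>- w\<close>). The lower bound
  \<open>f\<close> is only superlinear because \<open>dual_approx\<close> applies the lemma to a
  functional minus a multiple of a norm.\<close>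

lemma functional_sandwich:
  fixes p f :: "'a::real_vector \<Rightarrow> real"
  assumes V: "subspace V" and p: "sublinear_on V p"
    and W: "subspace W" "W \<subseteq> V" and f: "sublinear_on W (\<lambda>w. - f w)"
    and le: "\<And>w. w \<in> W \<Longrightarrow> f w \<le> p w"
  obtains g where "functional_on V g" "\<And>v. v \<in> V \<Longrightarrow> g v \<le> p v" "\<And>w. w \<in> W \<Longrightarrow> f w \<le> g w"
proof -
  define r where "r v = (INF w\<in>W. p (v + w) - f w)" for v
  note pD = sublinear_onD[OF p] and fD = sublinear_onD[OF f]
    and V_simps = subspace_add[OF V] subspace_scale[OF V] subspace_neg[OF V]
    and W_simps = subspace_add[OF W(1)] subspace_scale[OF W(1)] subspace_neg[OF W(1)]
  have WV: "w \<in> V" if "w \<in> W" for w using W that by auto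
  have "- p (- v) \<le> p (v + w) - f w" if "v \<in> V" "w \<in> W" for v w
  proof -
    have "f w \<le> p ((v + w) + (- v))" using le[OF that(2)] by simp
    also have "\<dots> \<le> p (v + w) + p (- v)" using that WV by (intro pD) (auto intro: V_simps)
    finally show ?thesis by simp
  qed
  then have bdd: "bdd_below ((\<lambda>w. p (v + w) - f w) ` W)" if "v \<in> V" for v
    using that by (intro bdd_belowI2[of _ "- p (- v)"]) auto
  have rle: "r v \<le> p (v + w) - f w" if "v \<in> V" "w \<in> W" for v w
    using that bdd by (auto simp: r_def intro: cINF_lower)
  have rge: "c \<le> r v" if "\<And>w. w \<in> W \<Longrightarrow> c \<le> p (v + w) - f w" for c v
    using that subspace_0[OF W(1)] by (auto simp: r_def intro!: cINF_greatest)
  have "sublinear_on V r"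
    unfolding sublinear_on_def
  proof (intro conjI ballI allI impI)
    fix u v assume uv: "u \<in> V" "v \<in> V"
    have "r (u + v) - (p (v + w) - f w) \<le> r u" if w: "w \<in> W" for w
    proof (rule rge)
      fix w' assume w': "w' \<in> W"
      have "r (u + v) \<le> p ((u + v) + (w' + w)) - f (w' + w)"
        using w w' uv by (intro rle) (auto intro: V_simps W_simps)
      also have "(u + v) + (w' + w) = (u + w') + (v + w)" by (simp add: algebra_simps)
      also have "p \<dots> \<le> p (u + w') + p (v + w)"
        using uv w w' WV by (intro pD) (auto intro: V_simps)
      finally show "r (u + v) - (p (v + w) - f w) \<le> p (u + w') - f w'"
        using fD(1)[OF w' w] by (simp add: algebra_simps)
    qed
    then have "r (u + v) - r u \<le> r v" using uv by (intro rge) (auto simp: algebra_simps)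
    then show "r (u + v) \<le> r u + r v" by simp
  next
    fix c :: real and v assume c: "0 < c" and v: "v \<in> V"
    have "r (c *\<^sub>R v) / c \<le> r v"
    proof (rule rge)
      fix w assume w: "w \<in> W"
      have "r (c *\<^sub>R v) \<le> p (c *\<^sub>R v + c *\<^sub>R w) - f (c *\<^sub>R w)"
        using w c v by (intro rle) (auto intro: V_simps W_simps)
      also have "c *\<^sub>R v + c *\<^sub>R w = c *\<^sub>R (v + w)" by (simp add: algebra_simps)
      also have "p \<dots> \<le> c * p (v + w)" using v w c WV by (intro pD) (auto intro: V_simps)
      finally show "r (c *\<^sub>R v) / c \<le> p (v + w) - f w"
        using fD(2)[OF w c] c by (simp add: field_simps)
    qed
    then show "r (c *\<^sub>R v) \<le> c * r v" using c by (simp add: field_simps)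
  qed
  from functional_below_sublinear[OF V this] obtain g where
    g: "functional_on V g" "\<And>v. v \<in> V \<Longrightarrow> g v \<le> r v" by auto
  show thesis
  proof
    have "f 0 = 0" using sublinear_on_0[OF f W(1)] by simp
    then show "g v \<le> p v" if "v \<in> V" for v
      using g(2)[OF that] rle[OF that subspace_0[OF W(1)]] by simp
    show "f w \<le> g w" if w: "w \<in> W" for w
    proof -
      have "- w \<in> V" using WV[OF w] by (rule V_simps)
      from g(2)[OF this] rle[OF this w] have "g (- w) \<le> - f w"
        using sublinear_on_0[OF p V] by simp
      then show ?thesis using functional_on_minus[OF g(1) WV[OF w]] by simp
    qed
  qed (fact g(1))
qed

text \<open>On the subspace \<open>W\<close> the lower bound of the sandwich holds at
  \<open>w\<close> and at \<open>- w\<close>, which for linear \<open>f\<close> means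
  equality.\<close>

lemma hahn_banach:
  fixes p f :: "'a::real_vector \<Rightarrow> real"
  assumes V: "subspace V" and p: "sublinear_on V p"
    and W: "subspace W" "W \<subseteq> V" and f: "functional_on W f"
    and le: "\<And>w. w \<in> W \<Longrightarrow> f w \<le> p w"
  obtains g where "functional_on V g" "\<And>v. v \<in> V \<Longrightarrow> g v \<le> p v" "\<And>w. w \<in> W \<Longrightarrow> g w = f w"
proof -
  have "sublinear_on W (\<lambda>w. - f w)" using f by (auto simp: sublinear_on_def functional_on_def)
  from functional_sandwich[OF V p W this le] obtain g where
    g: "functional_on V g" "\<And>v. v \<in> V \<Longrightarrow> g v \<le> p v" "\<And>w. w \<in> W \<Longrightarrow> f w \<le> g w" by auto
  have "g w = f w" if w: "w \<in> W" for w
    using g(3)[OF w] g(3)[OF subspace_neg[OF W(1) w]] functional_on_minus[OF f w]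
      functional_on_minus[OF g(1), of w] w W(2) by auto
  with g that show thesis by blast
qed

section \<open>Banach limits and the double limit property\<close>

lemma Bcontfun_nat_inverse:
  fixes f :: "nat \<Rightarrow> real"
  assumes "bounded (range f)"
  shows "apply_bcontfun (Bcontfun f) = f"
  using assms by (intro Bcontfun_inverse) (auto simp: bcontfun_def)

text \<open>Here \<open>p\<close> is the limit superior, written as the infimum of all eventual
  upper bounds, and a linear functional below it is a generalized limit. It serves instead of
  cluster points: limits of bounded sequences of functionals or of measures taken along it are again
  linear or additive, and no subnet has to be chosen.\<close>

lemma banach_limit_exists:
  "\<exists>L :: (nat \<Rightarrow> real) \<Rightarrow> real.
     (\<forall>f g. bounded (range f) \<longrightarrow> bounded (range g) \<longrightarrow> L (\<lambda>n. f n + g n) = L f + L g) \<and>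
     (\<forall>c f. bounded (range f) \<longrightarrow> L (\<lambda>n. c * f n) = c * L f) \<and>
     (\<forall>f c. bounded (range f) \<longrightarrow> (\<forall>\<^sub>F n in sequentially. f n \<le> c) \<longrightarrow> L f \<le> c)"
proof -
  define p where "p f = Inf {c. \<forall>\<^sub>F n in sequentially. apply_bcontfun f n \<le> c}"
    for f :: "nat \<Rightarrow>\<^sub>C real"
  have bdd: "bdd_below {c. \<forall>\<^sub>F n in sequentially. apply_bcontfun f n \<le> c}" for f :: "nat \<Rightarrow>\<^sub>C real"
  proof (rule bdd_belowI[of _ "- norm f"])
    fix c assume "c \<in> {c. \<forall>\<^sub>F n in sequentially. apply_bcontfun f n \<le> c}"
    then obtain n where "apply_bcontfun f n \<le> c" by (auto simp: eventually_sequentially)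
    moreover have "- norm f \<le> apply_bcontfun f n" using norm_bounded[of f n] by (simp add: abs_le_iff)
    ultimately show "- norm f \<le> c" by linarith
  qed
  have ple: "p f \<le> c" if "\<forall>\<^sub>F n in sequentially. apply_bcontfun f n \<le> c" for f c
    unfolding p_def by (rule cInf_lower[OF _ bdd]) (use that in simp)
  have pge: "c \<le> p f" if "\<And>d. \<forall>\<^sub>F n in sequentially. apply_bcontfun f n \<le> d \<Longrightarrow> c \<le> d" for f c
  proof -
    have "apply_bcontfun f n \<le> norm f" for n using norm_bounded[of f n] by (simp add: abs_le_iff)
    then have "norm f \<in> {c. \<forall>\<^sub>F n in sequentially. apply_bcontfun f n \<le> c}" by simp
    then show ?thesis unfolding p_def using that by (intro cInf_greatest) blast+
  qed
  have "sublinear_on UNIV p"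
    unfolding sublinear_on_def
  proof (intro conjI ballI allI impI)
    fix u v
    have "p (u + v) - d \<le> p u" if d: "\<forall>\<^sub>F n in sequentially. apply_bcontfun v n \<le> d" for d
    proof (rule pge)
      fix e assume "\<forall>\<^sub>F n in sequentially. apply_bcontfun u n \<le> e"
      with d have "\<forall>\<^sub>F n in sequentially. apply_bcontfun (u + v) n \<le> d + e"
        by eventually_elim simp
      then have "p (u + v) \<le> d + e" by (rule ple)
      then show "p (u + v) - d \<le> e" by simp
    qed
    then have "p (u + v) - p u \<le> d" if "\<forall>\<^sub>F n in sequentially. apply_bcontfun v n \<le> d" for d
      using that by (simp add: algebra_simps)
    then have "p (u + v) - p u \<le> p v" by (rule pge)
    then show "p (u + v) \<le> p u + p v" by simp
  next
    fix c :: real and v assume c: "0 < c"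
    have "p (c *\<^sub>R v) / c \<le> p v"
    proof (rule pge)
      fix d assume "\<forall>\<^sub>F n in sequentially. apply_bcontfun v n \<le> d"
      then have "\<forall>\<^sub>F n in sequentially. apply_bcontfun (c *\<^sub>R v) n \<le> c * d"
        by eventually_elim (use c in simp)
      then have "p (c *\<^sub>R v) \<le> c * d" by (rule ple)
      then show "p (c *\<^sub>R v) / c \<le> d" using c by (simp add: field_simps)
    qed
    then show "p (c *\<^sub>R v) \<le> c * p v" using c by (simp add: field_simps)
  qed
  from functional_below_sublinear[OF _ this] obtain g where
    g: "functional_on UNIV g" "\<And>v. g v \<le> p v" by auto
  have plus: "Bcontfun (\<lambda>n. f n + h n) = Bcontfun f + Bcontfun h"
    if "bounded (range f)" "bounded (range h)" for f h :: "nat \<Rightarrow> real"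
    by (rule bcontfun_eqI) (simp add: Bcontfun_nat_inverse that bounded_plus_comp[OF that])
  have scale: "Bcontfun (\<lambda>n. c * f n) = c *\<^sub>R Bcontfun f"
    if "bounded (range f)" for c and f :: "nat \<Rightarrow> real"
  proof -
    have "bounded (range (\<lambda>n. c * f n))"
      using bounded_scaleR_comp[OF that, of c] by simp
    then show ?thesis by (intro bcontfun_eqI) (simp add: Bcontfun_nat_inverse that)
  qed
  show ?thesis
  proof (intro exI[of _ "\<lambda>f. g (Bcontfun f)"] conjI allI impI)
    fix f :: "nat \<Rightarrow> real" and c assume "bounded (range f)" "\<forall>\<^sub>F n in sequentially. f n \<le> c"
    then show "g (Bcontfun f) \<le> c"
      using g(2)[of "Bcontfun f"] ple[of "Bcontfun f" c] by (simp add: Bcontfun_nat_inverse)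
  next
    fix f h :: "nat \<Rightarrow> real" assume "bounded (range f)" "bounded (range h)"
    then show "g (Bcontfun (\<lambda>n. f n + h n)) = g (Bcontfun f) + g (Bcontfun h)"
      by (simp only: plus functional_onD(1)[OF g(1)] UNIV_I)
  next
    fix c and f :: "nat \<Rightarrow> real" assume "bounded (range f)"
    then show "g (Bcontfun (\<lambda>n. c * f n)) = c * g (Bcontfun f)"
      by (simp only: scale functional_onD(2)[OF g(1)] UNIV_I)
  qed
qed

definition banach_limit :: "(nat \<Rightarrow> real) \<Rightarrow> real" where
  "banach_limit = (SOME L.
     (\<forall>f g. bounded (range f) \<longrightarrow> bounded (range g) \<longrightarrow> L (\<lambda>n. f n + g n) = L f + L g) \<and>
     (\<forall>c f. bounded (range f) \<longrightarrow> L (\<lambda>n. c * f n) = c * L f) \<and>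
     (\<forall>f c. bounded (range f) \<longrightarrow> (\<forall>\<^sub>F n in sequentially. f n \<le> c) \<longrightarrow> L f \<le> c))"

lemma
  assumes "bounded (range f)"
  shows banach_limit_add: "bounded (range g) \<Longrightarrow>
      banach_limit (\<lambda>n. f n + g n) = banach_limit f + banach_limit g"
    and banach_limit_scale: "banach_limit (\<lambda>n. c * f n) = c * banach_limit f"
    and banach_limit_le: "\<forall>\<^sub>F n in sequentially. f n \<le> c \<Longrightarrow> banach_limit f \<le> c"
proof -
  note L = someI_ex[OF banach_limit_exists, folded banach_limit_def]
  show "bounded (range g) \<Longrightarrow> banach_limit (\<lambda>n. f n + g n) = banach_limit f + banach_limit g"
    using conjunct1[OF L, rule_format, OF assms] .
  show "banach_limit (\<lambda>n. c * f n) = c * banach_limit f"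
    using conjunct1[OF conjunct2[OF L], rule_format, OF assms] .
  show "\<forall>\<^sub>F n in sequentially. f n \<le> c \<Longrightarrow> banach_limit f \<le> c"
    using conjunct2[OF conjunct2[OF L], rule_format, OF assms] .
qed

lemma banach_limit_ge:
  assumes "bounded (range f)" "\<forall>\<^sub>F n in sequentially. c \<le> f n"
  shows "c \<le> banach_limit f"
proof -
  have "bounded (range (\<lambda>n. (-1) * f n))"
    using bounded_scaleR_comp[OF assms(1), of "-1"] by simp
  then have "banach_limit (\<lambda>n. (-1) * f n) \<le> - c"
    using assms(2) by (intro banach_limit_le) auto
  then show ?thesis using banach_limit_scale[OF assms(1), of "-1"] by simp
qed

text \<open>Grothendieck's double limit property, with the double limits replaced by inequalities.\<close>

definition no_ladder :: "'a::real_normed_vector set \<Rightarrow> bool" where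
  "no_ladder A \<longleftrightarrow> (\<forall>(a :: nat \<Rightarrow> 'a) (\<theta> :: nat \<Rightarrow> 'a \<Rightarrow>\<^sub>L real) r s.
     (\<forall>n. a n \<in> A) \<and> (\<forall>n. norm (\<theta> n) \<le> 1) \<and>
     (\<forall>m n. m < n \<longrightarrow> blinfun_apply (\<theta> m) (a n) \<le> r) \<and>
     (\<forall>m n. n \<le> m \<longrightarrow> s \<le> blinfun_apply (\<theta> m) (a n)) \<longrightarrow> s \<le> r)"

lemma no_ladderI:
  fixes A :: "'a::real_normed_vector set"
  assumes "\<And>a (\<theta> :: nat \<Rightarrow> 'a \<Rightarrow>\<^sub>L real) r s. \<lbrakk>\<And>n. a n \<in> A; \<And>n. norm (\<theta> n) \<le> 1;
     \<And>m n :: nat. m < n \<Longrightarrow> blinfun_apply (\<theta> m) (a n) \<le> r;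
     \<And>m n. n \<le> m \<Longrightarrow> s \<le> blinfun_apply (\<theta> m) (a n)\<rbrakk> \<Longrightarrow> s \<le> r"
  shows "no_ladder A"
  unfolding no_ladder_def
proof (intro allI impI, elim conjE)
  fix a r s and \<theta> :: "nat \<Rightarrow> 'a \<Rightarrow>\<^sub>L real"
  assume h: "\<forall>n. a n \<in> A" "\<forall>n. norm (\<theta> n) \<le> 1"
    "\<forall>m n :: nat. m < n \<longrightarrow> blinfun_apply (\<theta> m) (a n) \<le> r"
    "\<forall>m n. n \<le> m \<longrightarrow> s \<le> blinfun_apply (\<theta> m) (a n)"
  show "s \<le> r" by (rule assms[of a \<theta> r s]) (simp_all add: h)
qed

lemma no_ladderD:
  fixes \<theta> :: "nat \<Rightarrow> 'a::real_normed_vector \<Rightarrow>\<^sub>L real"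
  assumes "no_ladder A" "\<And>n. a n \<in> A" "\<And>n. norm (\<theta> n) \<le> 1"
    "\<And>m n :: nat. m < n \<Longrightarrow> blinfun_apply (\<theta> m) (a n) \<le> r"
    "\<And>m n. n \<le> m \<Longrightarrow> s \<le> blinfun_apply (\<theta> m) (a n)"
  shows "s \<le> r"
proof -
  have "(\<forall>n. a n \<in> A) \<and> (\<forall>n. norm (\<theta> n) \<le> 1) \<and>
     (\<forall>m n. m < n \<longrightarrow> blinfun_apply (\<theta> m) (a n) \<le> r) \<and>
     (\<forall>m n. n \<le> m \<longrightarrow> s \<le> blinfun_apply (\<theta> m) (a n))"
    by (intro conjI allI impI assms(2-))
  then show ?thesis by (rule assms(1)[unfolded no_ladder_def, rule_format])
qed

lemma blinfun_apply_le_norm: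
  fixes \<theta> :: "'a::real_normed_vector \<Rightarrow>\<^sub>L real"
  assumes "norm \<theta> \<le> 1"
  shows "\<bar>blinfun_apply \<theta> a\<bar> \<le> norm a"
  using norm_blinfun[of \<theta> a] mult_right_mono[OF assms norm_ge_zero[of a]] by simp

lemma no_ladder_singleton: "no_ladder {a :: 'a::real_normed_vector}"
proof (rule no_ladderI)
  fix b r s and \<theta> :: "nat \<Rightarrow> 'a \<Rightarrow>\<^sub>L real"
  assume "\<And>n. b n \<in> {a}" "\<And>m n :: nat. m < n \<Longrightarrow> blinfun_apply (\<theta> m) (b n) \<le> r"
    "\<And>m n. n \<le> m \<Longrightarrow> s \<le> blinfun_apply (\<theta> m) (b n)"
  from this(1)[of 0] this(1)[of 1] this(2)[of 0 1] this(3)[of 0 0] show "s \<le> r" by simp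
qed

lemma no_ladder_subset:
  assumes "no_ladder A" "B \<subseteq> A"
  shows "no_ladder B"
  by (rule no_ladderI) (rule no_ladderD[OF assms(1) subsetD[OF assms(2)]])

text \<open>One of the two sets contains \<open>a n\<close> for infinitely many \<open>n\<close>,
  and restricting both sequences of a ladder to the same infinite set of indices leaves a
  ladder.\<close>

lemma no_ladder_Un:
  fixes A :: "'a::real_normed_vector set"
  assumes A: "no_ladder A" and B: "no_ladder B"
  shows "no_ladder (A \<union> B)"
proof (rule no_ladderI)
  fix a r s and \<theta> :: "nat \<Rightarrow> 'a \<Rightarrow>\<^sub>L real"
  assume a: "\<And>n. a n \<in> A \<union> B" and \<theta>: "\<And>n. norm (\<theta> n) \<le> 1"
    and r: "\<And>m n :: nat. m < n \<Longrightarrow> blinfun_apply (\<theta> m) (a n) \<le> r"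
    and s: "\<And>m n. n \<le> m \<Longrightarrow> s \<le> blinfun_apply (\<theta> m) (a n)"
  have sub: "s \<le> r" if C: "no_ladder C" and inf: "infinite {n. a n \<in> C}" for C
  proof (rule no_ladderD[OF C])
    let ?e = "enumerate {n. a n \<in> C}"
    show "a (?e n) \<in> C" for n using enumerate_in_set[OF inf, of n] by simp
    show "norm (\<theta> (?e n)) \<le> 1" for n by (rule \<theta>)
    show "blinfun_apply (\<theta> (?e m)) (a (?e n)) \<le> r" if "m < n" for m n
      using that by (intro r enumerate_mono inf)
    show "s \<le> blinfun_apply (\<theta> (?e m)) (a (?e n))" if "n \<le> m" for m n
      using that strict_mono_enumerate[OF inf] by (intro s) (simp add: strict_mono_less_eq)
  qed
  have "{n. a n \<in> A} \<union> {n. a n \<in> B} = UNIV" using a by auto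
  then have "infinite {n. a n \<in> A} \<or> infinite {n. a n \<in> B}"
    by (metis finite_Un infinite_UNIV_nat)
  then show "s \<le> r" using sub A B by auto
qed

lemma no_ladder_scale:
  fixes A :: "'a::real_normed_vector set"
  assumes A: "no_ladder A" and c: "0 < c"
  shows "no_ladder ((*\<^sub>R) c ` A)"
proof (rule no_ladderI)
  fix a r s and \<theta> :: "nat \<Rightarrow> 'a \<Rightarrow>\<^sub>L real"
  assume a: "\<And>n. a n \<in> (*\<^sub>R) c ` A" and \<theta>: "\<And>n. norm (\<theta> n) \<le> 1"
    and r: "\<And>m n :: nat. m < n \<Longrightarrow> blinfun_apply (\<theta> m) (a n) \<le> r"
    and s: "\<And>m n. n \<le> m \<Longrightarrow> s \<le> blinfun_apply (\<theta> m) (a n)"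
  have "\<forall>n. \<exists>b. b \<in> A \<and> a n = c *\<^sub>R b" using a by auto
  from choice[OF this] obtain b where b: "\<And>n. b n \<in> A" "\<And>n. a n = c *\<^sub>R b n" by auto
  have "\<theta> m (b n) \<le> r / c" if "m < n" for m n
    using r[OF that] c by (simp add: b(2) blinfun.scaleR_right field_simps)
  moreover have "s / c \<le> \<theta> m (b n)" if "n \<le> m" for m n
    using s[OF that] c by (simp add: b(2) blinfun.scaleR_right field_simps)
  ultimately have "s / c \<le> r / c" by (rule no_ladderD[OF A b(1) \<theta>])
  then show "s \<le> r" using c by (simp add: divide_right_mono field_simps)
qed

text \<open>The sign is moved from the elements to the functionals, whose unit ball is symmetric, so
  that \<open>r\<close> and \<open>s\<close> keep their roles.\<close>

lemma no_ladder_uminus: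
  fixes A :: "'a::real_normed_vector set"
  assumes A: "no_ladder A"
  shows "no_ladder (uminus ` A)"
proof (rule no_ladderI)
  fix a r s and \<theta> :: "nat \<Rightarrow> 'a \<Rightarrow>\<^sub>L real"
  assume a: "\<And>n. a n \<in> uminus ` A" and \<theta>: "\<And>n. norm (\<theta> n) \<le> 1"
    and r: "\<And>m n :: nat. m < n \<Longrightarrow> blinfun_apply (\<theta> m) (a n) \<le> r"
    and s: "\<And>m n. n \<le> m \<Longrightarrow> s \<le> blinfun_apply (\<theta> m) (a n)"
  have "\<forall>n. \<exists>b. b \<in> A \<and> a n = - b" using a by auto
  from choice[OF this] obtain b where b: "\<And>n. b n \<in> A" "\<And>n. a n = - b n" by auto
  have "blinfun_apply (- \<theta> m) (b n) \<le> r" if "m < n" for m n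
    using r[OF that] by (simp add: b(2) blinfun.minus_left blinfun.minus_right)
  moreover have "s \<le> blinfun_apply (- \<theta> m) (b n)" if "n \<le> m" for m n
    using s[OF that] by (simp add: b(2) blinfun.minus_left blinfun.minus_right)
  moreover have "norm (- \<theta> n) \<le> 1" for n using \<theta> by simp
  ultimately show "s \<le> r" by (intro no_ladderD[OF A, of b "\<lambda>n. - \<theta> n" r s] b(1))
qed

text \<open>Functionals of norm at most 1 change by at most the approximation error, so a ladder in
  \<open>A\<close> gives one in \<open>B\<close> with a slightly smaller gap. This is what permits
  an infinite union of sets whose norms tend to 0.\<close>

lemma no_ladder_approx:
  fixes A :: "'a::real_normed_vector set"
  assumes "\<And>\<epsilon>. 0 < \<epsilon> \<Longrightarrow> \<exists>B. no_ladder B \<and> (\<forall>a\<in>A. \<exists>b\<in>B. norm (a - b) \<le> \<epsilon>)"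
  shows "no_ladder A"
proof (rule no_ladderI)
  fix a and \<theta> :: "nat \<Rightarrow> 'a \<Rightarrow>\<^sub>L real" and r s
  assume a: "\<And>n. a n \<in> A" and \<theta>: "\<And>n. norm (\<theta> n) \<le> 1"
    and r: "\<And>m n :: nat. m < n \<Longrightarrow> blinfun_apply (\<theta> m) (a n) \<le> r"
    and s: "\<And>m n. n \<le> m \<Longrightarrow> s \<le> blinfun_apply (\<theta> m) (a n)"
  show "s \<le> r"
  proof (rule field_le_epsilon)
    fix e :: real assume "0 < e"
    then obtain B where B: "no_ladder B" "\<And>a. a \<in> A \<Longrightarrow> \<exists>b\<in>B. norm (a - b) \<le> e / 2"
      using assms[of "e / 2"] by auto
    have "\<forall>n. \<exists>b. b \<in> B \<and> norm (a n - b) \<le> e / 2" using B(2) a by blast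
    from choice[OF this] obtain b where b: "\<And>n. b n \<in> B" "\<And>n. norm (a n - b n) \<le> e / 2"
      by auto
    have d: "\<bar>\<theta> m (a n) - \<theta> m (b n)\<bar> \<le> e / 2" for m n
      using blinfun_apply_le_norm[OF \<theta>, of m "a n - b n"] b(2)[of n]
      by (simp add: blinfun.diff_right)
    have "\<theta> m (b n) \<le> r + e / 2" if "m < n" for m n
      using r[OF that] d[of m n] by linarith
    moreover have "s - e / 2 \<le> \<theta> m (b n)" if "n \<le> m" for m n
      using s[OF that] d[of m n] by linarith
    ultimately have "s - e / 2 \<le> r + e / 2"
      by (rule no_ladderD[OF B(1) b(1) \<theta>])
    then show "s \<le> r + e" by simp
  qed
qed

section \<open>Initial topologies and weak compactness\<close>

lemma topspace_initial_topology [simp]: "topspace (initial_topology A G) = A"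
  by (auto simp: initial_topology_def)

lemma openin_initial_topology:
  assumes "g \<in> G" "open U"
  shows "openin (initial_topology A G) {a \<in> A. g a \<in> U}"
  unfolding initial_topology_def using assms by (intro topology_generated_by_Basis) auto

lemma continuous_map_initial_topology:
  "continuous_map T (initial_topology A G) h \<longleftrightarrow>
     h ` topspace T \<subseteq> A \<and> (\<forall>g\<in>G. continuous_map T euclideanreal (\<lambda>x. g (h x)))"
  (is "?L \<longleftrightarrow> ?R")
proof
  assume L: ?L
  then have img: "h ` topspace T \<subseteq> A" by (auto simp: continuous_map_def)
  have "continuous_map T euclideanreal (\<lambda>x. g (h x))" if "g \<in> G" for g
  proof (rule continuous_map_compose[OF L, of euclideanreal g, unfolded o_def])
    show "continuous_map (initial_topology A G) euclideanreal g"
      using openin_initial_topology[OF that] by (auto simp: continuous_map_def)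
  qed
  with img show ?R by auto
next
  assume R: ?R
  show ?L
    unfolding initial_topology_def
  proof (rule continuous_on_generated_topo)
    show "h ` topspace T \<subseteq> \<Union> (insert A {{a \<in> A. g a \<in> U} |g U. g \<in> G \<and> open U})"
      using R by auto
    fix U assume "U \<in> insert A {{a \<in> A. g a \<in> U} |g U. g \<in> G \<and> open U}"
    then consider "U = A" | g V where "U = {a \<in> A. g a \<in> V}" "g \<in> G" "open V" by auto
    then show "openin T (h -` U \<inter> topspace T)"
    proof cases
      case 1
      then have "h -` U \<inter> topspace T = topspace T" using R by auto
      then show ?thesis by simp
    next
      case 2
      have "openin T {x \<in> topspace T. g (h x) \<in> V}"
        using R 2 by (auto simp: continuous_map_def)
      moreover have "h -` U \<inter> topspace T = {x \<in> topspace T. g (h x) \<in> V}" using R 2 by auto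
      ultimately show ?thesis by simp
    qed
  qed
qed

lemma initial_topology_basis:
  assumes "openin (initial_topology A G) Q" "a \<in> Q"
  obtains \<Phi> \<epsilon> where "finite \<Phi>" "\<Phi> \<subseteq> G" "0 < \<epsilon>"
    "\<forall>b\<in>A. (\<forall>g\<in>\<Phi>. \<bar>g b - g a\<bar> < \<epsilon>) \<longrightarrow> b \<in> Q"
proof -
  have "generate_topology_on (insert A {{a \<in> A. g a \<in> U} | g U. g \<in> G \<and> open U}) Q"
    using assms(1) by (simp add: initial_topology_def openin_topology_generated_by_iff)
  then have "\<exists>\<Phi> \<epsilon>. finite \<Phi> \<and> \<Phi> \<subseteq> G \<and> 0 < \<epsilon> \<and>
      (\<forall>b\<in>A. (\<forall>g\<in>\<Phi>. \<bar>g b - g a\<bar> < \<epsilon>) \<longrightarrow> b \<in> Q)"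
    using assms(2)
  proof (induction rule: generate_topology_on.induct)
    case (Int P Q)
    then obtain \<Phi> \<epsilon> \<Phi>' \<epsilon>' where
      "finite \<Phi>" "\<Phi> \<subseteq> G" "0 < \<epsilon>" "\<forall>b\<in>A. (\<forall>g\<in>\<Phi>. \<bar>g b - g a\<bar> < \<epsilon>) \<longrightarrow> b \<in> P"
      "finite \<Phi>'" "\<Phi>' \<subseteq> G" "0 < \<epsilon>'" "\<forall>b\<in>A. (\<forall>g\<in>\<Phi>'. \<bar>g b - g a\<bar> < \<epsilon>') \<longrightarrow> b \<in> Q"
      by auto
    then show ?case
      by (intro exI[of _ "\<Phi> \<union> \<Phi>'"] exI[of _ "min \<epsilon> \<epsilon>'"]) auto
  next
    case (UN K)
    then obtain k where k: "k \<in> K" "a \<in> k" by auto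
    from UN.IH[OF this] k(1) show ?case by blast
  next
    case (Basis s)
    then consider "s = A" | g U where "s = {a \<in> A. g a \<in> U}" "g \<in> G" "open U" by auto
    then show ?case
    proof cases
      case 1
      then show ?thesis by (intro exI[of _ "{}"] exI[of _ 1]) auto
    next
      case 2
      with Basis.prems obtain e where "0 < e" "\<And>y. \<bar>y - g a\<bar> < e \<Longrightarrow> y \<in> U"
        by (auto simp: open_real)
      with 2 show ?thesis by (intro exI[of _ "{g}"] exI[of _ e]) auto
    qed
  qed auto
  then obtain \<Phi> \<epsilon> where "finite \<Phi>" "\<Phi> \<subseteq> G" "0 < \<epsilon>"
    "\<forall>b\<in>A. (\<forall>g\<in>\<Phi>. \<bar>g b - g a\<bar> < \<epsilon>) \<longrightarrow> b \<in> Q" by (elim exE conjE)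
  then show thesis by (rule that)
qed

text \<open>The Banach limit \<open>\<Psi>\<close> of the functionals plays the part of a weak*
  cluster point. The half-spaces where \<open>\<theta> m\<close> is at most \<open>r\<close>,
  together with the one where \<open>\<Psi>\<close> is at least \<open>s\<close>, are weakly closed,
  and finitely many of them always contain \<open>a n\<close> for large \<open>n\<close>. At a
  common point \<open>e\<close> in the compact closure, \<open>\<Psi> e\<close> is at least
  \<open>s\<close> and at most \<open>r\<close>.\<close>

lemma relatively_weakly_compact_no_ladder:
  fixes A :: "'a::real_normed_vector set"
  assumes "relatively_weakly_compact A"
  shows "no_ladder A"
proof (rule no_ladderI)
  fix a and \<theta> :: "nat \<Rightarrow> 'a \<Rightarrow>\<^sub>L real" and r s
  assume a: "\<And>n. a n \<in> A" and \<theta>: "\<And>n. norm (\<theta> n) \<le> 1"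
    and r: "\<And>m n :: nat. m < n \<Longrightarrow> \<theta> m (a n) \<le> r" and s: "\<And>m n. n \<le> m \<Longrightarrow> s \<le> \<theta> m (a n)"
  let ?T = "weak_topology :: 'a topology"
  define K where "K = ?T closure_of A"
  have bdd: "bounded (range (\<lambda>m. \<theta> m e))" for e
    using blinfun_apply_le_norm[OF \<theta>] by (intro boundedI[of _ "norm e"]) auto
  define \<Psi> where "\<Psi> e = banach_limit (\<lambda>m. \<theta> m e)" for e
  have "bounded_linear \<Psi>"
  proof (rule bounded_linear_intro)
    show "norm (\<Psi> e) \<le> norm e * 1" for e
    proof -
      have "\<theta> m e \<le> norm e" "- norm e \<le> \<theta> m e" for m
        using blinfun_apply_le_norm[OF \<theta>, of m e] by (auto simp: abs_le_iff)
      then have "\<Psi> e \<le> norm e" "- norm e \<le> \<Psi> e"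
        unfolding \<Psi>_def by (auto intro!: banach_limit_le banach_limit_ge bdd)
      then show ?thesis by (simp add: abs_le_iff)
    qed
  qed (simp_all add: \<Psi>_def blinfun.add_right blinfun.scaleR_right banach_limit_add
      banach_limit_scale bdd)
  have closed: "closedin ?T {e. \<phi> e \<in> C}" if "bounded_linear \<phi>" "closed C"
    for \<phi> :: "'a \<Rightarrow> real" and C
  proof -
    have "openin ?T {e \<in> UNIV. \<phi> e \<in> - C}"
      unfolding weak_topology_def using that by (intro openin_initial_topology) auto
    moreover have "topspace ?T - {e. \<phi> e \<in> C} = {e \<in> UNIV. \<phi> e \<in> - C}"
      by (auto simp: weak_topology_def)
    ultimately show ?thesis by (simp add: closedin_def) (simp add: weak_topology_def)
  qed
  define F where "F m = {e. \<theta> m e \<in> {..r}}" for m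
  define Fs where "Fs = insert {e. \<Psi> e \<in> {s..}} (range F)"
  have "K \<inter> \<Inter> Fs \<noteq> {}"
  proof -
    have "compactin ?T K" using assms by (simp add: K_def relatively_weakly_compact_def)
    then have fip: "(\<forall>C\<in>\<U>. closedin ?T C) \<and> (\<forall>\<F>. finite \<F> \<and> \<F> \<subseteq> \<U> \<longrightarrow> K \<inter> \<Inter>\<F> \<noteq> {})
        \<longrightarrow> K \<inter> \<Inter>\<U> \<noteq> {}" for \<U>
      unfolding compactin_fip by blast
    show ?thesis
    proof (rule fip[rule_format], intro conjI ballI allI impI)
      fix C assume "C \<in> Fs"
      then show "closedin ?T C"
        using closed[OF \<open>bounded_linear \<Psi>\<close>, of "{s..}"]
          closed[OF blinfun.bounded_linear_right, of "{..r}"]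
        by (auto simp: Fs_def F_def)
    next
      fix \<F> assume "finite \<F> \<and> \<F> \<subseteq> Fs"
      then obtain M where M: "finite M" "\<F> - {{e. \<Psi> e \<in> {s..}}} = F ` M"
        using finite_subset_image[of "\<F> - {{e. \<Psi> e \<in> {s..}}}" F UNIV] by (auto simp: Fs_def)
      obtain n where n: "\<And>m. m \<in> M \<Longrightarrow> m < n"
        using M(1) finite_nat_set_iff_bounded by auto
      have "\<forall>\<^sub>F m in sequentially. s \<le> \<theta> m (a n)"
        using s by (auto simp: eventually_sequentially)
      then have "s \<le> \<Psi> (a n)" unfolding \<Psi>_def by (intro banach_limit_ge bdd)
      have "a n \<in> C" if C: "C \<in> \<F>" for C
      proof (cases "C = {e. \<Psi> e \<in> {s..}}")
        case False
        with C have "C \<in> F ` M" using M(2) by blast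
        then obtain m where "C = F m" "m \<in> M" by auto
        then show ?thesis using r[OF n] by (simp add: F_def)
      qed (simp add: \<open>s \<le> \<Psi> (a n)\<close>)
      then have "a n \<in> \<Inter>\<F>" by blast
      moreover have "a n \<in> K"
        using a[of n] closure_of_subset[of A ?T] by (auto simp: K_def weak_topology_def)
      ultimately show "K \<inter> \<Inter>\<F> \<noteq> {}" by auto
    qed
  qed
  then obtain e where "\<And>m. \<theta> m e \<le> r" "s \<le> \<Psi> e" by (auto simp: Fs_def F_def)
  moreover from this(1) have "\<Psi> e \<le> r" unfolding \<Psi>_def by (intro banach_limit_le bdd) auto
  ultimately show "s \<le> r" by linarith
qed

text \<open>The form in which the double limit property is applied. \<open>G\<close> stands for a
  limit of elements of \<open>W\<close>, tested on functionals, and \<open>\<psi>\<close> for a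
  limit of functionals, tested on \<open>W\<close>. In turn one chooses an element that follows
  \<open>G\<close> on the functionals chosen so far and a functional that follows
  \<open>\<psi>\<close> on the elements chosen so far; the result is a ladder with bounds
  \<open>\<alpha> + \<epsilon>\<close> and \<open>\<beta> - \<epsilon>\<close>.\<close>

lemma ladder_le:
  fixes W :: "'a::real_normed_vector set" and \<Theta> :: "('a \<Rightarrow>\<^sub>L real) set"
  assumes W: "no_ladder W" and \<Theta>: "\<And>\<theta>. \<theta> \<in> \<Theta> \<Longrightarrow> norm \<theta> \<le> 1"
    and H1: "\<And>\<Theta>\<^sub>0. finite \<Theta>\<^sub>0 \<Longrightarrow> \<Theta>\<^sub>0 \<subseteq> \<Theta> \<Longrightarrow>
      \<exists>w\<in>W. \<beta> \<le> \<psi> w \<and> (\<forall>\<theta>\<in>\<Theta>\<^sub>0. blinfun_apply \<theta> w \<le> G \<theta> + \<epsilon>)"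
    and H2: "\<And>W\<^sub>0. finite W\<^sub>0 \<Longrightarrow> W\<^sub>0 \<subseteq> W \<Longrightarrow>
      \<exists>\<theta>\<in>\<Theta>. G \<theta> \<le> \<alpha> \<and> (\<forall>w\<in>W\<^sub>0. \<psi> w - \<epsilon> \<le> blinfun_apply \<theta> w)"
  shows "\<beta> - \<epsilon> \<le> \<alpha> + \<epsilon>"
proof -
  obtain f1 where f1: "\<And>\<Theta>\<^sub>0. finite \<Theta>\<^sub>0 \<Longrightarrow> \<Theta>\<^sub>0 \<subseteq> \<Theta> \<Longrightarrow> f1 \<Theta>\<^sub>0 \<in> W \<and> \<beta> \<le> \<psi> (f1 \<Theta>\<^sub>0) \<and>
      (\<forall>\<theta>\<in>\<Theta>\<^sub>0. blinfun_apply \<theta> (f1 \<Theta>\<^sub>0) \<le> G \<theta> + \<epsilon>)"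
    using H1 by metis
  obtain f2 where f2: "\<And>W\<^sub>0. finite W\<^sub>0 \<Longrightarrow> W\<^sub>0 \<subseteq> W \<Longrightarrow> f2 W\<^sub>0 \<in> \<Theta> \<and> G (f2 W\<^sub>0) \<le> \<alpha> \<and>
      (\<forall>w\<in>W\<^sub>0. \<psi> w - \<epsilon> \<le> blinfun_apply (f2 W\<^sub>0) w)"
    using H2 by metis
  \<comment> \<open>In each round the element comes first, so that the functional of the same round
    already takes it into account; this is the case \<open>n = m\<close> of the lower bound.\<close>
  define st where "st = rec_nat ({}, {}) (\<lambda>_ (W\<^sub>0, \<Theta>\<^sub>0).
    (insert (f1 \<Theta>\<^sub>0) W\<^sub>0, insert (f2 (insert (f1 \<Theta>\<^sub>0) W\<^sub>0)) \<Theta>\<^sub>0))"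
  define w where "w n = f1 (snd (st n))" for n
  define \<theta> where "\<theta> n = f2 (fst (st (Suc n)))" for n
  have st_0: "st 0 = ({}, {})" by (simp add: st_def)
  have st_Suc: "fst (st (Suc n)) = insert (w n) (fst (st n))"
    "snd (st (Suc n)) = insert (\<theta> n) (snd (st n))" for n
    by (simp_all add: st_def w_def \<theta>_def split_def)
  have inv: "finite (fst (st n)) \<and> fst (st n) \<subseteq> W \<and> finite (snd (st n)) \<and> snd (st n) \<subseteq> \<Theta>" for n
  proof (induction n)
    case (Suc n)
    then have "w n \<in> W" using f1 by (simp add: w_def)
    with Suc have "finite (fst (st (Suc n)))" "fst (st (Suc n)) \<subseteq> W" by (simp_all add: st_Suc)
    moreover from this have "\<theta> n \<in> \<Theta>" using f2 by (simp add: \<theta>_def)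
    ultimately show ?case using Suc by (simp add: st_Suc)
  qed (simp add: st_0)
  have w_mem: "w n \<in> fst (st (Suc m))" if "n \<le> m" for m n
    using that by (induction m rule: dec_induct) (auto simp: st_Suc)
  have \<theta>_mem: "\<theta> m \<in> snd (st n)" if "m < n" for m n
    using that by (induction n) (auto simp: st_Suc less_Suc_eq)
  have w: "w n \<in> W" "\<beta> \<le> \<psi> (w n)" "\<And>\<theta>. \<theta> \<in> snd (st n) \<Longrightarrow> blinfun_apply \<theta> (w n) \<le> G \<theta> + \<epsilon>" for n
    using f1[of "snd (st n)"] inv[of n] by (auto simp: w_def)
  have t: "\<theta> n \<in> \<Theta>" "G (\<theta> n) \<le> \<alpha>"
    "\<And>w. w \<in> fst (st (Suc n)) \<Longrightarrow> \<psi> w - \<epsilon> \<le> blinfun_apply (\<theta> n) w" for n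
    using f2[of "fst (st (Suc n))"] inv[of "Suc n"] by (auto simp: \<theta>_def)
  show ?thesis
  proof (rule no_ladderD[OF W w(1)])
    show "norm (\<theta> n) \<le> 1" for n using \<Theta> t(1) by auto
    show "blinfun_apply (\<theta> m) (w n) \<le> \<alpha> + \<epsilon>" if "m < n" for m n
      using w(3)[OF \<theta>_mem[OF that]] t(2)[of m] by linarith
    show "\<beta> - \<epsilon> \<le> blinfun_apply (\<theta> m) (w n)" if "n \<le> m" for m n
      using t(3)[OF w_mem[OF that]] w(2)[of n] by linarith
  qed
qed

section \<open>Krein's theorem for the double limit property, and Helly's lemma\<close>

text \<open>Indices are taken one at a time such that the intersection \<open>C\<close> of the sets
  taken so far meets infinitely many of the remaining \<open>B m\<close> in measure bounded from
  below. With finite additivity only, the measure of a limit superior of sets cannot be estimated,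
  and this selection replaces it; the ladder to be built from it uses finite intersections.\<close>

lemma finitely_additive_fip:
  fixes \<Lambda> :: "'a set \<Rightarrow> real" and B :: "nat \<Rightarrow> 'a set"
  assumes add: "\<And>C D. C \<inter> D = {} \<Longrightarrow> \<Lambda> (C \<union> D) = \<Lambda> C + \<Lambda> D"
    and nonneg: "\<And>C. 0 \<le> \<Lambda> C" and le1: "\<And>C. \<Lambda> C \<le> 1"
    and \<delta>: "0 < \<delta>" and B: "\<And>m. \<delta> \<le> \<Lambda> (B m)"
  obtains r where "strict_mono (r :: nat \<Rightarrow> nat)" "\<And>k. (\<Inter>j\<in>{..k}. B (r j)) \<noteq> {}"
proof -
  have mono: "\<Lambda> C \<le> \<Lambda> D" if "C \<subseteq> D" for C D
    using add[of C "D - C"] nonneg[of "D - C"] that by (simp add: Un_absorb1)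
  have empty: "\<Lambda> {} = 0" using add[of "{}" "{}"] by simp
  have subadd: "\<Lambda> (C \<union> D) \<le> \<Lambda> C + \<Lambda> D" for C D
    using add[of C "D - C"] mono[of "D - C" D] by simp
  have inter: "\<Lambda> (C \<union> D) = \<Lambda> C + \<Lambda> D - \<Lambda> (C \<inter> D)" for C D
  proof -
    have "\<Lambda> (C \<union> D) = \<Lambda> C + \<Lambda> (D - C)" using add[of C "D - C"] by simp
    moreover have "\<Lambda> D = \<Lambda> (C \<inter> D) + \<Lambda> (D - C)"
    proof -
      have "C \<inter> D \<union> (D - C) = D" "C \<inter> D \<inter> (D - C) = {}" by auto
      then show ?thesis using add[of "C \<inter> D" "D - C"] by simp
    qed
    ultimately show ?thesis by simp
  qed
  have Union_le: "\<Lambda> (\<Union>m\<in>F. E m) \<le> (\<Sum>m\<in>F. \<Lambda> (E m))" if "finite F" for F and E :: "nat \<Rightarrow> 'a set"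
    using that
  proof (induction F)
    case (insert m F)
    then show ?case using subadd[of "E m" "\<Union>m\<in>F. E m"] by simp
  qed (simp add: empty)
  define good where "good C M \<longleftrightarrow> infinite M \<and> (\<exists>d>0. \<forall>m\<in>M. d \<le> \<Lambda> (C \<inter> B m))" for C and M :: "nat set"
  \<comment> \<open>Otherwise the sets \<open>C \<inter> B m\<close> would contain arbitrarily many almost disjoint sets of measure
    at least \<open>d\<close>.\<close>
  have step: "\<exists>m M'. m \<in> M \<and> M' \<subseteq> M \<inter> {m<..} \<and> good (C \<inter> B m) M'" if "good C M" for C M
  proof (rule ccontr)
    assume neg: "\<not> ?thesis"
    from that obtain d where inf: "infinite M" and d: "0 < d" "\<And>m. m \<in> M \<Longrightarrow> d \<le> \<Lambda> (C \<inter> B m)"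
      by (auto simp: good_def)
    have fin: "finite {m'\<in>M. e \<le> \<Lambda> (C \<inter> B m \<inter> B m')}" if m: "m \<in> M" and e: "0 < e" for m e
    proof (rule ccontr)
      let ?M = "{m'\<in>M. e \<le> \<Lambda> (C \<inter> B m \<inter> B m')}"
      assume inf: "infinite ?M"
      have sub: "?M \<subseteq> {..m} \<union> (?M \<inter> {m<..})" by auto
      have "infinite (?M \<inter> {m<..})"
      proof
        assume "finite (?M \<inter> {m<..})"
        then have "finite ({..m} \<union> (?M \<inter> {m<..}))" by simp
        from finite_subset[OF sub this] inf show False by simp
      qed
      then have "good (C \<inter> B m) (?M \<inter> {m<..})" using e by (auto simp: good_def)
      then have "\<exists>m M'. m \<in> M \<and> M' \<subseteq> M \<inter> {m<..} \<and> good (C \<inter> B m) M'"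
        by (intro exI[of _ m] exI[of _ "?M \<inter> {m<..}"] conjI m) auto
      with neg show False by (rule notE)
    qed
    have "\<exists>F. finite F \<and> F \<subseteq> M \<and> real K * d / 2 \<le> \<Lambda> (\<Union>m\<in>F. C \<inter> B m)" for K
    proof (induction K)
      case 0
      show ?case by (rule exI[of _ "{}"]) (simp add: nonneg)
    next
      case (Suc K)
      then obtain F where F: "finite F" "F \<subseteq> M" "real K * d / 2 \<le> \<Lambda> (\<Union>m\<in>F. C \<inter> B m)" by auto
      \<comment> \<open>The new set overlaps each of the \<open>card F\<close> old ones in measure
        at most \<open>e\<close>, hence adds at least \<open>d / 2\<close> to the union.\<close>
      define e where "e = d / (2 * (real (card F) + 1))"
      have e: "0 < e" using d(1) by (simp add: e_def)
      have "finite (\<Union>m\<in>F. {m'\<in>M. e \<le> \<Lambda> (C \<inter> B m \<inter> B m')})"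
        using F e by (intro finite_UN_I fin) auto
      from Diff_infinite_finite[OF this inf] obtain m' where
        m': "m' \<in> M" "m' \<notin> (\<Union>m\<in>F. {m'\<in>M. e \<le> \<Lambda> (C \<inter> B m \<inter> B m')})"
        using infinite_imp_nonempty by blast
      have "\<Lambda> ((\<Union>m\<in>F. C \<inter> B m) \<inter> (C \<inter> B m')) = \<Lambda> (\<Union>m\<in>F. C \<inter> B m \<inter> B m')"
        by (rule arg_cong[of _ _ \<Lambda>]) auto
      also have "\<dots> \<le> (\<Sum>m\<in>F. \<Lambda> (C \<inter> B m \<inter> B m'))" by (rule Union_le[OF F(1)])
      also have "\<dots> \<le> (\<Sum>m\<in>F. e)"
      proof (rule sum_mono)
        fix m assume "m \<in> F"
        then have "m' \<notin> {m'\<in>M. e \<le> \<Lambda> (C \<inter> B m \<inter> B m')}" using m'(2) by blast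
        with m'(1) show "\<Lambda> (C \<inter> B m \<inter> B m') \<le> e" by simp
      qed
      also have "\<dots> \<le> d / 2" using d(1) by (simp add: e_def field_simps)
      finally have "real K * d / 2 + d - d / 2 \<le> \<Lambda> ((\<Union>m\<in>F. C \<inter> B m) \<union> (C \<inter> B m'))"
        using F(3) d(2)[OF m'(1)] inter[of "\<Union>m\<in>F. C \<inter> B m" "C \<inter> B m'"] by linarith
      then have "real (Suc K) * d / 2 \<le> \<Lambda> (\<Union>m\<in>insert m' F. C \<inter> B m)"
        by (simp add: field_simps Un_commute)
      with F m'(1) show ?case by (intro exI[of _ "insert m' F"]) auto
    qed
    note large = this
    obtain K :: nat where "2 / d < real K" using reals_Archimedean2 by blast
    from large[of K] obtain F where "real K * d / 2 \<le> \<Lambda> (\<Union>m\<in>F. C \<inter> B m)"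
      by (elim exE conjE)
    then have "real K * d / 2 \<le> 1" using le1[of "\<Union>m\<in>F. C \<inter> B m"] by linarith
    with \<open>2 / d < real K\<close> d(1) show False by (simp add: field_simps)
  qed
  have "\<exists>s. \<forall>n :: nat. (case s n of (m, C, M) \<Rightarrow> good C M) \<and>
    (case (s n, s (Suc n)) of ((m, C, M), (m', C', M')) \<Rightarrow>
      m' \<in> M \<and> C' = C \<inter> B m' \<and> M' \<subseteq> M \<inter> {m'<..})"
  proof (rule dependent_nat_choice)
    show "\<exists>x :: nat \<times> 'a set \<times> nat set. case x of (m, C, M) \<Rightarrow> good C M"
      by (rule exI[of _ "(0, UNIV, UNIV)"]) (use \<delta> B in \<open>auto simp: good_def\<close>)
    fix x :: "nat \<times> 'a set \<times> nat set" and n :: nat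
    obtain m C M where x: "x = (m, C, M)" by (cases x)
    assume "case x of (m, C, M) \<Rightarrow> good C M"
    then have "good C M" by (simp add: x)
    from step[OF this] obtain m' M' where
      "m' \<in> M" "M' \<subseteq> M \<inter> {m'<..}" "good (C \<inter> B m') M'" by blast
    then show "\<exists>y. (case y of (m, C, M) \<Rightarrow> good C M) \<and>
      (case (x, y) of ((m, C, M), (m', C', M')) \<Rightarrow>
        m' \<in> M \<and> C' = C \<inter> B m' \<and> M' \<subseteq> M \<inter> {m'<..})"
      by (intro exI[of _ "(m', C \<inter> B m', M')"]) (simp add: x)
  qed
  then obtain s where s: "\<forall>n :: nat. (case s n of (m, C, M) \<Rightarrow> good C M) \<and>
    (case (s n, s (Suc n)) of ((m, C, M), (m', C', M')) \<Rightarrow>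
      m' \<in> M \<and> C' = C \<inter> B m' \<and> M' \<subseteq> M \<inter> {m'<..})" by (elim exE)
  define C where "C n = fst (snd (s n))" for n
  define M where "M n = snd (snd (s n))" for n
  \<comment> \<open>The index in the state \<open>s 0\<close> is a dummy: the index drawn from
    \<open>M n\<close> is recorded in the next state.\<close>
  define r where "r n = fst (s (Suc n))" for n
  have good: "good (C n) (M n)" for n
    using s by (simp add: C_def M_def split_beta)
  have r_in: "r n \<in> M n" and C_Suc: "C (Suc n) = C n \<inter> B (r n)"
    and M_Suc: "M (Suc n) \<subseteq> M n \<inter> {r n<..}" for n
    using s[rule_format, of n] by (simp_all add: C_def M_def r_def split_beta)
  have "strict_mono r"
    unfolding strict_mono_Suc_iff using subsetD[OF M_Suc r_in] by simp
  moreover have "(\<Inter>j\<in>{..k}. B (r j)) \<noteq> {}" for k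
  proof -
    have sub: "C (Suc k) \<subseteq> (\<Inter>j\<in>{..k}. B (r j))"
      by (induction k) (auto simp: C_Suc atMost_Suc)
    obtain d where d: "0 < d" "\<forall>m\<in>M (Suc k). d \<le> \<Lambda> (C (Suc k) \<inter> B m)"
      using good[of "Suc k"] by (auto simp: good_def)
    have "d \<le> \<Lambda> (C (Suc k) \<inter> B (r (Suc k)))" using d(2) r_in by blast
    also have "\<dots> \<le> \<Lambda> (C (Suc k))" by (intro mono) simp
    finally have "C (Suc k) \<noteq> {}" using d(1) empty by force
    with sub show ?thesis by blast
  qed
  ultimately show thesis by (rule that)
qed

text \<open>Krein's theorem by the method of Ptak: otherwise the means in the ladder generate a finitely
  additive probability on \<open>A\<close> for which the functionals in the ladder stay away from their
  pointwise limit on sets of measure bounded from below.\<close>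

lemma no_ladder_convex_hull:
  fixes A :: "'a::real_normed_vector set"
  assumes A: "no_ladder A" and bound: "\<And>a. a \<in> A \<Longrightarrow> norm a \<le> 1"
  shows "no_ladder (convex hull A)"
proof (rule no_ladderI)
  fix v r s and \<theta> :: "nat \<Rightarrow> 'a \<Rightarrow>\<^sub>L real"
  assume v: "\<And>n. v n \<in> convex hull A" and \<theta>: "\<And>n. norm (\<theta> n) \<le> 1"
    and r: "\<And>m n :: nat. m < n \<Longrightarrow> blinfun_apply (\<theta> m) (v n) \<le> r"
    and s: "\<And>m n. n \<le> m \<Longrightarrow> s \<le> blinfun_apply (\<theta> m) (v n)"
  show "s \<le> r"
  proof (rule ccontr)
    assume "\<not> s \<le> r"
    \<comment> \<open>A third of the gap: the average of \<open>g - \<theta> (k m)\<close> under a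
      late mean is at least \<open>3 * d\<close>; outside \<open>B m\<close> the difference is below
      \<open>d\<close>, and it never exceeds 2, so \<open>B m\<close> carries mass at least
      \<open>d\<close>.\<close>
    define d where "d = (s - r) / 3"
    have d: "0 < d" using \<open>\<not> s \<le> r\<close> by (simp add: d_def)
    have "\<forall>n. \<exists>Sc. finite (fst Sc) \<and> fst Sc \<subseteq> A \<and> (\<forall>a\<in>fst Sc. 0 \<le> snd Sc a) \<and>
        sum (snd Sc) (fst Sc) = 1 \<and> (\<Sum>a\<in>fst Sc. snd Sc a *\<^sub>R a) = v n"
    proof
      fix n
      obtain S u where "finite S" "S \<subseteq> A" "\<forall>a\<in>S. 0 \<le> u a" "sum u S = 1" "(\<Sum>a\<in>S. u a *\<^sub>R a) = v n"
        using v[of n] by (auto simp: convex_hull_explicit)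
      then show "\<exists>Sc. finite (fst Sc) \<and> fst Sc \<subseteq> A \<and> (\<forall>a\<in>fst Sc. 0 \<le> snd Sc a) \<and>
        sum (snd Sc) (fst Sc) = 1 \<and> (\<Sum>a\<in>fst Sc. snd Sc a *\<^sub>R a) = v n"
        by (intro exI[of _ "(S, u)"]) simp
    qed
    from choice[OF this] obtain Sc where
      Sc: "\<forall>n. finite (fst (Sc n)) \<and> fst (Sc n) \<subseteq> A \<and> (\<forall>a\<in>fst (Sc n). 0 \<le> snd (Sc n) a) \<and>
        sum (snd (Sc n)) (fst (Sc n)) = 1 \<and> (\<Sum>a\<in>fst (Sc n). snd (Sc n) a *\<^sub>R a) = v n" ..
    define S where "S n = fst (Sc n)" for n
    define c where "c n = snd (Sc n)" for n
    have fin: "finite (S n)" and SA: "S n \<subseteq> A" and c0: "a \<in> S n \<Longrightarrow> 0 \<le> c n a"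
      and c1: "sum (c n) (S n) = 1" and vn: "v n = (\<Sum>a\<in>S n. c n a *\<^sub>R a)" for n a
      using Sc by (auto simp: S_def c_def)
    define T where "T = (\<Union>n. S n)"
    have TA: "T \<subseteq> A" using SA by (auto simp: T_def)
    have le1: "\<bar>\<theta> m a\<bar> \<le> 1" if "a \<in> T" for m a
      using blinfun_apply_le_norm[OF \<theta>, of m a] bound[of a] TA that by auto
    \<comment> \<open>Each mean involves finitely many points of \<open>A\<close>, so countably many
      points matter in all, and a diagonal subsequence of the functionals converges at each of
      them.\<close>
    have "countable T" using fin by (auto simp: T_def intro: countable_finite)
    then obtain k where k: "strict_mono (k :: nat \<Rightarrow> nat)"
      and kl: "\<And>a. a \<in> T \<Longrightarrow> \<exists>l. (\<lambda>m. \<theta> (k m) a) \<longlonglongrightarrow> l"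
      using function_convergent_subsequence[of T "\<lambda>m a. blinfun_apply (\<theta> m) a" 1] le1 by auto
    define g where "g a = lim (\<lambda>m. \<theta> (k m) a)" for a
    have g: "(\<lambda>m. \<theta> (k m) a) \<longlonglongrightarrow> g a" if "a \<in> T" for a
      using kl[OF that] by (auto simp: g_def limI)
    have g1: "\<bar>g a\<bar> \<le> 1" if "a \<in> T" for a
      using tendsto_rabs[OF g[OF that]] le1[OF that] by (intro LIMSEQ_le_const2) auto
    have \<theta>v: "\<theta> m (v n) = (\<Sum>a\<in>S n. c n a * \<theta> m a)" for m n
      by (simp add: vn blinfun.sum_right blinfun.scaleR_right)
    have gs: "s \<le> (\<Sum>a\<in>S n. c n a * g a)" for n
    proof (rule LIMSEQ_le_const)
      show "(\<lambda>m. \<Sum>a\<in>S n. c n a * \<theta> (k m) a) \<longlonglongrightarrow> (\<Sum>a\<in>S n. c n a * g a)"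
        by (intro tendsto_intros g) (auto simp: T_def)
      show "\<exists>N. \<forall>m\<ge>N. s \<le> (\<Sum>a\<in>S n. c n a * \<theta> (k m) a)"
        unfolding \<theta>v[symmetric]
        by (intro exI[of _ n] allI impI s order_trans[OF _ seq_suble[OF k]])
    qed
    define B where "B m = {a \<in> T. d \<le> g a - \<theta> (k m) a}" for m
    \<comment> \<open>The mass that the \<open>n\<close>-th mean gives to \<open>C\<close>; its
      Banach limit in \<open>n\<close> is the finitely additive measure.\<close>
    define p where "p C n = (\<Sum>a\<in>S n \<inter> C. c n a)" for C n
    have p0: "0 \<le> p C n" for C n unfolding p_def by (intro sum_nonneg c0) auto
    have p1: "p C n \<le> 1" for C n
      unfolding p_def c1[of n, symmetric] using fin c0 by (intro sum_mono2) auto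
    have pb: "bounded (range (p C))" for C
      using p0 p1 by (intro boundedI[of _ 1]) auto
    have pB: "d \<le> p (B m) n" if "k m < n" for m n
    proof -
      have "3 * d \<le> (\<Sum>a\<in>S n. c n a * g a) - \<theta> (k m) (v n)"
        using gs[of n] r[OF that] by (simp add: d_def)
      also have "\<dots> = (\<Sum>a\<in>S n. c n a * (g a - \<theta> (k m) a))"
        by (simp add: \<theta>v sum_subtractf right_diff_distrib)
      also have "\<dots> \<le> (\<Sum>a\<in>S n. c n a * (d + (if a \<in> B m then 2 else 0)))"
      proof (intro sum_mono mult_left_mono c0)
        fix a assume a: "a \<in> S n"
        then have "a \<in> T" by (auto simp: T_def)
        then show "g a - \<theta> (k m) a \<le> d + (if a \<in> B m then 2 else 0)"
          using g1[of a] le1[of a "k m"] d by (auto simp: B_def abs_le_iff)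
      qed
      also have "\<dots> = d * sum (c n) (S n) + 2 * (\<Sum>a\<in>S n. if a \<in> B m then c n a else 0)"
        unfolding sum_distrib_left sum.distrib[symmetric] by (intro sum.cong) (auto simp: algebra_simps)
      also have "(\<Sum>a\<in>S n. if a \<in> B m then c n a else 0) = p (B m) n"
        unfolding p_def by (rule sum.inter_restrict[OF fin, symmetric])
      finally show ?thesis by (simp add: c1)
    qed
    obtain q where q: "strict_mono (q :: nat \<Rightarrow> nat)" "\<And>i. (\<Inter>j\<in>{..i}. B (q j)) \<noteq> {}"
    proof (rule finitely_additive_fip[of "\<lambda>C. banach_limit (p C)" d B])
      show "banach_limit (p (C \<union> D)) = banach_limit (p C) + banach_limit (p D)"
        if "C \<inter> D = {}" for C D
      proof -
        have "p (C \<union> D) = (\<lambda>n. p C n + p D n)"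
          unfolding p_def Int_Un_distrib using fin that
          by (intro ext sum.union_disjoint) auto
        then show ?thesis using banach_limit_add[OF pb pb] by simp
      qed
      show "0 \<le> banach_limit (p C)" "banach_limit (p C) \<le> 1" for C
        using p0 p1 by (auto intro!: banach_limit_ge banach_limit_le pb)
      show "d \<le> banach_limit (p (B m))" for m
        by (intro banach_limit_ge pb eventually_mono[OF eventually_gt_at_top[of "k m"]] pB)
    qed (use d in auto)
    have "\<forall>i. \<exists>a. a \<in> (\<Inter>j\<in>{..i}. B (q j))" by (simp only: ex_in_conv q(2) simp_thms)
    from choice[OF this] obtain a where a: "\<And>i. a i \<in> (\<Inter>j\<in>{..i}. B (q j))" by auto
    then have aT: "a i \<in> T" for i by (auto simp: B_def)
    have "bounded (range (\<lambda>i. g (a i)))" using g1[OF aT] by (intro boundedI[of _ 1]) auto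
    from bounded_imp_convergent_subsequence[OF this] obtain \<gamma> l where
      l: "strict_mono l" "((\<lambda>i. g (a i)) \<circ> l) \<longlonglongrightarrow> \<gamma>" by blast
    \<comment> \<open>Along \<open>a (l i)\<close> the values of \<open>g\<close> are within
      \<open>e\<close> of \<open>\<gamma>\<close>, while the functionals with smaller indices are at
      most \<open>\<gamma> - d + e\<close> there; yet at each fixed point the functionals converge
      to \<open>g\<close>. The ladder gives that \<open>d\<close> is at most \<open>3 * e\<close>,
      which this choice of \<open>e\<close> excludes.\<close>
    define e where "e = d / 4"
    have e: "0 < e" using d by (simp add: e_def)
    have "\<forall>\<^sub>F i in sequentially. \<bar>g (a (l i)) - \<gamma>\<bar> < e"
      using tendstoD[OF l(2) e] by (simp add: dist_real_def)
    then obtain N where N: "\<And>i. N \<le> i \<Longrightarrow> \<bar>g (a (l i)) - \<gamma>\<bar> < e"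
      by (auto simp: eventually_sequentially)
    have "(\<gamma> - e) - e \<le> (\<gamma> - d) + e"
    proof (rule ladder_le[OF no_ladder_subset[OF A, of "range a"], where \<psi> = g and G = "\<lambda>_. \<gamma> - d" and \<Theta> = "range (\<lambda>j. \<theta> (k (q j)))"])
      fix \<Theta>\<^sub>0 assume "finite \<Theta>\<^sub>0" "\<Theta>\<^sub>0 \<subseteq> range (\<lambda>j. \<theta> (k (q j)))"
      from finite_subset_image[OF this] obtain J where
        J: "finite J" "\<Theta>\<^sub>0 = (\<lambda>j. \<theta> (k (q j))) ` J" by (elim exE conjE)
      obtain i0 where i0: "\<And>j. j \<in> J \<Longrightarrow> j < i0" using J(1) finite_nat_set_iff_bounded by auto
      define i where "i = max N i0"
      have "N \<le> i" "i0 \<le> i" by (simp_all add: i_def)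
      then have i: "i0 \<le> l i" using seq_suble[OF l(1), of i] by simp
      have g_near: "\<bar>g (a (l i)) - \<gamma>\<bar> < e" using N[OF \<open>N \<le> i\<close>] .
      show "\<exists>w\<in>range a. \<gamma> - e \<le> g w \<and> (\<forall>\<theta>\<in>\<Theta>\<^sub>0. blinfun_apply \<theta> w \<le> \<gamma> - d + e)"
      proof (rule bexI[of _ "a (l i)"], intro conjI ballI)
        show "\<gamma> - e \<le> g (a (l i))" using g_near by linarith
        fix \<theta>' assume "\<theta>' \<in> \<Theta>\<^sub>0"
        then obtain j where j: "\<theta>' = \<theta> (k (q j))" "j \<in> J" using J(2) by auto
        have "j \<in> {..l i}" using i0[OF j(2)] i by simp
        with a[of "l i"] have "a (l i) \<in> B (q j)" by blast
        then have "d \<le> g (a (l i)) - \<theta> (k (q j)) (a (l i))" by (simp add: B_def)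
        then show "\<theta>' (a (l i)) \<le> \<gamma> - d + e"
          using g_near unfolding j(1) by linarith
      qed simp
    next
      fix W\<^sub>0 assume W\<^sub>0: "finite W\<^sub>0" "W\<^sub>0 \<subseteq> range a"
      have "\<forall>\<^sub>F j in sequentially. g w - e \<le> \<theta> (k (q j)) w" if "w \<in> W\<^sub>0" for w
      proof -
        have "w \<in> T" using that W\<^sub>0(2) aT by auto
        from LIMSEQ_subseq_LIMSEQ[OF g[OF this] q(1)]
        have "\<forall>\<^sub>F j in sequentially. g w - e < \<theta> (k (q j)) w"
          unfolding o_def by (rule order_tendstoD) (use e in linarith)
        then show ?thesis by eventually_elim simp
      qed
      then have "\<forall>\<^sub>F j in sequentially. \<forall>w\<in>W\<^sub>0. g w - e \<le> \<theta> (k (q j)) w"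
        using W\<^sub>0(1) by (simp add: eventually_ball_finite)
      then obtain j where "\<forall>w\<in>W\<^sub>0. g w - e \<le> \<theta> (k (q j)) w"
        by (auto simp: eventually_sequentially)
      then show "\<exists>\<theta>\<in>range (\<lambda>j. \<theta> (k (q j))). \<gamma> - d \<le> \<gamma> - d \<and> (\<forall>w\<in>W\<^sub>0. g w - e \<le> blinfun_apply \<theta> w)"
        by (intro bexI[of _ "\<theta> (k (q j))"]) simp_all
    next
      show "range a \<subseteq> A" using aT TA by auto
      show "norm \<theta>' \<le> 1" if "\<theta>' \<in> range (\<lambda>j. \<theta> (k (q j)))" for \<theta>' using that \<theta> by auto
    qed
    then show False using d by (simp add: e_def)
  qed
qed

text \<open>Helly's lemma by least squares. If the infimum \<open>d\<close> of the squared distance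
  \<open>D\<close> to the target were positive, the hypothesis for the coefficients
  \<open>r i - f i x\<close> at a near minimizer \<open>x\<close> would give a point
  \<open>y\<close> such that \<open>D\<close> falls below \<open>d\<close> on the segment from
  \<open>x\<close> to \<open>y\<close>. As the infimum need not be attained, the decrease is
  estimated quantitatively. The lemma yields both Goldstine's theorem and the weak* density of
  combinations of evaluations.\<close>

lemma helly:
  fixes f :: "'i \<Rightarrow> 'a::real_vector \<Rightarrow> real"
  assumes T: "convex T" and I: "finite I"
    and affine: "\<And>i x y u. \<lbrakk>i \<in> I; x \<in> T; y \<in> T; 0 \<le> u; u \<le> 1\<rbrakk> \<Longrightarrow>
      f i ((1 - u) *\<^sub>R x + u *\<^sub>R y) = (1 - u) * f i x + u * f i y"
    and bound: "\<And>i t. i \<in> I \<Longrightarrow> t \<in> T \<Longrightarrow> \<bar>f i t\<bar> \<le> M"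
    and hyp: "\<And>c \<delta>. 0 < \<delta> \<Longrightarrow> \<exists>t\<in>T. (\<Sum>i\<in>I. c i * r i) - \<delta> \<le> (\<Sum>i\<in>I. c i * f i t)"
    and \<epsilon>: "0 < \<epsilon>"
  shows "\<exists>t\<in>T. \<forall>i\<in>I. \<bar>f i t - r i\<bar> \<le> \<epsilon>"
proof -
  define D where "D t = (\<Sum>i\<in>I. (f i t - r i)\<^sup>2)" for t
  define d where "d = (INF t\<in>T. D t)"
  have ne: "T \<noteq> {}" using hyp[of 1 "\<lambda>_. 0"] by auto
  have D0: "0 \<le> D t" for t by (simp add: D_def sum_nonneg)
  have bdd: "bdd_below (D ` T)" using D0 by (intro bdd_belowI2)
  have dle: "d \<le> D t" if "t \<in> T" for t unfolding d_def using bdd that by (rule cINF_lower)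
  have near: "\<exists>t\<in>T. D t < d + e" if "0 < e" for e
    using cINF_less_iff[OF ne bdd, of "d + e"] that by (simp add: d_def)
  have "d \<le> 0"
  proof (rule ccontr)
    assume "\<not> d \<le> 0"
    then have d: "0 < d" by simp
    define M' where "M' = (\<Sum>i\<in>I. (2 * M)\<^sup>2)"
    have M': "0 \<le> M'" by (simp add: M'_def sum_nonneg)
    \<comment> \<open>The step along the segment is so short that the first-order gain, about
      \<open>2 * \<eta> * d\<close>, outweighs the second-order term
      \<open>\<eta>\<^sup>2 * M'\<close> and the defects \<open>\<eta>\<^sup>2\<close> allowed in
      the choice of \<open>x\<close> and \<open>y\<close>.\<close>
    define \<eta> where "\<eta> = min (1/2) (d / (2 * (2 + M')))"
    have \<eta>: "0 < \<eta>" "\<eta> < 1" "\<eta> * (2 + M') \<le> d / 2"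
    proof -
      show "0 < \<eta>" "\<eta> < 1" using d M' by (auto simp: \<eta>_def)
      have "\<eta> * (2 + M') \<le> d / (2 * (2 + M')) * (2 + M')"
        using M' by (intro mult_right_mono) (auto simp: \<eta>_def)
      also have "\<dots> = d / 2" using M' by (simp add: field_simps)
      finally show "\<eta> * (2 + M') \<le> d / 2" .
    qed
    obtain x where x: "x \<in> T" "D x < d + \<eta>\<^sup>2" using near[of "\<eta>\<^sup>2"] \<eta>(1) by auto
    define c where "c i = r i - f i x" for i
    obtain y where y: "y \<in> T" "(\<Sum>i\<in>I. c i * r i) - \<eta>\<^sup>2 \<le> (\<Sum>i\<in>I. c i * f i y)"
      using hyp[of "\<eta>\<^sup>2" c] \<eta>(1) by auto
    define z where "z i = f i y - f i x" for i
    have Dx: "D x = (\<Sum>i\<in>I. c i * c i)"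
      by (auto simp: D_def c_def power2_eq_square algebra_simps intro!: sum.cong)
    have "(\<Sum>i\<in>I. c i * z i) = (\<Sum>i\<in>I. c i * f i y) - (\<Sum>i\<in>I. c i * r i) + D x"
      unfolding Dx by (simp add: z_def c_def sum_subtractf[symmetric] sum.distrib[symmetric] algebra_simps)
    then have cz: "d - \<eta>\<^sup>2 \<le> (\<Sum>i\<in>I. c i * z i)" using y(2) dle[OF x(1)] by linarith
    have z2: "(\<Sum>i\<in>I. (z i)\<^sup>2) \<le> M'"
      unfolding M'_def
    proof (rule sum_mono)
      fix i assume i: "i \<in> I"
      then have "\<bar>z i\<bar> \<le> 2 * M" using bound[OF i x(1)] bound[OF i y(1)] by (simp add: z_def)
      then have "\<bar>z i\<bar> \<le> \<bar>2 * M\<bar>" by linarith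
      then show "(z i)\<^sup>2 \<le> (2 * M)\<^sup>2" by (simp only: abs_le_square_iff)
    qed
    have "d \<le> D ((1 - \<eta>) *\<^sub>R x + \<eta> *\<^sub>R y)"
      using T x y \<eta> by (intro dle) (auto intro: convexD_alt)
    also have "\<dots> = (\<Sum>i\<in>I. (\<eta> * z i - c i)\<^sup>2)"
      unfolding D_def
    proof (rule sum.cong)
      fix i assume "i \<in> I"
      then have "f i ((1 - \<eta>) *\<^sub>R x + \<eta> *\<^sub>R y) - r i = \<eta> * z i - c i"
        using x(1) y(1) \<eta> by (simp add: affine z_def c_def) (simp add: algebra_simps)
      then show "(f i ((1 - \<eta>) *\<^sub>R x + \<eta> *\<^sub>R y) - r i)\<^sup>2 = (\<eta> * z i - c i)\<^sup>2"
        by (simp only:)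
    qed simp
    also have "\<dots> = D x - 2 * \<eta> * (\<Sum>i\<in>I. c i * z i) + \<eta>\<^sup>2 * (\<Sum>i\<in>I. (z i)\<^sup>2)"
      unfolding Dx sum_distrib_left sum_subtractf[symmetric] sum.distrib[symmetric]
      by (intro sum.cong) (auto simp: power2_eq_square algebra_simps)
    also have "\<dots> \<le> (d + \<eta>\<^sup>2) - 2 * \<eta> * (\<Sum>i\<in>I. c i * z i) + \<eta>\<^sup>2 * M'"
      using x(2) mult_left_mono[OF z2, of "\<eta>\<^sup>2"] by simp
    finally have "\<eta> * (2 * (\<Sum>i\<in>I. c i * z i)) \<le> \<eta> * (\<eta> * (1 + M'))"
      by (simp add: power2_eq_square algebra_simps)
    then have "2 * (\<Sum>i\<in>I. c i * z i) \<le> \<eta> * (1 + M')" using \<eta>(1) by simp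
    with cz have "2 * d \<le> \<eta> * (1 + M') + 2 * (\<eta> * \<eta>)" by (simp add: power2_eq_square)
    also have "\<dots> \<le> \<eta> * (1 + M') + 2 * (\<eta> * 1)" using \<eta> by (intro add_mono mult_left_mono) auto
    also have "\<dots> = \<eta> * (2 + M') + \<eta>" by (simp add: algebra_simps)
    finally have "2 * d \<le> \<eta> * (2 + M') + \<eta>" .
    moreover have "\<eta> \<le> \<eta> * (2 + M')" using \<eta>(1) M' by (simp add: algebra_simps)
    ultimately have "2 * d \<le> 2 * (\<eta> * (2 + M'))" by linarith
    with \<eta>(3) d show False by linarith
  qed
  then obtain t where t: "t \<in> T" "D t < \<epsilon>\<^sup>2" using near[of "\<epsilon>\<^sup>2"] \<epsilon> by force
  have "\<bar>f i t - r i\<bar> \<le> \<epsilon>" if "i \<in> I" for i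
  proof -
    have "(f i t - r i)\<^sup>2 \<le> D t" unfolding D_def using that I by (intro member_le_sum) auto
    then have "(f i t - r i)\<^sup>2 \<le> \<epsilon>\<^sup>2" using t(2) by linarith
    then show ?thesis using \<epsilon> by (simp add: abs_le_square_iff[symmetric])
  qed
  with t(1) show ?thesis by blast
qed

section \<open>Normed spaces on subspaces and translation representations\<close>

text \<open>The norm axioms of \<open>banach_on\<close> by themselves, so that facts about norms are
  available while the completeness of the spaces constructed below is still being proved.\<close>

locale normed_on =
  fixes V :: "'v::real_vector set" and N :: "'v \<Rightarrow> real"
  assumes subspace: "subspace V"
    and norm_nonneg: "v \<in> V \<Longrightarrow> 0 \<le> N v"
    and norm_eq_zero: "v \<in> V \<Longrightarrow> N v = 0 \<longleftrightarrow> v = 0"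
    and norm_scaleR: "v \<in> V \<Longrightarrow> N (c *\<^sub>R v) = \<bar>c\<bar> * N v"
    and norm_triangle: "u \<in> V \<Longrightarrow> v \<in> V \<Longrightarrow> N (u + v) \<le> N u + N v"

sublocale banach_on \<subseteq> normed_on
  by unfold_locales (fact subspace norm_nonneg norm_eq_zero norm_scaleR norm_triangle)+

context normed_on
begin

lemmas mem_simps = subspace_0[OF subspace] subspace_add[OF subspace] subspace_diff[OF subspace]
  subspace_scale[OF subspace] subspace_neg[OF subspace] subspace_sum[OF subspace]

lemma norm_zero: "N 0 = 0"
  using norm_eq_zero[OF subspace_0[OF subspace]] by simp

lemma norm_minus: "v \<in> V \<Longrightarrow> N (- v) = N v"
  using norm_scaleR[of v "-1"] by simp

lemma norm_minus_commute: "u \<in> V \<Longrightarrow> v \<in> V \<Longrightarrow> N (u - v) = N (v - u)"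
  using norm_minus[of "u - v"] by (simp add: mem_simps)

lemma norm_diff_triangle: "u \<in> V \<Longrightarrow> v \<in> V \<Longrightarrow> w \<in> V \<Longrightarrow> N (u - w) \<le> N (u - v) + N (v - w)"
  using norm_triangle[of "u - v" "v - w"] by (simp add: mem_simps)

lemma norm_diff_le: "u \<in> V \<Longrightarrow> v \<in> V \<Longrightarrow> N (u - v) \<le> N u + N v"
  using norm_triangle[of u "- v"] by (simp add: mem_simps norm_minus)

lemma norm_sum:
  assumes "finite I" "\<And>i. i \<in> I \<Longrightarrow> f i \<in> V"
  shows "N (\<Sum>i\<in>I. f i) \<le> (\<Sum>i\<in>I. N (f i))"
  using assms
proof (induction I)
  case (insert i I)
  then have "N (f i + (\<Sum>i\<in>I. f i)) \<le> N (f i) + N (\<Sum>i\<in>I. f i)"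
    by (intro norm_triangle mem_simps) auto
  with insert show ?case by simp
qed (simp add: norm_zero)

lemma metric: "Metric_space V (norm_dist V N)"
proof
  show "0 \<le> norm_dist V N u v" for u v
    by (simp add: norm_dist_def norm_nonneg mem_simps)
  show "norm_dist V N u v = norm_dist V N v u" for u v
    by (simp add: norm_dist_def norm_minus_commute)
  show "norm_dist V N u v = 0 \<longleftrightarrow> u = v" if "u \<in> V" "v \<in> V" for u v
    using that by (simp add: norm_dist_def norm_eq_zero mem_simps)
  show "norm_dist V N u w \<le> norm_dist V N u v + norm_dist V N v w"
    if "u \<in> V" "v \<in> V" "w \<in> V" for u v w
    using that by (simp add: norm_dist_def norm_diff_triangle)
qed

text \<open>A Cauchy sequence can be thinned out until its increments decay geometrically, so it is
  enough to sum such series. The rate demanded of the sum turns into an estimate for the whole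
  sequence.\<close>

lemma banach_onI:
  assumes series: "\<And>u. (\<And>k. u k \<in> V \<and> N (u k) \<le> (1/2) ^ k) \<Longrightarrow>
    \<exists>z\<in>V. \<forall>K. N (z - (\<Sum>k<K. u k)) \<le> C * (1/2) ^ K"
  shows "banach_on V N"
proof
  interpret M: Metric_space V "norm_dist V N" by (rule metric)
  show "M.mcomplete"
    unfolding M.mcomplete_def
  proof (intro allI impI)
    fix \<sigma> assume \<sigma>: "M.MCauchy \<sigma>"
    then have \<sigma>V: "\<sigma> n \<in> V" for n by (auto simp: M.MCauchy_def)
    have "\<forall>k. \<exists>m. \<forall>n n'. m \<le> n \<longrightarrow> m \<le> n' \<longrightarrow> N (\<sigma> n - \<sigma> n') \<le> (1/2) ^ k"
    proof
      fix k
      have "(0::real) < (1/2) ^ k" by simp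
      with \<sigma> obtain m where
        "\<And>n n'. m \<le> n \<Longrightarrow> m \<le> n' \<Longrightarrow> norm_dist V N (\<sigma> n) (\<sigma> n') < (1/2) ^ k"
        unfolding M.MCauchy_def by blast
      then show "\<exists>m. \<forall>n n'. m \<le> n \<longrightarrow> m \<le> n' \<longrightarrow> N (\<sigma> n - \<sigma> n') \<le> (1/2) ^ k"
        by (intro exI[of _ m]) (auto simp: norm_dist_def \<sigma>V less_imp_le)
    qed
    from choice[OF this] obtain m where
      m: "\<And>k n n'. m k \<le> n \<Longrightarrow> m k \<le> n' \<Longrightarrow> N (\<sigma> n - \<sigma> n') \<le> (1/2) ^ k" by auto
    \<comment> \<open>The partial sums of \<open>m\<close> are a monotone majorant, so that
      \<open>r k\<close> and \<open>r (Suc k)\<close> both lie beyond \<open>m k\<close>.\<close>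
    define r where "r k = (\<Sum>i\<le>k. m i)" for k
    have r1: "m k \<le> r k" for k unfolding r_def by (auto intro!: member_le_sum)
    have r: "m k \<le> r k" "m k \<le> r (Suc k)" for k using r1[of k] by (simp_all add: r_def)
    define u where "u k = \<sigma> (r (Suc k)) - \<sigma> (r k)" for k
    have "u k \<in> V \<and> N (u k) \<le> (1/2) ^ k" for k
      unfolding u_def using m[OF r(2) r(1)] \<sigma>V by (simp add: mem_simps)
    from series[OF this] obtain z where
      z: "z \<in> V" "\<And>K. N (z - (\<Sum>k<K. u k)) \<le> C * (1/2) ^ K" by blast
    have sum_u: "(\<Sum>k<K. u k) = \<sigma> (r K) - \<sigma> (r 0)" for K
      by (induction K) (simp_all add: u_def)
    define x where "x = \<sigma> (r 0) + z"
    have x: "x \<in> V" using z \<sigma>V by (simp add: x_def mem_simps)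
    have lim: "N (\<sigma> n - x) \<le> (1 + \<bar>C\<bar>) * (1/2) ^ K" if "m K \<le> n" for n K
    proof -
      have "N (\<sigma> n - x) \<le> N (\<sigma> n - \<sigma> (r K)) + N (\<sigma> (r K) - x)"
        by (intro norm_diff_triangle x \<sigma>V)
      also have "N (\<sigma> n - \<sigma> (r K)) \<le> (1/2) ^ K" by (intro m that r)
      also have "N (\<sigma> (r K) - x) = N (z - (\<Sum>k<K. u k))"
        unfolding norm_minus_commute[OF \<sigma>V x] by (simp add: sum_u x_def algebra_simps)
      also have "\<dots> \<le> \<bar>C\<bar> * (1/2) ^ K"
        by (rule order_trans[OF z(2)]) (simp add: mult_right_mono)
      finally show ?thesis by (simp add: distrib_right)
    qed
    have "limitin M.mtopology \<sigma> x sequentially"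
      unfolding M.limitin_metric
    proof (intro conjI x allI impI)
      fix \<epsilon> :: real assume "0 < \<epsilon>"
      then have "0 < \<epsilon> / (1 + \<bar>C\<bar>)" by simp
      then obtain K where "(1/2) ^ K < \<epsilon> / (1 + \<bar>C\<bar>)"
        using real_arch_pow_inv[of "\<epsilon> / (1 + \<bar>C\<bar>)" "1/2"] by auto
      then have K: "(1 + \<bar>C\<bar>) * (1/2) ^ K < \<epsilon>" by (simp add: pos_less_divide_eq mult.commute)
      show "\<forall>\<^sub>F n in sequentially. \<sigma> n \<in> V \<and> norm_dist V N (\<sigma> n) x < \<epsilon>"
        using eventually_ge_at_top[of "m K"]
      proof eventually_elim
        case (elim n)
        then show ?case using order_le_less_trans[OF lim[OF elim] K] by (simp add: norm_dist_def \<sigma>V x)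
      qed
    qed
    then show "\<exists>x. limitin M.mtopology \<sigma> x sequentially" ..
  qed
qed (fact subspace norm_nonneg norm_eq_zero norm_scaleR norm_triangle)+

lemma dualI:
  assumes "functional_on V f" "\<And>v. v \<in> V \<Longrightarrow> \<bar>f v\<bar> \<le> C * N v"
  shows "restrict f V \<in> dual V N"
proof -
  have "\<exists>C. \<forall>v\<in>V. \<bar>restrict f V v\<bar> \<le> C * N v"
    by (rule exI[of _ C]) (simp add: assms(2))
  then show ?thesis
    using assms(1) by (simp add: dual_def functional_on_def mem_simps)
qed

lemma dual_functional: "\<phi> \<in> dual V N \<Longrightarrow> functional_on V \<phi>"
  by (simp add: dual_def functional_on_def)

lemma dual_bdd_above:
  assumes "\<phi> \<in> dual V N"
  shows "bdd_above ((\<lambda>v. \<bar>\<phi> v\<bar>) ` {v \<in> V. N v \<le> 1})"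
proof -
  have "\<exists>C. \<forall>v\<in>V. \<bar>\<phi> v\<bar> \<le> C * N v" using assms by (simp add: dual_def)
  then obtain C where C: "\<And>v. v \<in> V \<Longrightarrow> \<bar>\<phi> v\<bar> \<le> C * N v" by blast
  show ?thesis
  proof (rule bdd_aboveI2)
    fix v assume v: "v \<in> {v \<in> V. N v \<le> 1}"
    then have "\<bar>\<phi> v\<bar> \<le> C * N v" by (intro C) simp
    also have "\<dots> \<le> \<bar>C\<bar> * 1" using v norm_nonneg by (intro mult_mono) auto
    finally show "\<bar>\<phi> v\<bar> \<le> \<bar>C\<bar>" by simp
  qed
qed

lemma dual_norm_upper: "\<phi> \<in> dual V N \<Longrightarrow> v \<in> V \<Longrightarrow> N v \<le> 1 \<Longrightarrow> \<bar>\<phi> v\<bar> \<le> dual_norm V N \<phi>"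
  unfolding dual_norm_def by (rule cSUP_upper2[where x = v]) (auto intro: dual_bdd_above)

lemma dual_norm_nonneg: "\<phi> \<in> dual V N \<Longrightarrow> 0 \<le> dual_norm V N \<phi>"
  using dual_norm_upper[of \<phi> 0] by (simp add: mem_simps norm_zero)

lemma dual_apply_le:
  assumes \<phi>: "\<phi> \<in> dual V N" and v: "v \<in> V"
  shows "\<bar>\<phi> v\<bar> \<le> dual_norm V N \<phi> * N v"
proof (cases "v = 0")
  case True
  then have "\<phi> v = 0" using functional_onD(2)[OF dual_functional[OF \<phi>] v, of 0] by simp
  with True show ?thesis by (simp add: norm_zero)
next
  case False
  then have pos: "0 < N v" using norm_eq_zero[OF v] norm_nonneg[OF v] by linarith
  have "\<bar>\<phi> ((1 / N v) *\<^sub>R v)\<bar> \<le> dual_norm V N \<phi>"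
    using \<phi> v pos by (intro dual_norm_upper) (auto simp: mem_simps norm_scaleR)
  then have "\<bar>\<phi> v\<bar> / N v \<le> dual_norm V N \<phi>"
    using functional_onD(2)[OF dual_functional[OF \<phi>] v, of "1 / N v"] pos by (simp add: abs_mult)
  then show ?thesis using pos by (simp add: field_simps)
qed

lemma dual_norm_le:
  assumes "0 \<le> C" "\<And>v. v \<in> V \<Longrightarrow> \<bar>\<phi> v\<bar> \<le> C * N v"
  shows "dual_norm V N \<phi> \<le> C"
  unfolding dual_norm_def
proof (rule cSUP_least)
  show "{v \<in> V. N v \<le> 1} \<noteq> {}" using mem_simps(1) norm_zero by (auto intro: exI[of _ 0])
  fix v assume v: "v \<in> {v \<in> V. N v \<le> 1}"
  then have "\<bar>\<phi> v\<bar> \<le> C * N v" by (intro assms) simp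
  also have "\<dots> \<le> C * 1" using v assms(1) by (intro mult_left_mono) auto
  finally show "\<bar>\<phi> v\<bar> \<le> C" by simp
qed

lemma dual_norm_attained:
  assumes \<phi>: "\<phi> \<in> dual V N" and "0 < e"
  obtains v where "v \<in> V" "N v \<le> 1" "dual_norm V N \<phi> - e < \<phi> v"
proof -
  have "{v \<in> V. N v \<le> 1} \<noteq> {}" using mem_simps(1) norm_zero by (auto intro: exI[of _ 0])
  then obtain v where v: "v \<in> V" "N v \<le> 1" "dual_norm V N \<phi> - e < \<bar>\<phi> v\<bar>"
    using less_cSUP_iff[OF _ dual_bdd_above[OF \<phi>], of "dual_norm V N \<phi> - e"] assms(2)
    by (auto simp: dual_norm_def)
  show thesis
  proof (cases "0 \<le> \<phi> v")
    case False
    then have "\<phi> (- v) = \<bar>\<phi> v\<bar>" using functional_on_minus[OF dual_functional[OF \<phi>] v(1)] by simp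
    with v show thesis by (intro that[of "- v"]) (auto simp: mem_simps norm_minus)
  qed (use v in \<open>auto intro: that[of v]\<close>)
qed

end

text \<open>The converse of \<open>banach_onI\<close> with an explicit rate; it carries completeness
  over to closed subspaces in \<open>separable_banach_subspace\<close> and to quotients of sums in
  \<open>c0_sum.banach_space\<close>.\<close>

lemma (in banach_on) series_converges:
  assumes C: "0 \<le> C" and u: "\<And>k. u k \<in> V" "\<And>k. N (u k) \<le> C * (1/2) ^ k"
  shows "\<exists>z\<in>V. \<forall>K. N (z - (\<Sum>k<K. u k)) \<le> 2 * C * (1/2) ^ K"
proof -
  interpret M: Metric_space V "norm_dist V N" by (rule metric)
  define s where "s K = (\<Sum>k<K. u k)" for K
  have sV: "s K \<in> V" for K unfolding s_def using u(1) by (intro mem_simps)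
  \<comment> \<open>The remainder of the geometric series is kept on the right, so that the
    induction closes.\<close>
  have diff: "N (s (K + j) - s K) \<le> 2 * C * (1/2) ^ K - 2 * C * (1/2) ^ (K + j)" for K j
  proof (induction j)
    case (Suc j)
    have "s (K + Suc j) - s K = (s (K + j) - s K) + u (K + j)" by (simp add: s_def)
    then have "N (s (K + Suc j) - s K) \<le> N (s (K + j) - s K) + N (u (K + j))"
      by (simp only:) (intro norm_triangle mem_simps sV u(1))
    also have "\<dots> \<le> (2 * C * (1/2) ^ K - 2 * C * (1/2) ^ (K + j)) + C * (1/2) ^ (K + j)"
      by (intro add_mono Suc.IH u)
    finally show ?case by simp
  qed (simp add: norm_zero)
  have diff': "N (s n - s K) \<le> 2 * C * (1/2) ^ K" if "K \<le> n" for n K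
  proof -
    have "0 \<le> 2 * C * (1/2) ^ (K + (n - K))" using C by simp
    then show ?thesis using diff[of K "n - K"] that by simp
  qed
  have "M.MCauchy s"
    unfolding M.MCauchy_def
  proof (intro conjI allI impI)
    fix \<epsilon> :: real assume "0 < \<epsilon>"
    then obtain K where K: "(1/2) ^ K < \<epsilon> / (4 * C + 1)"
      using real_arch_pow_inv[of "\<epsilon> / (4 * C + 1)" "1/2"] C by auto
    show "\<exists>m. \<forall>n n'. m \<le> n \<longrightarrow> m \<le> n' \<longrightarrow> norm_dist V N (s n) (s n') < \<epsilon>"
    proof (intro exI[of _ K] allI impI)
      fix n n' assume "K \<le> n" "K \<le> n'"
      have "N (s n - s n') \<le> N (s n - s K) + N (s n' - s K)"
        using norm_diff_triangle[of "s n" "s K" "s n'", OF sV sV sV] norm_minus_commute[of "s K" "s n'", OF sV sV] by simp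
      also have "\<dots> \<le> 4 * C * (1/2) ^ K"
        using diff'[OF \<open>K \<le> n\<close>] diff'[OF \<open>K \<le> n'\<close>] by simp
      also have "\<dots> \<le> (4 * C + 1) * (1/2) ^ K" by (intro mult_right_mono) auto
      also have "\<dots> < \<epsilon>" using K C by (simp add: field_simps)
      finally show "norm_dist V N (s n) (s n') < \<epsilon>" by (simp add: norm_dist_def sV)
    qed
  qed (use sV in auto)
  with complete obtain z where z: "limitin M.mtopology s z sequentially"
    by (auto simp: M.mcomplete_def)
  then have zV: "z \<in> V" by (simp add: M.limitin_metric)
  have "N (z - s K) \<le> 2 * C * (1/2) ^ K" for K
  proof (rule field_le_epsilon)
    fix e :: real assume "0 < e"
    with z have "\<forall>\<^sub>F n in sequentially. s n \<in> V \<and> norm_dist V N (s n) z < e"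
      by (simp add: M.limitin_metric)
    then obtain n where n: "K \<le> n" "norm_dist V N (s n) z < e"
      using eventually_happens[OF eventually_conj[OF eventually_ge_at_top[of K]]] by auto
    have "N (z - s K) \<le> N (s n - z) + N (s n - s K)"
      using norm_diff_triangle[of z "s n" "s K", OF zV sV sV] norm_minus_commute[of "s n" z, OF sV zV] by simp
    then show "N (z - s K) \<le> 2 * C * (1/2) ^ K + e"
      using n(2) diff'[OF n(1)] by (simp add: norm_dist_def sV zV)
  qed
  with zV show ?thesis by (auto simp: s_def)
qed

text \<open>Each member of a countable base is covered by those sets from the \<open>B i\<close>
  that it contains. By Lindelof's theorem countably many of them cover it, and one index is kept for
  each. A single index handles each neighbourhood, since points are separated from closed sets by
  single functions or representations.\<close>

lemma countable_subfamily_basis: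
  fixes B :: "'i \<Rightarrow> 'x::second_countable_topology set set"
  assumes op: "\<And>i G. i \<in> I \<Longrightarrow> G \<in> B i \<Longrightarrow> open G"
    and base: "\<And>U x. open U \<Longrightarrow> x \<in> U \<Longrightarrow> \<exists>i\<in>I. \<exists>G\<in>B i. x \<in> G \<and> G \<subseteq> U"
  obtains r :: "nat \<Rightarrow> 'i" where "range r \<subseteq> I"
    "\<And>U x. open U \<Longrightarrow> x \<in> U \<Longrightarrow> \<exists>n. \<exists>G\<in>B (r n). x \<in> G \<and> G \<subseteq> U"
proof -
  obtain \<B> :: "'x set set" where \<B>: "countable \<B>" "topological_basis \<B>"
    using ex_countable_basis by blast
  define F where "F U = {G. G \<subseteq> U \<and> (\<exists>i\<in>I. G \<in> B i)}" for U
  have "\<forall>U. \<exists>F'. F' \<subseteq> F U \<and> countable F' \<and> \<Union>F' = \<Union>(F U)"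
  proof
    fix U
    have "open G" if "G \<in> F U" for G using that op by (auto simp: F_def)
    then obtain F' where "F' \<subseteq> F U" "countable F'" "\<Union>F' = \<Union>(F U)" by (rule Lindelof)
    then show "\<exists>F'. F' \<subseteq> F U \<and> countable F' \<and> \<Union>F' = \<Union>(F U)" by (intro exI conjI)
  qed
  from choice[OF this] obtain F' where
    "\<forall>U. F' U \<subseteq> F U \<and> countable (F' U) \<and> \<Union>(F' U) = \<Union>(F U)" ..
  then have F': "F' U \<subseteq> F U" "countable (F' U)" "\<Union>(F' U) = \<Union>(F U)" for U by simp_all
  define \<G> where "\<G> = (\<Union>U\<in>\<B>. F' U)"
  have "countable \<G>" unfolding \<G>_def using \<B> F'(2) by (intro countable_UN) auto
  have "\<forall>G\<in>\<G>. \<exists>i. i \<in> I \<and> G \<in> B i" using F'(1) by (fastforce simp: \<G>_def F_def)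
  from bchoice[OF this] obtain i where i: "\<And>G. G \<in> \<G> \<Longrightarrow> i G \<in> I \<and> G \<in> B (i G)" by auto
  have ex: "\<exists>G\<in>\<G>. x \<in> G \<and> G \<subseteq> U" if U: "open U" "x \<in> U" for U x
  proof -
    obtain U' where U': "U' \<in> \<B>" "x \<in> U'" "U' \<subseteq> U"
      by (rule topological_basisE[OF \<B>(2) U])
    then have "open U'" using \<B>(2) by (auto intro: topological_basis_open)
    from base[OF this U'(2)] have "x \<in> \<Union>(F U')" by (auto simp: F_def)
    then have "x \<in> \<Union>(F' U')" by (simp add: F'(3))
    then obtain G where "G \<in> F' U'" "x \<in> G" by auto
    moreover from this have "G \<subseteq> U" using U'(3) F'(1)[of U'] by (auto simp: F_def)
    moreover from calculation have "G \<in> \<G>" using U'(1) by (auto simp: \<G>_def)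
    ultimately show ?thesis by blast
  qed
  then have "\<G> \<noteq> {}" using open_UNIV by blast
  define r where "r n = i (from_nat_into \<G> n)" for n
  show thesis
  proof
    show "range r \<subseteq> I"
      using i from_nat_into[OF \<open>\<G> \<noteq> {}\<close>] by (auto simp: r_def)
    fix U :: "'x set" and x assume "open U" "x \<in> U"
    then obtain G where G: "G \<in> \<G>" "x \<in> G" "G \<subseteq> U" using ex by blast
    obtain n where "from_nat_into \<G> n = G"
      using from_nat_into_surj[OF \<open>countable \<G>\<close> G(1)] by blast
    then have "G \<in> B (r n)" using i[OF G(1)] by (simp add: r_def)
    with G show "\<exists>n. \<exists>G\<in>B (r n). x \<in> G \<and> G \<subseteq> U" by blast
  qed
qed

section \<open>Translations of functions along a flow\<close>

lemma translate_apply: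
  assumes "flow act"
  shows "apply_bcontfun (translate act f s) x = apply_bcontfun f (act s x)"
proof -
  have "continuous_on UNIV (\<lambda>x. apply_bcontfun f (act s x))"
    using assms by (intro continuous_on_compose2[OF continuous_on_apply_bcontfun[of UNIV f]])
      (auto simp: flow_def)
  then have "(\<lambda>x. apply_bcontfun f (act s x)) \<in> bcontfun"
    using norm_bounded[of f] by (intro bcontfun_normI)
  then show ?thesis by (simp add: translate_def Bcontfun_inverse)
qed

lemma
  assumes "flow act"
  shows translate_add: "translate act (f + g) s = translate act f s + translate act g s"
    and translate_diff: "translate act (f - g) s = translate act f s - translate act g s"
    and translate_scaleR: "translate act (c *\<^sub>R f) s = c *\<^sub>R translate act f s"
    and translate_translate: "translate act (translate act f s) t = translate act f (s * t)"
  using assms by (auto simp: translate_apply flow_def intro!: bcontfun_eqI)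

lemma norm_translate_le: "flow act \<Longrightarrow> norm (translate act f s) \<le> norm f"
  using norm_bounded[of f] by (intro norm_bound) (simp add: translate_apply)

text \<open>The common last step of both parts. Translating by \<open>s\<close> and then by
  \<open>t\<close> is translating by \<open>s * t\<close>, which is the antihomomorphism property,
  and \<open>le\<close> places the evaluations in the dual ball. No separation axiom is imposed on
  X, hence injectivity has its own hypothesis \<open>sep\<close> beside \<open>gen\<close>, which
  says that \<open>V\<close> generates the topology.\<close>

lemma faithful_translation_representation:
  fixes act :: "'s::semitopological_semigroup \<Rightarrow> 'x::topological_space \<Rightarrow> 'x"
    and V :: "('x \<Rightarrow>\<^sub>C real) set"
  assumes act: "flow act" and "normed_on V N"
    and le: "\<And>f x. f \<in> V \<Longrightarrow> \<bar>apply_bcontfun f x\<bar> \<le> N f"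
    and inv: "\<And>f s. f \<in> V \<Longrightarrow> translate act f s \<in> V"
    and contr: "\<And>f s. f \<in> V \<Longrightarrow> N (translate act f s) \<le> N f"
    and wot: "\<And>\<phi> f. \<phi> \<in> dual V N \<Longrightarrow> f \<in> V \<Longrightarrow> continuous_on UNIV (\<lambda>s. \<phi> (translate act f s))"
    and sep: "\<And>x y. x \<noteq> y \<Longrightarrow> \<exists>f\<in>V. apply_bcontfun f x \<noteq> apply_bcontfun f y"
    and gen: "\<And>U x. open U \<Longrightarrow> x \<in> U \<Longrightarrow> \<exists>\<Phi> \<epsilon>. finite \<Phi> \<and> \<Phi> \<subseteq> V \<and> 0 < \<epsilon> \<and>
      (\<forall>y. (\<forall>f\<in>\<Phi>. \<bar>apply_bcontfun f y - apply_bcontfun f x\<bar> < \<epsilon>) \<longrightarrow> y \<in> U)"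
  shows "faithful_representation V N act (\<lambda>s. \<lambda>f\<in>V. translate act f s)
    (\<lambda>x. \<lambda>f\<in>V. apply_bcontfun f x)"
proof -
  interpret normed_on V N by fact
  define h where "h s = (\<lambda>f\<in>V. translate act f s)" for s
  define \<alpha> where "\<alpha> x = (\<lambda>f\<in>V. apply_bcontfun f x)" for x
  let ?ball = "{\<phi> \<in> dual V N. dual_norm V N \<phi> \<le> 1}"
  have \<alpha>_dual: "\<alpha> x \<in> ?ball" for x
  proof -
    have "functional_on V (\<lambda>f. apply_bcontfun f x)" by (simp add: functional_on_def)
    then have "\<alpha> x \<in> dual V N"
      unfolding \<alpha>_def by (rule dualI[where C = 1]) (simp add: le)
    moreover have "dual_norm V N (\<alpha> x) \<le> 1"
      by (rule dual_norm_le) (simp_all add: \<alpha>_def le)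
    ultimately show ?thesis by simp
  qed
  have cont\<alpha>: "continuous_map euclidean (weak_star_ball V N) \<alpha>"
    unfolding weak_star_ball_def continuous_map_initial_topology
    using \<alpha>_dual by (auto simp: \<alpha>_def)
  have h: "h s \<in> contractions V N" for s
    using inv contr by (auto simp: contractions_def h_def mem_simps translate_add[OF act]
        translate_scaleR[OF act])
  have "continuous_map euclidean (weak_operator_topology V N) h"
    unfolding weak_operator_topology_def continuous_map_initial_topology
    using h wot by (auto simp: h_def)
  then have rep: "representation V N act h \<alpha>"
    using cont\<alpha> inv
    by (simp add: representation_def h_def \<alpha>_def translate_translate[OF act] translate_apply[OF act])
  have open_nbhd: "openin (weak_star_ball V N) {\<phi> \<in> ?ball. \<forall>f\<in>\<Phi>. \<bar>\<phi> f - c f\<bar> < \<epsilon>}"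
    if "finite \<Phi>" "\<Phi> \<subseteq> V" for \<Phi> c \<epsilon>
    using that
  proof (induction \<Phi>)
    case empty
    show ?case using openin_topspace[of "weak_star_ball V N"] by (simp add: weak_star_ball_def)
  next
    case (insert f \<Phi>)
    have "openin (weak_star_ball V N) {\<phi> \<in> ?ball. \<phi> f \<in> {c f - \<epsilon><..<c f + \<epsilon>}}"
      unfolding weak_star_ball_def using insert.prems by (intro openin_initial_topology) auto
    with insert have "openin (weak_star_ball V N) ({\<phi> \<in> ?ball. \<phi> f \<in> {c f - \<epsilon><..<c f + \<epsilon>}} \<inter>
      {\<phi> \<in> ?ball. \<forall>f\<in>\<Phi>. \<bar>\<phi> f - c f\<bar> < \<epsilon>})" by (intro openin_Int) auto
    also have "\<dots> = {\<phi> \<in> ?ball. \<forall>f\<in>insert f \<Phi>. \<bar>\<phi> f - c f\<bar> < \<epsilon>}" by (auto simp: abs_diff_less_iff)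
    finally show ?case .
  qed
  let ?Y = "subtopology (weak_star_ball V N) (range \<alpha>)"
  have "homeomorphic_map euclidean ?Y \<alpha>"
  proof (rule bijective_open_imp_homeomorphic_map)
    show "continuous_map euclidean ?Y \<alpha>"
      using cont\<alpha> by (simp add: continuous_map_in_subtopology)
    show "\<alpha> ` topspace euclidean = topspace ?Y"
      using \<alpha>_dual by (auto simp: weak_star_ball_def)
    show "inj_on \<alpha> (topspace euclidean)"
    proof (rule inj_onI, rule ccontr)
      fix x y assume eq: "\<alpha> x = \<alpha> y" and "x \<noteq> y"
      then obtain f where "f \<in> V" "apply_bcontfun f x \<noteq> apply_bcontfun f y" using sep by blast
      with fun_cong[OF eq, of f] show False by (simp add: \<alpha>_def)
    qed
    show "open_map euclidean ?Y \<alpha>"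
      unfolding open_map_def
    proof (intro allI impI)
      fix U :: "'x set" assume "openin euclidean U"
      then have U: "open U" by simp
      show "openin ?Y (\<alpha> ` U)"
      proof (subst openin_subopen, intro ballI)
        fix \<psi> assume "\<psi> \<in> \<alpha> ` U"
        then obtain x where x: "x \<in> U" "\<psi> = \<alpha> x" by auto
        from gen[OF U x(1)] obtain \<Phi> \<epsilon> where \<Phi>: "finite \<Phi>" "\<Phi> \<subseteq> V" "0 < \<epsilon>"
          "\<forall>y. (\<forall>f\<in>\<Phi>. \<bar>apply_bcontfun f y - apply_bcontfun f x\<bar> < \<epsilon>) \<longrightarrow> y \<in> U"
          by (elim exE conjE)
        define Q where "Q = {\<phi> \<in> ?ball. \<forall>f\<in>\<Phi>. \<bar>\<phi> f - apply_bcontfun f x\<bar> < \<epsilon>}"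
        have app: "\<alpha> y f = apply_bcontfun f y" if "f \<in> \<Phi>" for y f
          using that \<Phi>(2) by (auto simp: \<alpha>_def)
        have "openin ?Y (Q \<inter> range \<alpha>)"
          unfolding Q_def using open_nbhd[OF \<Phi>(1,2)] by (intro openin_subtopology_Int) auto
        moreover have "\<psi> \<in> Q \<inter> range \<alpha>" using \<alpha>_dual[of x] x \<Phi>(3) by (auto simp: Q_def app)
        moreover have "Q \<inter> range \<alpha> \<subseteq> \<alpha> ` U"
        proof
          fix \<xi> assume "\<xi> \<in> Q \<inter> range \<alpha>"
          then obtain y where y: "\<xi> = \<alpha> y" "\<alpha> y \<in> Q" by auto
          then have "y \<in> U" using \<Phi>(4) by (auto simp: Q_def app)
          with y show "\<xi> \<in> \<alpha> ` U" by simp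
        qed
        ultimately show "\<exists>T. openin ?Y T \<and> \<psi> \<in> T \<and> T \<subseteq> \<alpha> ` U" by blast
      qed
    qed
  qed
  then have "embedding_map euclidean (weak_star_ball V N) \<alpha>" by (simp add: embedding_map_def)
  with rep show ?thesis
    by (simp add: faithful_representation_def h_def[abs_def] \<alpha>_def[abs_def])
qed

section \<open>Interpolation spaces\<close>

locale interpolation =
  fixes W :: "'a::banach set"
  assumes convex: "convex W" and zero: "0 \<in> W"
    and neg: "w \<in> W \<Longrightarrow> - w \<in> W" and norm_le_1: "w \<in> W \<Longrightarrow> norm w \<le> 1"
begin

lemma scale_mem: "w \<in> W \<Longrightarrow> 0 \<le> c \<Longrightarrow> c \<le> 1 \<Longrightarrow> c *\<^sub>R w \<in> W"
  using convexD_alt[OF convex zero, of w c] by simp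

text \<open>Up to a factor of 2 this is the Minkowski functional of 2^n W + 2^-n B, with B the unit
  ball: that functional is the infimum of the maximum of the same two terms. For the sum, the
  triangle inequality follows term by term from the convexity of \<open>W\<close>.\<close>

definition gauge :: "nat \<Rightarrow> 'a \<Rightarrow> real" where
  "gauge n v = (INF (t, w)\<in>{0..} \<times> W. (1/2) ^ n * t + 2 ^ n * norm (v - t *\<^sub>R w))"

lemma gauge_lower: "0 \<le> t \<Longrightarrow> w \<in> W \<Longrightarrow> gauge n v \<le> (1/2) ^ n * t + 2 ^ n * norm (v - t *\<^sub>R w)"
  unfolding gauge_def
  by (rule cINF_lower2[where x = "(t, w)"]) (auto intro!: bdd_belowI2[of _ 0])

lemma gauge_greatest:
  assumes "\<And>t w. 0 \<le> t \<Longrightarrow> w \<in> W \<Longrightarrow> c \<le> (1/2) ^ n * t + 2 ^ n * norm (v - t *\<^sub>R w)"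
  shows "c \<le> gauge n v"
  unfolding gauge_def using zero assms by (intro cINF_greatest) auto

lemma gauge_less:
  assumes "gauge n v < c"
  obtains t w where "0 \<le> t" "w \<in> W" "(1/2) ^ n * t + 2 ^ n * norm (v - t *\<^sub>R w) < c"
proof -
  have "\<exists>t w. 0 \<le> t \<and> w \<in> W \<and> (1/2) ^ n * t + 2 ^ n * norm (v - t *\<^sub>R w) < c"
  proof (rule ccontr)
    assume *: "\<not> ?thesis"
    have "c \<le> gauge n v"
    proof (rule gauge_greatest, rule ccontr)
      fix t w assume "0 \<le> t" "w \<in> W" "\<not> c \<le> (1/2) ^ n * t + 2 ^ n * norm (v - t *\<^sub>R w)"
      with * show False unfolding not_le by blast
    qed
    with assms show False by simp
  qed
  then show thesis by (elim exE conjE) (rule that)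
qed

lemma gauge_nonneg: "0 \<le> gauge n v"
  by (rule gauge_greatest) simp

lemma gauge_le_norm: "gauge n v \<le> 2 ^ n * norm v"
  using gauge_lower[of 0 0 n v] zero by simp

lemma gauge_mem: "w \<in> W \<Longrightarrow> gauge n w \<le> (1/2) ^ n"
  using gauge_lower[of 1 w n w] by simp

lemma norm_le_gauge: "norm v \<le> gauge 0 v"
proof (rule gauge_greatest)
  fix t :: real and w assume tw: "0 \<le> t" "w \<in> W"
  have "norm v \<le> norm (v - t *\<^sub>R w) + norm (t *\<^sub>R w)" using norm_triangle_ineq[of "v - t *\<^sub>R w" "t *\<^sub>R w"] by simp
  also have "norm (t *\<^sub>R w) \<le> t"
    using mult_left_mono[OF norm_le_1[OF tw(2)] tw(1)] tw(1) by simp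
  finally show "norm v \<le> (1 / 2) ^ 0 * t + 2 ^ 0 * norm (v - t *\<^sub>R w)" by simp
qed

lemma gauge_triangle: "gauge n (u + v) \<le> gauge n u + gauge n v"
proof -
  have "gauge n (u + v) - gauge n v \<le> (1/2) ^ n * t + 2 ^ n * norm (u - t *\<^sub>R w)"
    if tw: "0 \<le> t" "w \<in> W" for t w
  proof -
    have "gauge n (u + v) - ((1/2) ^ n * t + 2 ^ n * norm (u - t *\<^sub>R w)) \<le> gauge n v"
    proof (rule gauge_greatest)
      fix t' :: real and w' assume tw': "0 \<le> t'" "w' \<in> W"
      \<comment> \<open>Convexity merges two multiples of elements of \<open>W\<close> into one; the
        quotients are undefined only if \<open>t\<close> and \<open>t'\<close> both vanish.\<close>
      obtain w'' where w'': "w'' \<in> W" "(t + t') *\<^sub>R w'' = t *\<^sub>R w + t' *\<^sub>R w'"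
      proof (cases "t + t' = 0")
        case True
        then have "t = 0" "t' = 0" using tw tw' by auto
        then show thesis using zero by (intro that[of 0]) simp_all
      next
        case False
        let ?w = "(t / (t + t')) *\<^sub>R w + (t' / (t + t')) *\<^sub>R w'"
        have "?w \<in> W"
          using tw tw' False by (intro convexD[OF convex]) (simp_all add: add_divide_distrib[symmetric])
        moreover have "(t + t') *\<^sub>R ?w = t *\<^sub>R w + t' *\<^sub>R w'" using False by (simp add: scaleR_add_right)
        ultimately show thesis by (rule that)
      qed
      have "gauge n (u + v) \<le> (1/2) ^ n * (t + t') + 2 ^ n * norm ((u + v) - (t + t') *\<^sub>R w'')"
        using tw tw' w'' by (intro gauge_lower) auto
      also have "(u + v) - (t + t') *\<^sub>R w'' = (u - t *\<^sub>R w) + (v - t' *\<^sub>R w')"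
        by (simp add: w''(2))
      also have "2 ^ n * norm \<dots> \<le> 2 ^ n * (norm (u - t *\<^sub>R w) + norm (v - t' *\<^sub>R w'))"
        by (intro mult_left_mono norm_triangle_ineq) simp
      finally show "gauge n (u + v) - ((1/2) ^ n * t + 2 ^ n * norm (u - t *\<^sub>R w)) \<le>
          (1/2) ^ n * t' + 2 ^ n * norm (v - t' *\<^sub>R w')"
        by (simp add: algebra_simps)
    qed
    then show ?thesis by linarith
  qed
  then have "gauge n (u + v) - gauge n v \<le> gauge n u" by (rule gauge_greatest)
  then show ?thesis by linarith
qed

lemma gauge_scaleR_le: "gauge n (c *\<^sub>R v) \<le> \<bar>c\<bar> * gauge n v"
proof (cases "c = 0")
  case True
  then show ?thesis using gauge_le_norm[of n 0] by simp
next
  case False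
  have "gauge n (c *\<^sub>R v) / \<bar>c\<bar> \<le> gauge n v"
  proof (rule gauge_greatest)
    fix t :: real and w assume tw: "0 \<le> t" "w \<in> W"
    have "sgn c *\<^sub>R w \<in> W" using tw(2) neg by (simp add: sgn_real_def zero)
    then have "gauge n (c *\<^sub>R v) \<le>
        (1/2) ^ n * (\<bar>c\<bar> * t) + 2 ^ n * norm (c *\<^sub>R v - (\<bar>c\<bar> * t) *\<^sub>R sgn c *\<^sub>R w)"
      using tw by (intro gauge_lower) auto
    also have "(\<bar>c\<bar> * t) *\<^sub>R sgn c *\<^sub>R w = c *\<^sub>R t *\<^sub>R w"
      by (simp add: abs_sgn_eq sgn_real_def)
    also have "c *\<^sub>R v - c *\<^sub>R t *\<^sub>R w = c *\<^sub>R (v - t *\<^sub>R w)" by (simp add: scaleR_diff_right)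
    also have "(1/2) ^ n * (\<bar>c\<bar> * t) + 2 ^ n * norm (c *\<^sub>R (v - t *\<^sub>R w)) =
        \<bar>c\<bar> * ((1/2) ^ n * t + 2 ^ n * norm (v - t *\<^sub>R w))"
      by (simp only: norm_scaleR distrib_left mult_ac)
    finally have "gauge n (c *\<^sub>R v) \<le> \<bar>c\<bar> * ((1/2) ^ n * t + 2 ^ n * norm (v - t *\<^sub>R w))" .
    then show "gauge n (c *\<^sub>R v) / \<bar>c\<bar> \<le> (1/2) ^ n * t + 2 ^ n * norm (v - t *\<^sub>R w)"
      using False by (simp add: field_simps)
  qed
  then show ?thesis using False by (simp add: field_simps)
qed

lemma gauge_scaleR: "gauge n (c *\<^sub>R v) = \<bar>c\<bar> * gauge n v"
proof (rule antisym[OF gauge_scaleR_le])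
  show "\<bar>c\<bar> * gauge n v \<le> gauge n (c *\<^sub>R v)"
  proof (cases "c = 0")
    case False
    then have "gauge n v \<le> \<bar>1 / c\<bar> * gauge n (c *\<^sub>R v)"
      using gauge_scaleR_le[of n "1 / c" "c *\<^sub>R v"] by simp
    with False show ?thesis by (simp add: field_simps)
  qed (simp add: gauge_nonneg)
qed

lemma gauge_zero: "gauge n 0 = 0"
  using gauge_scaleR[of n 0 0] by simp

lemma gauge_diff_le: "\<bar>gauge n u - gauge n v\<bar> \<le> 2 ^ n * norm (u - v)"
  using gauge_triangle[of n "u - v" v] gauge_triangle[of n "v - u" u]
    gauge_le_norm[of n "u - v"] gauge_le_norm[of n "v - u"] norm_minus_commute[of u v]
  by simp

lemma tendsto_gauge:
  assumes "(f \<longlongrightarrow> z) F"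
  shows "((\<lambda>x. gauge n (f x)) \<longlongrightarrow> gauge n z) F"
proof (rule LIM_zero_cancel, rule Lim_null_comparison)
  show "((\<lambda>x. 2 ^ n * norm (f x - z)) \<longlongrightarrow> 0) F"
    by (intro tendsto_mult_right_zero tendsto_norm_zero LIM_zero assms)
qed (simp add: gauge_diff_le)

lemma gauge_sublinear: "sublinear_on UNIV (gauge n)"
  by (simp add: sublinear_on_def gauge_triangle gauge_scaleR)

text \<open>Quadratic summation of the gauges is what makes the space reflexive for suitable
  \<open>W\<close>: it lies behind \<open>almost_orthogonal\<close>, and the Cauchy-Schwarz
  inequality bounds the functionals with which \<open>reflexive_space\<close> tests
  membership.\<close>

definition space :: "'a set" where
  "space = {v. summable (\<lambda>n. (gauge n v)\<^sup>2)}"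

definition nrm :: "'a \<Rightarrow> real" where
  "nrm v = sqrt (\<Sum>n. (gauge n v)\<^sup>2)"

lemma sum_gauge_le:
  assumes "v \<in> space"
  shows "(\<Sum>n<m. (gauge n v)\<^sup>2) \<le> (nrm v)\<^sup>2"
proof -
  have s: "summable (\<lambda>n. (gauge n v)\<^sup>2)" using assms by (simp add: space_def)
  then have "0 \<le> (\<Sum>n. (gauge n v)\<^sup>2)" by (intro suminf_nonneg) auto
  then show ?thesis using s by (simp add: nrm_def sum_le_suminf)
qed

lemma nrm_nonneg: "0 \<le> nrm v" if "v \<in> space"
  using that unfolding nrm_def space_def by (auto intro!: suminf_nonneg)

lemma L2_set_gauge_le: "v \<in> space \<Longrightarrow> L2_set (\<lambda>n. gauge n v) {..<m} \<le> nrm v"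
  unfolding L2_set_def using sum_gauge_le[of v m] nrm_nonneg by (intro real_le_lsqrt) auto

lemma space_nrm_leI:
  assumes C: "0 \<le> C" and le: "\<And>m. (\<Sum>n<m. (gauge n v)\<^sup>2) \<le> C\<^sup>2"
  shows "v \<in> space" "nrm v \<le> C"
proof -
  have s: "summable (\<lambda>n. (gauge n v)\<^sup>2)"
    by (rule summableI_nonneg_bounded[OF _ le]) simp
  then show "v \<in> space" by (simp add: space_def)
  have "(\<Sum>n. (gauge n v)\<^sup>2) \<le> C\<^sup>2" using s le by (intro suminf_le_const) auto
  then show "nrm v \<le> C" unfolding nrm_def using C by (intro real_le_lsqrt) auto
qed

lemma space_nrm_leI':
  assumes C: "0 \<le> C" and le: "\<And>m. L2_set (\<lambda>n. gauge n v) {..<m} \<le> C"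
  shows "v \<in> space" "nrm v \<le> C"
proof -
  have "(\<Sum>n<m. (gauge n v)\<^sup>2) \<le> C\<^sup>2" for m
    using le[of m] unfolding L2_set_def by (rule sqrt_le_D)
  then show "v \<in> space" "nrm v \<le> C" by (rule space_nrm_leI[OF C])+
qed

lemma gauge_le_nrm: "v \<in> space \<Longrightarrow> gauge n v \<le> nrm v"
proof -
  assume v: "v \<in> space"
  have "(gauge n v)\<^sup>2 \<le> (\<Sum>n<Suc n. (gauge n v)\<^sup>2)" by (rule member_le_sum) auto
  also have "\<dots> \<le> (nrm v)\<^sup>2" by (rule sum_gauge_le[OF v])
  finally show ?thesis using nrm_nonneg[OF v] by (rule power2_le_imp_le)
qed

lemma norm_le_nrm: "v \<in> space \<Longrightarrow> norm v \<le> nrm v"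
  using norm_le_gauge[of v] gauge_le_nrm[of v 0] by linarith

lemma nrm_add:
  assumes "u \<in> space" "v \<in> space"
  shows "u + v \<in> space" "nrm (u + v) \<le> nrm u + nrm v"
proof -
  have "L2_set (\<lambda>n. gauge n (u + v)) {..<m} \<le> nrm u + nrm v" for m
  proof -
    have "L2_set (\<lambda>n. gauge n (u + v)) {..<m} \<le> L2_set (\<lambda>n. gauge n u + gauge n v) {..<m}"
      by (intro L2_set_mono gauge_triangle gauge_nonneg)
    also have "\<dots> \<le> L2_set (\<lambda>n. gauge n u) {..<m} + L2_set (\<lambda>n. gauge n v) {..<m}"
      by (rule L2_set_triangle_ineq)
    also have "\<dots> \<le> nrm u + nrm v" by (intro add_mono L2_set_gauge_le assms)
    finally show ?thesis .
  qed
  moreover have "0 \<le> nrm u + nrm v" by (intro add_nonneg_nonneg nrm_nonneg assms)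
  ultimately show "u + v \<in> space" "nrm (u + v) \<le> nrm u + nrm v"
    using space_nrm_leI'[of "nrm u + nrm v" "u + v"] by blast+
qed

lemma nrm_scaleR:
  assumes "v \<in> space"
  shows "c *\<^sub>R v \<in> space" "nrm (c *\<^sub>R v) = \<bar>c\<bar> * nrm v"
proof -
  have s: "summable (\<lambda>n. (gauge n v)\<^sup>2)" using assms by (simp add: space_def)
  then show "c *\<^sub>R v \<in> space" by (simp add: space_def gauge_scaleR power_mult_distrib summable_mult)
  show "nrm (c *\<^sub>R v) = \<bar>c\<bar> * nrm v"
    using suminf_mult[OF s, of "c\<^sup>2"]
    by (simp add: nrm_def gauge_scaleR power_mult_distrib real_sqrt_mult)
qed

lemma zero_mem_space: "0 \<in> space"
  by (simp add: space_def gauge_zero)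

sublocale normed_on space nrm
proof
  show "subspace space"
    by (simp add: subspace_def zero_mem_space nrm_add(1) nrm_scaleR(1))
  show "nrm v = 0 \<longleftrightarrow> v = 0" if "v \<in> space" for v
  proof
    show "v = 0" if "nrm v = 0" using norm_le_nrm[OF \<open>v \<in> space\<close>] that by simp
    show "nrm v = 0" if "v = 0" using that by (simp add: nrm_def gauge_zero)
  qed
qed (simp_all add: nrm_nonneg nrm_add(2) nrm_scaleR(2))

lemma W_subset_space:
  assumes "w \<in> W"
  shows "w \<in> space" "nrm w \<le> 2"
proof -
  have "(\<Sum>n<m. (gauge n w)\<^sup>2) \<le> 2\<^sup>2" for m
  proof -
    have "(\<Sum>n<m. (gauge n w)\<^sup>2) \<le> (\<Sum>n<m. (1/2) ^ n)"
    proof (rule sum_mono)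
      fix n
      have "(gauge n w)\<^sup>2 \<le> ((1/2) ^ n)\<^sup>2"
        using gauge_mem[OF assms, of n] gauge_nonneg[of n w] by (intro power_mono)
      also have "\<dots> \<le> ((1/2) ^ n)" unfolding power2_eq_square
        by (rule mult_left_le_one_le) (simp_all add: power_le_one)
      finally show "(gauge n w)\<^sup>2 \<le> (1/2) ^ n" .
    qed
    also have "\<dots> \<le> 2" by (simp add: geometric_sum)
    finally show ?thesis by simp
  qed
  then show "w \<in> space" "nrm w \<le> 2" using space_nrm_leI[of 2 w] by simp_all
qed

text \<open>The series converges in the ambient Banach space because \<open>nrm\<close> dominates
  its norm. The bound for \<open>nrm\<close> passes to the limit since it only concerns finite sums
  of squares of gauges, and each gauge is continuous.\<close>

lemma banach_space: "banach_on space nrm"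
proof (rule banach_onI)
  fix u assume "\<And>k. u k \<in> space \<and> nrm (u k) \<le> (1/2) ^ k"
  then have u: "u k \<in> space" "nrm (u k) \<le> (1/2) ^ k" for k by auto
  have "norm (u k) \<le> (1/2) ^ k" for k using norm_le_nrm[OF u(1)] u(2) by (rule order_trans)
  then have su: "summable u" 
    by (intro summable_comparison_test'[OF summable_geometric[of "1/2 :: real"]]) auto
  define z where "z = suminf u"
  have lim: "(\<lambda>M. \<Sum>k<M. u k) \<longlonglongrightarrow> z" unfolding z_def by (rule summable_LIMSEQ[OF su])
  have tail: "z - (\<Sum>k<K. u k) \<in> space \<and> nrm (z - (\<Sum>k<K. u k)) \<le> 2 * (1/2) ^ K" for K
  proof -
    have part: "(\<Sum>k\<in>{K..<K + M}. u k) \<in> space \<and> nrm (\<Sum>k\<in>{K..<K + M}. u k) \<le> 2 * (1/2) ^ K" for M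
    proof
      show "(\<Sum>k\<in>{K..<K + M}. u k) \<in> space" by (intro mem_simps u)
      have "nrm (\<Sum>k\<in>{K..<K + M}. u k) \<le> (\<Sum>k\<in>{K..<K + M}. nrm (u k))" by (intro norm_sum u) simp
      also have "\<dots> \<le> (\<Sum>k\<in>{K..<K + M}. (1/2) ^ k)" by (intro sum_mono u)
      also have "\<dots> \<le> 2 * (1/2) ^ K"
      proof -
        have "(\<Sum>k\<in>{K..<K + M}. (1/2) ^ k) = 2 * (1/2) ^ K - 2 * (1/2 :: real) ^ (K + M)"
          by (induction M) simp_all
        then show ?thesis by simp
      qed
      finally show "nrm (\<Sum>k\<in>{K..<K + M}. u k) \<le> 2 * (1/2) ^ K" .
    qed
    have "(\<Sum>n<m. (gauge n (z - (\<Sum>k<K. u k)))\<^sup>2) \<le> (2 * (1/2) ^ K)\<^sup>2" for m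
    proof (rule LIMSEQ_le_const2)
      have cont: "(\<lambda>M. gauge n (\<Sum>k\<in>{K..<K + M}. u k)) \<longlonglongrightarrow> gauge n (z - (\<Sum>k<K. u k))" for n
      proof (rule tendsto_gauge)
        have "(\<Sum>k\<in>{K..<K + M}. u k) = (\<Sum>k<M + K. u k) - (\<Sum>k<K. u k)" for M
          by (induction M) (simp_all add: add.commute)
        then show "(\<lambda>M. \<Sum>k\<in>{K..<K + M}. u k) \<longlonglongrightarrow> z - (\<Sum>k<K. u k)"
          by (simp only:) (intro tendsto_diff tendsto_const LIMSEQ_ignore_initial_segment lim)
      qed
      show "(\<lambda>M. \<Sum>n<m. (gauge n (\<Sum>k\<in>{K..<K + M}. u k))\<^sup>2)
          \<longlonglongrightarrow> (\<Sum>n<m. (gauge n (z - (\<Sum>k<K. u k)))\<^sup>2)"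
        by (intro tendsto_intros cont)
      show "\<exists>M0. \<forall>M\<ge>M0. (\<Sum>n<m. (gauge n (\<Sum>k\<in>{K..<K + M}. u k))\<^sup>2) \<le> (2 * (1/2) ^ K)\<^sup>2"
      proof (intro exI[of _ 0] allI impI)
        fix M
        have "(\<Sum>n<m. (gauge n (\<Sum>k\<in>{K..<K + M}. u k))\<^sup>2) \<le> (nrm (\<Sum>k\<in>{K..<K + M}. u k))\<^sup>2"
          using part by (intro sum_gauge_le) blast
        also have "\<dots> \<le> (2 * (1/2) ^ K)\<^sup>2" using part nrm_nonneg by (intro power_mono) blast+
        finally show "(\<Sum>n<m. (gauge n (\<Sum>k\<in>{K..<K + M}. u k))\<^sup>2) \<le> (2 * (1/2) ^ K)\<^sup>2" .
      qed
    qed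
    then show ?thesis by (intro conjI space_nrm_leI[of "2 * (1/2) ^ K"]) simp_all
  qed
  show "\<exists>z\<in>space. \<forall>K. nrm (z - (\<Sum>k<K. u k)) \<le> 2 * (1/2) ^ K"
  proof
    show "z \<in> space" using tail[of 0] by simp
  qed (use tail in blast)
qed

text \<open>Hahn-Banach from the line through \<open>v\<close>; the extension is continuous because
  a gauge is at most a multiple of the norm. In \<open>reflexive_space\<close> these functionals
  show that a point of the ambient space belongs to \<open>space\<close>.\<close>

lemma norming_functional:
  obtains \<psi> :: "'a \<Rightarrow>\<^sub>L real"
  where "\<And>u. \<bar>blinfun_apply \<psi> u\<bar> \<le> gauge n u" "blinfun_apply \<psi> v = gauge n v"
proof (cases "v = 0")
  case True
  then show thesis by (intro that[of 0]) (simp_all add: gauge_nonneg gauge_zero)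
next
  case False
  define f where "f w = (THE c. w = c *\<^sub>R v) * gauge n v" for w
  have f: "f (c *\<^sub>R v) = c * gauge n v" for c
  proof -
    have "(THE c'. c *\<^sub>R v = c' *\<^sub>R v) = c" using False by (intro the_equality) auto
    then show ?thesis by (simp add: f_def)
  qed
  have W: "subspace (range (\<lambda>c. c *\<^sub>R v))"
    by (auto simp: subspace_def scaleR_add_left[symmetric] intro: rangeI image_eqI[of _ _ 0])
  have lin: "functional_on (range (\<lambda>c. c *\<^sub>R v)) f"
    by (auto simp: functional_on_def f scaleR_add_left[symmetric] distrib_right)
  have le: "f w \<le> gauge n w" if "w \<in> range (\<lambda>c. c *\<^sub>R v)" for w
    using that gauge_nonneg[of n v] by (auto simp: f gauge_scaleR mult_right_mono)
  obtain g where g: "functional_on UNIV g" "\<And>u. u \<in> UNIV \<Longrightarrow> g u \<le> gauge n u"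
    "\<And>w. w \<in> range (\<lambda>c. c *\<^sub>R v) \<Longrightarrow> g w = f w"
    by (rule hahn_banach[OF subspace_UNIV gauge_sublinear W subset_UNIV lin le]) (assumption, rule that)
  have g_le: "\<bar>g u\<bar> \<le> gauge n u" for u
    using g(2)[of u] g(2)[of "- u"] functional_on_minus[OF g(1), of u] gauge_scaleR[of n "-1" u]
    by (simp add: abs_le_iff)
  have "bounded_linear g"
  proof (rule bounded_linear_intro)
    show "norm (g u) \<le> norm u * 2 ^ n" for u
      using g_le[of u] gauge_le_norm[of n u] by (simp add: mult.commute)
  qed (use g(1) in \<open>auto simp: functional_on_def\<close>)
  moreover have "g v = gauge n v"
    using g(3)[OF rangeI, of 1] f[of 1] by simp
  ultimately show thesis
    using g_le by (intro that[of "Blinfun g"]) (simp_all add: bounded_linear_Blinfun_apply)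
qed

end

section \<open>Dual and bidual of the interpolation space\<close>

context normed_on
begin

lemma bidual_add:
  "F \<in> bidual V N \<Longrightarrow> \<phi> \<in> dual V N \<Longrightarrow> \<psi> \<in> dual V N \<Longrightarrow>
    F (\<lambda>v\<in>V. \<phi> v + \<psi> v) = F \<phi> + F \<psi>"
  by (simp add: bidual_def)

lemma bidual_scale:
  "F \<in> bidual V N \<Longrightarrow> \<phi> \<in> dual V N \<Longrightarrow> F (\<lambda>v\<in>V. c * \<phi> v) = c * F \<phi>"
  by (simp add: bidual_def)

end

context interpolation
begin

text \<open>If \<open>u'\<close> is small in the original norm, then the initial gauges of \<open>u'\<close> and the final gauges
  of \<open>u\<close> are negligible, so the squares of the norms nearly add up.\<close>

lemma almost_orthogonal:
  assumes u: "u \<in> space" "nrm u \<le> 1"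
  obtains \<delta> where "0 < \<delta>" "\<And>u'. u' \<in> space \<Longrightarrow> nrm u' \<le> 1 \<Longrightarrow> norm u' \<le> \<delta> \<Longrightarrow> nrm (u + u') \<le> 5/3"
proof -
  have "summable (\<lambda>n. (gauge n u)\<^sup>2)" using u by (simp add: space_def)
  moreover have s: "(\<Sum>n. (gauge n u)\<^sup>2) = (nrm u)\<^sup>2"
    using calculation by (simp add: nrm_def suminf_nonneg)
  ultimately have lim: "(\<lambda>m. \<Sum>n<m. (gauge n u)\<^sup>2) \<longlonglongrightarrow> (nrm u)\<^sup>2"
    using summable_LIMSEQ by fastforce
  have "\<forall>\<^sub>F m in sequentially. (nrm u)\<^sup>2 - 1/40 < (\<Sum>n<m. (gauge n u)\<^sup>2)"
    by (rule order_tendstoD[OF lim]) simp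
  then obtain m where m: "(nrm u)\<^sup>2 - 1/40 < (\<Sum>n<m. (gauge n u)\<^sup>2)"
    by (auto simp: eventually_sequentially)
  \<comment> \<open>The gauges of \<open>u'\<close> with \<open>n < m\<close> are at most
    \<open>2 ^ n * \<delta>\<close>; the choice of \<open>\<delta>\<close> makes the sum of their
    squares at most 1/40, the same bound as for the tail of \<open>u\<close>.\<close>
  define S where "S = (\<Sum>n<m. (2 ^ n)\<^sup>2 :: real)"
  have S: "0 \<le> S" by (simp add: S_def sum_nonneg)
  define \<delta> where "\<delta> = sqrt (1 / (40 * (S + 1)))"
  have \<delta>: "0 < \<delta>" "\<delta>\<^sup>2 * S \<le> 1/40" using S by (simp_all add: \<delta>_def field_simps)
  show thesis
  proof (rule that[OF \<delta>(1)])
    fix u' assume u': "u' \<in> space" "nrm u' \<le> 1" "norm u' \<le> \<delta>"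
    define a where "a n = gauge n u" for n
    define b where "b n = gauge n u'" for n
    have ab: "0 \<le> a n" "0 \<le> b n" for n by (simp_all add: a_def b_def gauge_nonneg)
    \<comment> \<open>Applied with the negligible term as \<open>y\<close>: the cross term then
      costs only a quarter of the square of the other one.\<close>
    have sq: "(x + y)\<^sup>2 \<le> 5/4 * (x\<^sup>2 + y\<^sup>2) + 15/4 * y\<^sup>2" for x y :: real
    proof -
      have "4 * (x + y)\<^sup>2 + (x - 4 * y)\<^sup>2 = 5 * (x\<^sup>2 + y\<^sup>2) + 15 * y\<^sup>2"
        by (simp add: power2_eq_square algebra_simps)
      then show ?thesis using zero_le_power2[of "x - 4 * y"] by linarith
    qed
    have "(nrm u)\<^sup>2 \<le> 1" "(nrm u')\<^sup>2 \<le> 1"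
      using u(2) u'(2) nrm_nonneg u(1) u'(1) by (simp_all add: power_le_one)
    then have a1: "(\<Sum>n<M. (a n)\<^sup>2) \<le> 1" and b1: "(\<Sum>n<M. (b n)\<^sup>2) \<le> 1" for M
      unfolding a_def b_def using sum_gauge_le[OF u(1), of M] sum_gauge_le[OF u'(1), of M] by linarith+
    have head: "(\<Sum>n<m. (b n)\<^sup>2) \<le> 1/40"
    proof -
      have "(\<Sum>n<m. (b n)\<^sup>2) \<le> (\<Sum>n<m. \<delta>\<^sup>2 * (2 ^ n)\<^sup>2)"
      proof (rule sum_mono)
        fix n
        have "b n \<le> 2 ^ n * norm u'" unfolding b_def by (rule gauge_le_norm)
        also have "\<dots> \<le> 2 ^ n * \<delta>" using u'(3) by (intro mult_left_mono) auto
        finally have "(b n)\<^sup>2 \<le> (2 ^ n * \<delta>)\<^sup>2" using ab by (intro power_mono)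
        then show "(b n)\<^sup>2 \<le> \<delta>\<^sup>2 * (2 ^ n)\<^sup>2" by (simp add: power_mult_distrib mult.commute)
      qed
      also have "\<dots> \<le> 1/40" using \<delta>(2) by (simp add: S_def sum_distrib_left)
      finally show ?thesis .
    qed
    have tail: "(\<Sum>n<m + j. (a n)\<^sup>2) - (\<Sum>n<m. (a n)\<^sup>2) \<le> 1/40" for j
      using m sum_gauge_le[OF u(1), of "m + j"] by (simp add: a_def)
    \<comment> \<open>The right-hand side is at most 5/2 + 15/80, and 25/9 is the square of 5/3.
      What counts is that 5/3 is below 2, the bound of the triangle inequality.\<close>
    have arith: "X \<le> 25/9" if "X \<le> 5/4 * (A + B) + 15/4 * (H + (A - A'))"
      "A \<le> 1" "B \<le> 1" "H \<le> 1/40" "A - A' \<le> 1/40" for X A B H A' :: real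
      using that by (simp add: field_simps)
    have "(\<Sum>n<m + j. (gauge n (u + u'))\<^sup>2) \<le> (5/3)\<^sup>2" for j
    proof -
      have "(gauge n (u + u'))\<^sup>2 \<le>
        5/4 * ((a n)\<^sup>2 + (b n)\<^sup>2) + 15/4 * (if n < m then (b n)\<^sup>2 else (a n)\<^sup>2)" for n
      proof -
        have "(gauge n (u + u'))\<^sup>2 \<le> (a n + b n)\<^sup>2"
          unfolding a_def b_def by (intro power_mono gauge_triangle gauge_nonneg)
        then show ?thesis using sq[of "a n" "b n"] sq[of "b n" "a n"] by (simp add: add.commute)
      qed
      then have "(\<Sum>n<m + j. (gauge n (u + u'))\<^sup>2) \<le>
        (\<Sum>n<m + j. 5/4 * ((a n)\<^sup>2 + (b n)\<^sup>2) + 15/4 * (if n < m then (b n)\<^sup>2 else (a n)\<^sup>2))"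
        by (rule sum_mono)
      also have "\<dots> = 5/4 * ((\<Sum>n<m + j. (a n)\<^sup>2) + (\<Sum>n<m + j. (b n)\<^sup>2)) +
          15/4 * (\<Sum>n<m + j. if n < m then (b n)\<^sup>2 else (a n)\<^sup>2)"
        by (simp only: sum.distrib sum_distrib_left[symmetric])
      also have "(\<Sum>n<m + j. if n < m then (b n)\<^sup>2 else (a n)\<^sup>2) =
          (\<Sum>n<m. (b n)\<^sup>2) + ((\<Sum>n<m + j. (a n)\<^sup>2) - (\<Sum>n<m. (a n)\<^sup>2))"
        by (induction j) simp_all
      finally have "(\<Sum>n<m + j. (gauge n (u + u'))\<^sup>2) \<le> 25/9"
        by (rule arith[OF _ a1[of "m + j"] b1[of "m + j"] head tail[of j]])
      then show ?thesis by (simp add: power2_eq_square)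
    qed
    moreover have "(\<Sum>n<M. (gauge n (u + u'))\<^sup>2) \<le> (\<Sum>n<m + M. (gauge n (u + u'))\<^sup>2)" for M
      by (intro sum_mono2) auto
    ultimately have "(\<Sum>n<M. (gauge n (u + u'))\<^sup>2) \<le> (5/3)\<^sup>2" for M
      using order_trans by blast
    then show "nrm (u + u') \<le> 5/3" by (intro space_nrm_leI(2)[of "5/3"]) simp_all
  qed
qed

text \<open>Suppose \<open>\<phi>\<close> were at least \<open>c\<close> at points of the unit ball
  of arbitrarily small ambient norm. Take two of them, the second small enough for the first; their
  sum has norm at most 5/3, so 3/5 of it is again such a point, with value at least
  \<open>6/5 * c\<close>. Repeating this contradicts the boundedness of
  \<open>\<phi>\<close>.\<close>

lemma dual_small_norm:
  assumes \<phi>: "\<phi> \<in> dual space nrm" and c: "0 < c"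
  shows "\<exists>\<delta>>0. \<forall>v\<in>space. nrm v \<le> 1 \<longrightarrow> norm v \<le> \<delta> \<longrightarrow> \<phi> v < c"
proof (rule ccontr)
  assume not: "\<not> ?thesis"
  define P where "P c \<longleftrightarrow> (\<forall>\<delta>>0. \<exists>v\<in>space. nrm v \<le> 1 \<and> norm v \<le> \<delta> \<and> c \<le> \<phi> v)" for c
  have "P c"
    unfolding P_def
  proof (intro allI impI, rule ccontr)
    fix \<delta> :: real
    assume \<delta>: "0 < \<delta>" and "\<not> (\<exists>v\<in>space. nrm v \<le> 1 \<and> norm v \<le> \<delta> \<and> c \<le> \<phi> v)"
    have "\<forall>v\<in>space. nrm v \<le> 1 \<longrightarrow> norm v \<le> \<delta> \<longrightarrow> \<phi> v < c"
    proof (intro ballI impI, rule ccontr)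
      fix v assume "v \<in> space" "nrm v \<le> 1" "norm v \<le> \<delta>" "\<not> \<phi> v < c"
      then have "\<exists>v\<in>space. nrm v \<le> 1 \<and> norm v \<le> \<delta> \<and> c \<le> \<phi> v"
        by (intro bexI[of _ v] conjI) simp_all
      with \<open>\<not> (\<exists>v\<in>space. nrm v \<le> 1 \<and> norm v \<le> \<delta> \<and> c \<le> \<phi> v)\<close> show False by (rule notE)
    qed
    with not \<delta> show False by blast
  qed
  have step: "P (6/5 * c)" if P: "P c" for c
    unfolding P_def
  proof (intro allI impI)
    fix \<delta> :: real assume \<delta>: "0 < \<delta>"
    then have "0 < \<delta> / 2" by simp
    with P obtain u where u: "u \<in> space" "nrm u \<le> 1" "norm u \<le> \<delta> / 2" "c \<le> \<phi> u"
      unfolding P_def by blast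
    obtain \<delta>' where \<delta>': "0 < \<delta>'"
      "\<And>u'. u' \<in> space \<Longrightarrow> nrm u' \<le> 1 \<Longrightarrow> norm u' \<le> \<delta>' \<Longrightarrow> nrm (u + u') \<le> 5/3"
      by (rule almost_orthogonal[OF u(1,2)]) (rule that)
    have "0 < min \<delta>' (\<delta> / 2)" using \<delta> \<delta>' by simp
    with P obtain u' where u': "u' \<in> space" "nrm u' \<le> 1" "norm u' \<le> min \<delta>' (\<delta> / 2)" "c \<le> \<phi> u'"
      unfolding P_def by blast
    have uu: "u + u' \<in> space" using u u' by (intro mem_simps)
    show "\<exists>v\<in>space. nrm v \<le> 1 \<and> norm v \<le> \<delta> \<and> 6/5 * c \<le> \<phi> v"
    proof (intro bexI[of _ "(3/5) *\<^sub>R (u + u')"] conjI)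
      show "nrm ((3/5) *\<^sub>R (u + u')) \<le> 1"
        using \<delta>'(2)[of u'] u' uu by (simp add: nrm_scaleR)
      have "norm (u + u') \<le> \<delta>" using norm_triangle_ineq[of u u'] u(3) u'(3) by simp
      then show "norm ((3/5) *\<^sub>R (u + u')) \<le> \<delta>" using \<delta> by simp
      show "6/5 * c \<le> \<phi> ((3/5) *\<^sub>R (u + u'))"
        using u(4) u'(4) functional_onD(2)[OF dual_functional[OF \<phi>] uu, of "3/5"]
          functional_onD(1)[OF dual_functional[OF \<phi>] u(1) u'(1)] by simp
    qed (use uu in \<open>rule mem_simps\<close>)
  qed
  have Pk: "P ((6/5) ^ k * c)" for k
  proof (induction k)
    case (Suc k)
    then show ?case using step[of "(6/5) ^ k * c"] by (simp add: mult.assoc)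
  qed (simp add: \<open>P c\<close>)
  have bound: "(6/5) ^ k * c \<le> dual_norm space nrm \<phi>" for k
  proof -
    have "(0::real) < 1" by simp
    with Pk[of k] obtain v where "v \<in> space" "nrm v \<le> 1" "(6/5) ^ k * c \<le> \<phi> v"
      unfolding P_def by blast
    then show ?thesis using dual_norm_upper[OF \<phi>, of v] by linarith
  qed
  obtain k where "dual_norm space nrm \<phi> / c < (6/5) ^ k"
    using real_arch_pow[of "6/5" "dual_norm space nrm \<phi> / c"] by auto
  with bound[of k] c show False by (simp add: field_simps)
qed

text \<open>Dividing \<open>v\<close> by \<open>nrm v + norm v / \<delta>\<close> satisfies both
  bounds of \<open>dual_small_norm\<close> at once.\<close>

lemma dual_dominated:
  assumes \<phi>: "\<phi> \<in> dual space nrm" and \<epsilon>: "0 < \<epsilon>"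
  obtains K where "0 \<le> K" "\<And>v. v \<in> space \<Longrightarrow> \<phi> v \<le> \<epsilon> * nrm v + K * norm v"
proof -
  obtain \<delta> where \<delta>: "0 < \<delta>" "\<And>v. v \<in> space \<Longrightarrow> nrm v \<le> 1 \<Longrightarrow> norm v \<le> \<delta> \<Longrightarrow> \<phi> v < \<epsilon>"
    using dual_small_norm[OF \<phi> \<epsilon>] by auto
  have "\<phi> v \<le> \<epsilon> * nrm v + (\<epsilon> / \<delta>) * norm v" if v: "v \<in> space" for v
  proof (cases "v = 0")
    case True
    have "\<phi> 0 = 0" using functional_onD(2)[OF dual_functional[OF \<phi>] v, of 0] by simp
    with True show ?thesis by (simp add: norm_zero)
  next
    case False
    define s where "s = nrm v + norm v / \<delta>"
    have n: "0 \<le> nrm v" "0 < norm v / \<delta>" using nrm_nonneg[OF v] False \<delta>(1) by auto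
    then have s: "0 < s" by (simp add: s_def)
    have "\<phi> ((1 / s) *\<^sub>R v) < \<epsilon>"
    proof (rule \<delta>(2))
      show "(1 / s) *\<^sub>R v \<in> space" using v by (rule mem_simps)
      show "nrm ((1 / s) *\<^sub>R v) \<le> 1" using s n v by (simp add: nrm_scaleR) (simp add: s_def)
      have "norm v \<le> \<delta> * s" using n \<delta>(1) by (simp add: s_def field_simps)
      then show "norm ((1 / s) *\<^sub>R v) \<le> \<delta>" using s by (simp add: field_simps)
    qed
    then have "\<phi> v < \<epsilon> * s"
      using s functional_onD(2)[OF dual_functional[OF \<phi>] v, of "1 / s"] by (simp add: field_simps)
    then show ?thesis by (simp add: s_def distrib_left)
  qed
  then show thesis using \<epsilon> \<delta>(1) by (intro that[of "\<epsilon> / \<delta>"]) auto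
qed

text \<open>On \<open>space\<close>, \<open>\<phi>\<close> minus \<open>\<epsilon>\<close> times the
  norm is superlinear and lies below \<open>K\<close> times the ambient norm, so a continuous
  functional of the ambient space fits in between. Restrictions of ambient functionals are thus norm
  dense in the dual, and elements of the bidual as well as the continuity of bounded orbits can be
  tested on them.\<close>

lemma dual_approx:
  assumes \<phi>: "\<phi> \<in> dual space nrm" and \<epsilon>: "0 < \<epsilon>"
  obtains \<psi> :: "'a \<Rightarrow>\<^sub>L real" where "\<And>v. v \<in> space \<Longrightarrow> \<bar>\<phi> v - blinfun_apply \<psi> v\<bar> \<le> \<epsilon> * nrm v"
proof -
  obtain K where K: "0 \<le> K" "\<And>v. v \<in> space \<Longrightarrow> \<phi> v \<le> \<epsilon> * nrm v + K * norm v"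
    by (rule dual_dominated[OF \<phi> \<epsilon>]) (rule that)
  have sub: "sublinear_on UNIV (\<lambda>e :: 'a. K * norm e)"
    using mult_left_mono[OF norm_triangle_ineq K(1)] by (auto simp: sublinear_on_def distrib_left)
  have sup: "sublinear_on space (\<lambda>v. - (\<phi> v - \<epsilon> * nrm v))"
    unfolding sublinear_on_def
  proof (intro conjI ballI allI impI)
    fix u v assume uv: "u \<in> space" "v \<in> space"
    have "\<epsilon> * nrm (u + v) \<le> \<epsilon> * (nrm u + nrm v)"
      using nrm_add(2)[OF uv] \<epsilon> by (intro mult_left_mono) auto
    then show "- (\<phi> (u + v) - \<epsilon> * nrm (u + v)) \<le> - (\<phi> u - \<epsilon> * nrm u) + - (\<phi> v - \<epsilon> * nrm v)"
      using functional_onD(1)[OF dual_functional[OF \<phi>] uv] by (simp add: distrib_left)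
  next
    fix c :: real and v assume "0 < c" "v \<in> space"
    then show "- (\<phi> (c *\<^sub>R v) - \<epsilon> * nrm (c *\<^sub>R v)) \<le> c * - (\<phi> v - \<epsilon> * nrm v)"
      using functional_onD(2)[OF dual_functional[OF \<phi>], of v c] by (simp add: nrm_scaleR algebra_simps)
  qed
  have le: "\<phi> v - \<epsilon> * nrm v \<le> K * norm v" if "v \<in> space" for v using K(2)[OF that] by linarith
  obtain g where g: "functional_on UNIV g" "\<And>e. e \<in> UNIV \<Longrightarrow> g e \<le> K * norm e"
    "\<And>v. v \<in> space \<Longrightarrow> \<phi> v - \<epsilon> * nrm v \<le> g v"
    by (rule functional_sandwich[OF subspace_UNIV sub subspace subset_UNIV sup le]) (assumption, rule that)
  have "bounded_linear g"
  proof (rule bounded_linear_intro)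
    show "norm (g e) \<le> norm e * K" for e
      using g(2)[of e] g(2)[of "- e"] functional_on_minus[OF g(1), of e]
      by (simp add: abs_le_iff mult.commute)
  qed (use g(1) in \<open>simp_all add: functional_on_def\<close>)
  then have app: "blinfun_apply (Blinfun g) = g" by (rule bounded_linear_Blinfun_apply)
  show thesis
  proof (rule that[of "Blinfun g"])
    fix v assume v: "v \<in> space"
    have "- v \<in> space" using v by (rule mem_simps)
    from g(3)[OF v] g(3)[OF this] functional_on_minus[OF g(1), of v]
      functional_on_minus[OF dual_functional[OF \<phi>] v] norm_minus[OF v]
    show "\<bar>\<phi> v - blinfun_apply (Blinfun g) v\<bar> \<le> \<epsilon> * nrm v" by (simp add: app abs_le_iff)
  qed
qed

lemma restrict_dual: "restrict (blinfun_apply \<psi>) space \<in> dual space nrm"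
proof (rule dualI)
  show "functional_on space (blinfun_apply \<psi>)"
    by (simp add: functional_on_def blinfun.add_right blinfun.scaleR_right)
  fix v assume v: "v \<in> space"
  have "\<bar>blinfun_apply \<psi> v\<bar> \<le> norm \<psi> * norm v" using norm_blinfun[of \<psi> v] by simp
  also have "\<dots> \<le> norm \<psi> * nrm v" using norm_le_nrm[OF v] by (intro mult_left_mono) auto
  finally show "\<bar>blinfun_apply \<psi> v\<bar> \<le> norm \<psi> * nrm v" .
qed

lemma bidual_linear:
  assumes F: "F \<in> bidual space nrm"
  shows "F (restrict (blinfun_apply (\<psi> + \<zeta>)) space) =
      F (restrict (blinfun_apply \<psi>) space) + F (restrict (blinfun_apply \<zeta>) space)"
    and "F (restrict (blinfun_apply (c *\<^sub>R \<psi>)) space) = c * F (restrict (blinfun_apply \<psi>) space)"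
proof -
  have eq: "restrict (blinfun_apply (\<psi> + \<zeta>)) space =
      (\<lambda>v\<in>space. restrict (blinfun_apply \<psi>) space v + restrict (blinfun_apply \<zeta>) space v)"
    by (auto simp: blinfun.add_left)
  show "F (restrict (blinfun_apply (\<psi> + \<zeta>)) space) =
      F (restrict (blinfun_apply \<psi>) space) + F (restrict (blinfun_apply \<zeta>) space)"
    by (simp only: eq bidual_add[OF F restrict_dual restrict_dual])
  have eq: "restrict (blinfun_apply (c *\<^sub>R \<psi>)) space =
      (\<lambda>v\<in>space. c * restrict (blinfun_apply \<psi>) space v)"
    by (auto simp: blinfun.scaleR_left)
  show "F (restrict (blinfun_apply (c *\<^sub>R \<psi>)) space) = c * F (restrict (blinfun_apply \<psi>) space)"
    by (simp only: eq bidual_scale[OF F restrict_dual])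
qed

lemma bidual_sum:
  assumes F: "F \<in> bidual space nrm" and "finite I"
  shows "F (restrict (blinfun_apply (\<Sum>i\<in>I. c i *\<^sub>R \<psi> i)) space) =
      (\<Sum>i\<in>I. c i * F (restrict (blinfun_apply (\<psi> i)) space))"
  using assms(2)
proof (induction I rule: finite_induct)
  case empty
  show ?case using bidual_linear(2)[OF F, of 0 0]
    by (simp only: sum.empty scaleR_zero_left mult_zero_left)
next
  case (insert i I)
  then show ?case by (simp only: sum.insert bidual_linear[OF F] simp_thms)
qed

text \<open>Goldstine's theorem, tested on ambient functionals. For every linear combination of the
  functionals in \<open>\<Psi>\<close>, the value of \<open>F\<close> is at most \<open>C\<close>
  times its dual norm and hence almost reached on the ball of radius \<open>C\<close>;
  \<open>helly\<close> turns this into simultaneous approximation.\<close>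

lemma bidual_approx:
  assumes F: "F \<in> bidual space nrm" and C: "0 < C"
    and FC: "\<And>\<phi>. \<phi> \<in> dual space nrm \<Longrightarrow> \<bar>F \<phi>\<bar> \<le> C * dual_norm space nrm \<phi>"
    and \<Psi>: "finite \<Psi>" and \<epsilon>: "0 < \<epsilon>"
  shows "\<exists>v\<in>{v \<in> space. nrm v \<le> C}. \<forall>\<psi>\<in>\<Psi>.
    \<bar>blinfun_apply \<psi> v - F (restrict (blinfun_apply \<psi>) space)\<bar> \<le> \<epsilon>"
proof (rule helly[OF _ \<Psi>, where M = "C * (\<Sum>\<psi>\<in>\<Psi>. norm \<psi>)"])
  show "convex {v \<in> space. nrm v \<le> C}"
  proof (rule convexI)
    fix x y and a b :: real
    assume xy: "x \<in> {v \<in> space. nrm v \<le> C}" "y \<in> {v \<in> space. nrm v \<le> C}"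
      and ab: "0 \<le> a" "0 \<le> b" "a + b = 1"
    have "nrm (a *\<^sub>R x + b *\<^sub>R y) \<le> a * nrm x + b * nrm y"
      using nrm_add(2)[of "a *\<^sub>R x" "b *\<^sub>R y"] xy ab by (simp add: nrm_scaleR)
    also have "\<dots> \<le> a * C + b * C" using xy ab by (intro add_mono mult_left_mono) auto
    also have "\<dots> = C" using ab by (simp add: distrib_right[symmetric])
    finally show "a *\<^sub>R x + b *\<^sub>R y \<in> {v \<in> space. nrm v \<le> C}" using xy by (simp add: mem_simps)
  qed
  show "blinfun_apply \<psi> ((1 - u) *\<^sub>R x + u *\<^sub>R y) = (1 - u) * blinfun_apply \<psi> x + u * blinfun_apply \<psi> y"
    for \<psi> :: "'a \<Rightarrow>\<^sub>L real" and x y u by (simp add: blinfun.add_right blinfun.scaleR_right)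
  show "\<bar>blinfun_apply \<psi> v\<bar> \<le> C * (\<Sum>\<psi>\<in>\<Psi>. norm \<psi>)"
    if "\<psi> \<in> \<Psi>" "v \<in> {v \<in> space. nrm v \<le> C}" for \<psi> v
  proof -
    have "\<bar>blinfun_apply \<psi> v\<bar> \<le> norm \<psi> * norm v" using norm_blinfun[of \<psi> v] by simp
    also have "\<dots> \<le> (\<Sum>\<psi>\<in>\<Psi>. norm \<psi>) * C"
      using that norm_le_nrm[of v] C by (intro mult_mono member_le_sum \<Psi> sum_nonneg) auto
    finally show ?thesis by (simp add: mult.commute)
  qed
  show "\<exists>v\<in>{v \<in> space. nrm v \<le> C}.
      (\<Sum>\<psi>\<in>\<Psi>. c \<psi> * F (restrict (blinfun_apply \<psi>) space)) - \<delta> \<le> (\<Sum>\<psi>\<in>\<Psi>. c \<psi> * blinfun_apply \<psi> v)"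
    if "0 < \<delta>" for c and \<delta> :: real
  proof -
    define \<xi> where "\<xi> = (\<Sum>\<psi>\<in>\<Psi>. c \<psi> *\<^sub>R \<psi>)"
    have "0 < \<delta> / C" using that C by simp
    then obtain v where v: "v \<in> space" "nrm v \<le> 1"
      "dual_norm space nrm (restrict (blinfun_apply \<xi>) space) - \<delta> / C < restrict (blinfun_apply \<xi>) space v"
      by (rule dual_norm_attained[OF restrict_dual])
    have "(\<Sum>\<psi>\<in>\<Psi>. c \<psi> * F (restrict (blinfun_apply \<psi>) space)) = F (restrict (blinfun_apply \<xi>) space)"
      unfolding \<xi>_def using bidual_sum[OF F \<Psi>, of c "\<lambda>\<psi>. \<psi>"] by simp
    also have "\<dots> \<le> C * dual_norm space nrm (restrict (blinfun_apply \<xi>) space)"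
      using FC[OF restrict_dual, of \<xi>] by simp
    also have "\<dots> \<le> C * (blinfun_apply \<xi> v + \<delta> / C)"
      using v C by (intro mult_left_mono) auto
    also have "\<dots> = blinfun_apply \<xi> (C *\<^sub>R v) + \<delta>"
      using C by (simp add: distrib_left blinfun.scaleR_right)
    finally have "(\<Sum>\<psi>\<in>\<Psi>. c \<psi> * F (restrict (blinfun_apply \<psi>) space)) - \<delta> \<le> blinfun_apply \<xi> (C *\<^sub>R v)"
      by simp
    moreover have "blinfun_apply \<xi> (C *\<^sub>R v) = (\<Sum>\<psi>\<in>\<Psi>. c \<psi> * blinfun_apply \<psi> (C *\<^sub>R v))"
      by (simp add: \<xi>_def blinfun.sum_left blinfun.scaleR_left)
    moreover have "C *\<^sub>R v \<in> {v \<in> space. nrm v \<le> C}"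
      using v C by (simp add: nrm_scaleR)
    ultimately show ?thesis by (intro bexI[of _ "C *\<^sub>R v"]) simp_all
  qed
qed (fact \<epsilon>)

text \<open>A near minimizer in the \<open>n\<close>-th gauge. The multiple of \<open>W\<close>
  depends on \<open>n\<close> and \<open>C\<close> but not on \<open>v\<close>: a whole ball of
  \<open>space\<close> is uniformly close to one set, and this set inherits the double limit
  property from \<open>W\<close>. The factor 2 leaves room for an infimum that is not
  attained.\<close>

lemma space_near_W:
  assumes v: "v \<in> space" "nrm v \<le> C" and C: "0 < C"
  obtains w where "w \<in> (*\<^sub>R) (2 ^ Suc n * C) ` W" "norm (v - w) \<le> 2 * C * (1/2) ^ n"
proof -
  have "gauge n v < 2 * C" using gauge_le_nrm[OF v(1), of n] v(2) C by linarith
  then obtain t w where tw: "0 \<le> t" "w \<in> W" "(1/2) ^ n * t + 2 ^ n * norm (v - t *\<^sub>R w) < 2 * C"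
    by (rule gauge_less)
  define \<tau> where "\<tau> = 2 ^ Suc n * C"
  have \<tau>: "0 < \<tau>" using C by (simp add: \<tau>_def)
  have p: "(1/2) ^ n * (2 :: real) ^ n = 1" by (simp add: power_mult_distrib[symmetric])
  have "0 \<le> 2 ^ n * norm (v - t *\<^sub>R w)" "0 \<le> (1/2) ^ n * t" using tw(1) by simp_all
  with tw(3) have l: "(1/2) ^ n * t \<le> 2 * C" "2 ^ n * norm (v - t *\<^sub>R w) \<le> 2 * C" by linarith+
  have "t \<le> \<tau>" using l(1) by (simp add: \<tau>_def field_simps)
  then have "(t / \<tau>) *\<^sub>R w \<in> W" using tw \<tau> by (intro scale_mem) auto
  moreover have "t *\<^sub>R w = \<tau> *\<^sub>R (t / \<tau>) *\<^sub>R w" using \<tau> by simp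
  ultimately have "t *\<^sub>R w \<in> (*\<^sub>R) \<tau> ` W" by (rule rev_image_eqI)
  moreover have "norm (v - t *\<^sub>R w) \<le> 2 * C * (1/2) ^ n" using l(2) by (simp add: field_simps)
  ultimately show thesis unfolding \<tau>_def by (rule that)
qed

text \<open>The representing point \<open>e\<close> is asked for in the ambient space and for
  ambient functionals alone. Testing \<open>F\<close> on combinations of norming functionals bounds
  the gauges of \<open>e\<close>, so \<open>e\<close> lies in \<open>space\<close>; the equation
  then extends to the whole dual by \<open>dual_approx\<close>.\<close>

lemma reflexive_space:
  assumes ex: "\<And>F. F \<in> bidual space nrm \<Longrightarrow>
    \<exists>e. \<forall>\<psi>. F (restrict (blinfun_apply \<psi>) space) = blinfun_apply \<psi> e"
  shows "reflexive_on space nrm"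
  unfolding reflexive_on_def
proof (intro conjI banach_space subset_antisym subsetI)
  fix F assume "F \<in> (\<lambda>v. \<lambda>\<phi>\<in>dual space nrm. \<phi> v) ` space"
  then obtain v where v: "v \<in> space" and F: "F = (\<lambda>\<phi>\<in>dual space nrm. \<phi> v)" by auto
  have add: "(\<lambda>v\<in>space. \<phi> v + \<psi> v) \<in> dual space nrm"
    if \<phi>: "\<phi> \<in> dual space nrm" and \<psi>: "\<psi> \<in> dual space nrm" for \<phi> \<psi>
  proof (rule dualI[where C = "dual_norm space nrm \<phi> + dual_norm space nrm \<psi>"])
    show "functional_on space (\<lambda>v. \<phi> v + \<psi> v)"
      using dual_functional[OF \<phi>] dual_functional[OF \<psi>] by (simp add: functional_on_def distrib_left)
    show "\<bar>\<phi> v + \<psi> v\<bar> \<le> (dual_norm space nrm \<phi> + dual_norm space nrm \<psi>) * nrm v" if "v \<in> space" for v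
      using dual_apply_le[OF \<phi> that] dual_apply_le[OF \<psi> that] by (simp add: distrib_right)
  qed
  have scale: "(\<lambda>v\<in>space. c * \<phi> v) \<in> dual space nrm" if \<phi>: "\<phi> \<in> dual space nrm" for \<phi> c
  proof (rule dualI[where C = "\<bar>c\<bar> * dual_norm space nrm \<phi>"])
    show "functional_on space (\<lambda>v. c * \<phi> v)"
      using dual_functional[OF \<phi>] by (simp add: functional_on_def distrib_left)
    show "\<bar>c * \<phi> v\<bar> \<le> \<bar>c\<bar> * dual_norm space nrm \<phi> * nrm v" if "v \<in> space" for v
      using mult_left_mono[OF dual_apply_le[OF \<phi> that], of "\<bar>c\<bar>"] by (simp add: abs_mult mult.assoc)
  qed
  have "\<exists>C. \<forall>\<phi>\<in>dual space nrm. \<bar>F \<phi>\<bar> \<le> C * dual_norm space nrm \<phi>"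
    using dual_apply_le v by (intro exI[of _ "nrm v"]) (simp add: F mult.commute)
  then show "F \<in> bidual space nrm"
    using add scale v by (simp add: bidual_def F)
next
  fix F assume F: "F \<in> bidual space nrm"
  then obtain e where e: "\<And>\<psi>. F (restrict (blinfun_apply \<psi>) space) = blinfun_apply \<psi> e"
    using ex by blast
  have "\<exists>C. \<forall>\<phi>\<in>dual space nrm. \<bar>F \<phi>\<bar> \<le> C * dual_norm space nrm \<phi>"
    using F by (simp add: bidual_def)
  then obtain C' where C': "\<And>\<phi>. \<phi> \<in> dual space nrm \<Longrightarrow> \<bar>F \<phi>\<bar> \<le> C' * dual_norm space nrm \<phi>" by blast
  define C where "C = \<bar>C'\<bar>"
  have C0: "0 \<le> C" by (simp add: C_def)
  have C: "\<bar>F \<phi>\<bar> \<le> C * dual_norm space nrm \<phi>" if "\<phi> \<in> dual space nrm" for \<phi>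
    using C'[OF that] mult_right_mono[OF abs_ge_self dual_norm_nonneg[OF that], of C']
    by (simp add: C_def)
  have "(\<Sum>n<m. (gauge n e)\<^sup>2) \<le> C\<^sup>2" for m
  proof -
    have "\<forall>n. \<exists>\<psi> :: 'a \<Rightarrow>\<^sub>L real. (\<forall>u. \<bar>blinfun_apply \<psi> u\<bar> \<le> gauge n u) \<and> blinfun_apply \<psi> e = gauge n e"
    proof
      fix n
      obtain \<psi> :: "'a \<Rightarrow>\<^sub>L real" where "\<And>u. \<bar>blinfun_apply \<psi> u\<bar> \<le> gauge n u" "blinfun_apply \<psi> e = gauge n e"
        by (rule norming_functional[of n e]) (rule that)
      then show "\<exists>\<psi> :: 'a \<Rightarrow>\<^sub>L real. (\<forall>u. \<bar>blinfun_apply \<psi> u\<bar> \<le> gauge n u) \<and> blinfun_apply \<psi> e = gauge n e"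
        by (intro exI[of _ \<psi>]) simp
    qed
    from choice[OF this] obtain \<psi> :: "nat \<Rightarrow> 'a \<Rightarrow>\<^sub>L real" where
      "\<forall>n. (\<forall>u. \<bar>blinfun_apply (\<psi> n) u\<bar> \<le> gauge n u) \<and> blinfun_apply (\<psi> n) e = gauge n e" ..
    then have \<psi>: "\<bar>blinfun_apply (\<psi> n) u\<bar> \<le> gauge n u" "blinfun_apply (\<psi> n) e = gauge n e" for n u
      by simp_all
    define S where "S = L2_set (\<lambda>n. gauge n e) {..<m}"
    have S2: "S\<^sup>2 = (\<Sum>n<m. (gauge n e)\<^sup>2)" by (simp add: S_def L2_set_def sum_nonneg)
    have S0: "0 \<le> S" by (simp add: S_def)
    \<comment> \<open>The value of \<open>\<xi>\<close> at \<open>e\<close> is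
      \<open>S\<^sup>2\<close>, whereas by the Cauchy-Schwarz inequality its dual norm is at most
      \<open>S\<close>. Hence \<open>S\<close> is bounded by \<open>C\<close>, independently of
      \<open>m\<close>.\<close>
    define \<xi> where "\<xi> = (\<Sum>n<m. gauge n e *\<^sub>R \<psi> n)"
    have "S\<^sup>2 = blinfun_apply \<xi> e"
      unfolding S2 by (simp add: \<xi>_def blinfun.sum_left blinfun.scaleR_left \<psi>(2) power2_eq_square)
    also have "\<dots> \<le> C * dual_norm space nrm (restrict (blinfun_apply \<xi>) space)"
      using C[OF restrict_dual, of \<xi>] by (simp add: e)
    also have "\<dots> \<le> C * S"
    proof (intro mult_left_mono C0 dual_norm_le S0)
      fix v assume v: "v \<in> space"
      have "\<bar>blinfun_apply \<xi> v\<bar> \<le> (\<Sum>n<m. \<bar>gauge n e * blinfun_apply (\<psi> n) v\<bar>)"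
        by (simp add: \<xi>_def blinfun.sum_left blinfun.scaleR_left sum_abs)
      also have "\<dots> \<le> (\<Sum>n<m. \<bar>gauge n e\<bar> * \<bar>gauge n v\<bar>)"
        using \<psi>(1) gauge_nonneg by (intro sum_mono) (simp add: abs_mult mult_left_mono)
      also have "\<dots> \<le> S * L2_set (\<lambda>n. gauge n v) {..<m}" unfolding S_def by (rule L2_set_mult_ineq)
      also have "\<dots> \<le> S * nrm v" by (intro mult_left_mono L2_set_gauge_le v S0)
      finally show "\<bar>restrict (blinfun_apply \<xi>) space v\<bar> \<le> S * nrm v" using v by simp
    qed
    finally have "S \<le> C" using S0 by (cases "S = 0") (simp_all add: power2_eq_square C0)
    then show ?thesis unfolding S2[symmetric] using S0 by (intro power_mono)
  qed
  from space_nrm_leI(1)[OF C0 this] have eV: "e \<in> space" .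
  have "F \<phi> = \<phi> e" if \<phi>: "\<phi> \<in> dual space nrm" for \<phi>
  proof -
    have "\<bar>F \<phi> - \<phi> e\<bar> \<le> 0"
    proof (rule field_le_epsilon)
      fix \<epsilon> :: real assume "0 < \<epsilon>"
      define \<eta> where "\<eta> = \<epsilon> / (C + nrm e + 1)"
      have ne: "0 \<le> nrm e" by (rule nrm_nonneg[OF eV])
      have \<eta>: "0 < \<eta>" using \<open>0 < \<epsilon>\<close> C0 ne by (simp add: \<eta>_def)
      obtain \<psi> :: "'a \<Rightarrow>\<^sub>L real" where
        \<psi>: "\<And>v. v \<in> space \<Longrightarrow> \<bar>\<phi> v - blinfun_apply \<psi> v\<bar> \<le> \<eta> * nrm v"
        by (rule dual_approx[OF \<phi> \<eta>]) (rule that)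
      define \<zeta> where "\<zeta> = restrict (\<lambda>v. \<phi> v - blinfun_apply \<psi> v) space"
      have \<zeta>: "\<zeta> \<in> dual space nrm"
        unfolding \<zeta>_def
      proof (rule dualI[OF _ \<psi>])
        show "functional_on space (\<lambda>v. \<phi> v - blinfun_apply \<psi> v)"
          using dual_functional[OF \<phi>]
          by (simp add: functional_on_def blinfun.add_right blinfun.scaleR_right right_diff_distrib)
      qed
      have "\<phi> = (\<lambda>v\<in>space. \<zeta> v + restrict (blinfun_apply \<psi>) space v)"
        using \<phi> by (auto simp: \<zeta>_def dual_def extensional_def)
      then have "F \<phi> = F (\<lambda>v\<in>space. \<zeta> v + restrict (blinfun_apply \<psi>) space v)" by (rule arg_cong)
      also have "\<dots> = F \<zeta> + blinfun_apply \<psi> e"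
        by (simp only: bidual_add[OF F \<zeta> restrict_dual] e)
      finally have "\<bar>F \<phi> - \<phi> e\<bar> \<le> \<bar>F \<zeta>\<bar> + \<bar>\<phi> e - blinfun_apply \<psi> e\<bar>" by linarith
      also have "\<bar>F \<zeta>\<bar> \<le> C * \<eta>"
      proof -
        have "dual_norm space nrm \<zeta> \<le> \<eta>"
          using \<eta> \<psi> by (intro dual_norm_le) (simp_all add: \<zeta>_def)
        then show ?thesis using C[OF \<zeta>] mult_left_mono[OF _ C0] order_trans by blast
      qed
      also have "\<bar>\<phi> e - blinfun_apply \<psi> e\<bar> \<le> \<eta> * nrm e" by (rule \<psi>[OF eV])
      also have "C * \<eta> + \<eta> * nrm e \<le> \<eta> * (C + nrm e + 1)" using \<eta> by (simp add: algebra_simps)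
      also have "\<dots> = \<epsilon>" using C0 ne by (simp add: \<eta>_def)
      finally show "\<bar>F \<phi> - \<phi> e\<bar> \<le> 0 + \<epsilon>" by simp
    qed
    then show ?thesis by simp
  qed
  then have "F = (\<lambda>\<phi>\<in>dual space nrm. \<phi> e)"
    using F by (auto simp: bidual_def extensional_def)
  then show "F \<in> (\<lambda>v. \<lambda>\<phi>\<in>dual space nrm. \<phi> v) ` space" using eV by (rule image_eqI)
qed

end

section \<open>Reflexive interpolation spaces of bounded continuous functions\<close>

text \<open>The ambient type of \<open>interpolation\<close> and \<open>c0_sum\<close> has to be a
  Banach space, and X carries no metric.\<close>

instance bcontfun :: (topological_space, complete_space) complete_space
proof
  fix f :: "nat \<Rightarrow> 'a \<Rightarrow>\<^sub>C 'b"
  assume "Cauchy f"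
  then have "\<forall>e>0. \<exists>N. \<forall>m n x. N \<le> m \<and> N \<le> n \<and> True \<longrightarrow>
      dist (apply_bcontfun (f m) x) (apply_bcontfun (f n) x) < e"
    unfolding Cauchy_def by (metis dist_fun_lt_imp_dist_val_lt)
  then obtain g where "uniform_limit UNIV f g sequentially"
    using uniformly_convergent_eq_cauchy[of "\<lambda>_. True" "\<lambda>n. apply_bcontfun (f n)"]
    unfolding uniform_limit_sequentially_iff by auto
  from uniform_limit_bcontfunE[OF this sequentially_bot]
  obtain l where "g = apply_bcontfun l" "f \<longlonglongrightarrow> l" by metis
  then show "convergent f" by (intro convergentI)
qed

instance bcontfun :: (topological_space, banach) banach ..

lemma abs_apply_bcontfun_le:
  fixes f :: "'x::topological_space \<Rightarrow>\<^sub>C real"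
  shows "\<bar>apply_bcontfun f x\<bar> \<le> norm f"
  using norm_bounded[of f x] by simp

section \<open>Evaluations and weak* limits in the bidual of C(X)\<close>

definition eval_at :: "'x::topological_space \<Rightarrow> ('x \<Rightarrow>\<^sub>C real) \<Rightarrow>\<^sub>L real" where
  "eval_at x = Blinfun (\<lambda>f. apply_bcontfun f x)"

lemma eval_at_apply [simp]: "blinfun_apply (eval_at x) f = apply_bcontfun f x"
proof -
  have "bounded_linear (\<lambda>f :: 'a \<Rightarrow>\<^sub>C real. apply_bcontfun f x)"
    by (intro bounded_linear_intro[where K = 1]) (simp_all add: abs_apply_bcontfun_le)
  then show ?thesis by (simp add: eval_at_def bounded_linear_Blinfun_apply)
qed

lemma norm_eval_at_le: "norm (eval_at x) \<le> 1"
  by (intro norm_blinfun_bound) (simp_all add: abs_apply_bcontfun_le)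

text \<open>Finite combinations of evaluations, the functionals for which pointwise information
  about functions is enough.\<close>

definition eval_ball :: "(('x::topological_space \<Rightarrow>\<^sub>C real) \<Rightarrow>\<^sub>L real) set" where
  "eval_ball = {\<theta> \<in> span (range eval_at). norm \<theta> \<le> 1}"

text \<open>Up to sign, some evaluation almost attains the norm of any given combination of the
  functions in \<open>E\<close>, and this is the hypothesis of \<open>helly\<close>.\<close>

lemma eval_ball_weak_star_dense:
  fixes \<psi> :: "('x::topological_space \<Rightarrow>\<^sub>C real) \<Rightarrow>\<^sub>L real"
  assumes \<psi>: "norm \<psi> \<le> 1" and E: "finite E" and \<epsilon>: "0 < \<epsilon>"
  shows "\<exists>\<theta>\<in>eval_ball. \<forall>f\<in>E. \<bar>blinfun_apply \<theta> f - blinfun_apply \<psi> f\<bar> \<le> \<epsilon>"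
proof (rule helly[OF _ E, where M = "\<Sum>f\<in>E. norm f" and f = "\<lambda>f \<theta>. blinfun_apply \<theta> f"])
  have eq: "eval_ball = span (range eval_at) \<inter> cball (0 :: ('x \<Rightarrow>\<^sub>C real) \<Rightarrow>\<^sub>L real) 1"
    by (auto simp: eval_ball_def)
  show "convex (eval_ball :: (('x \<Rightarrow>\<^sub>C real) \<Rightarrow>\<^sub>L real) set)"
    unfolding eq by (intro convex_Int convex_cball subspace_imp_convex subspace_span)
  show "\<bar>blinfun_apply \<theta> f\<bar> \<le> (\<Sum>f\<in>E. norm f)" if "f \<in> E" "\<theta> \<in> eval_ball" for f \<theta>
  proof -
    have "\<bar>blinfun_apply \<theta> f\<bar> \<le> norm f" using that by (intro blinfun_apply_le_norm) (simp add: eval_ball_def)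
    also have "\<dots> \<le> (\<Sum>f\<in>E. norm f)" using that E by (intro member_le_sum) auto
    finally show ?thesis .
  qed
  show "\<exists>\<theta>\<in>eval_ball. (\<Sum>f\<in>E. c f * blinfun_apply \<psi> f) - \<delta> \<le> (\<Sum>f\<in>E. c f * blinfun_apply \<theta> f)"
    if \<delta>: "0 < \<delta>" for c and \<delta> :: real
  proof -
    define g where "g = (\<Sum>f\<in>E. c f *\<^sub>R f)"
    have app: "(\<Sum>f\<in>E. c f * blinfun_apply \<theta> f) = blinfun_apply \<theta> g" for \<theta> :: "('x \<Rightarrow>\<^sub>C real) \<Rightarrow>\<^sub>L real"
      by (simp add: g_def blinfun.sum_right blinfun.scaleR_right)
    have "\<not> (\<forall>x. norm (apply_bcontfun g x) \<le> norm g - \<delta>)"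
      using norm_bound[of g "norm g - \<delta>"] \<delta> by auto
    then obtain x where x: "norm g - \<delta> < \<bar>apply_bcontfun g x\<bar>" by (auto simp: not_le)
    define \<theta> where "\<theta> = sgn (apply_bcontfun g x) *\<^sub>R eval_at x"
    have "norm \<theta> \<le> 1" using norm_eval_at_le[of x] by (simp add: \<theta>_def sgn_real_def)
    then have "\<theta> \<in> eval_ball" by (simp add: eval_ball_def \<theta>_def span_scale span_base)
    moreover have "blinfun_apply \<theta> g = \<bar>apply_bcontfun g x\<bar>"
      by (simp add: \<theta>_def blinfun.scaleR_left abs_sgn mult.commute)
    moreover have "blinfun_apply \<psi> g \<le> norm g" using blinfun_apply_le_norm[OF \<psi>, of g] by simp
    ultimately show ?thesis unfolding app using x by (intro bexI[of _ \<theta>]) auto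
  qed
qed (simp_all add: blinfun.add_left blinfun.scaleR_left \<epsilon>)

text \<open>The hypothesis \<open>approx\<close> says that \<open>G\<close>, an element of the bidual of \<open>C(X)\<close>, is a weak* limit
  of elements of a weakly relatively compact set, up to an error \<open>\<eta>\<close>.\<close>

lemma weak_star_limit_lower_semicontinuous:
  fixes G :: "(('x::topological_space \<Rightarrow>\<^sub>C real) \<Rightarrow>\<^sub>L real) \<Rightarrow> real"
  assumes approx: "\<And>\<eta>. 0 < \<eta> \<Longrightarrow> \<exists>W. no_ladder W \<and> (\<forall>\<Psi>. finite \<Psi> \<and> (\<forall>\<psi>\<in>\<Psi>. norm \<psi> \<le> 1) \<longrightarrow>
      (\<exists>w\<in>W. \<forall>\<psi>\<in>\<Psi>. \<bar>blinfun_apply \<psi> w - G \<psi>\<bar> \<le> \<eta>))"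
    and \<eta>: "0 < \<eta>"
  shows "\<forall>\<^sub>F y in nhds x. G (eval_at x) - \<eta> < G (eval_at y)"
proof (rule ccontr)
  assume "\<not> ?thesis"
  then have freq: "\<exists>\<^sub>F y in nhds x. G (eval_at y) \<le> G (eval_at x) - \<eta>"
    by (simp add: not_eventually not_less)
  define \<epsilon> where "\<epsilon> = \<eta> / 4"
  have \<epsilon>: "0 < \<epsilon>" using \<eta> by (simp add: \<epsilon>_def)
  from approx[OF \<epsilon>] obtain W where W: "no_ladder W" "\<And>\<Psi>. finite \<Psi> \<Longrightarrow> (\<forall>\<psi>\<in>\<Psi>. norm \<psi> \<le> 1) \<Longrightarrow>
      (\<exists>w\<in>W. \<forall>\<psi>\<in>\<Psi>. \<bar>blinfun_apply \<psi> w - G \<psi>\<bar> \<le> \<epsilon>)" by auto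
  \<comment> \<open>In the ladder, elements of \<open>W\<close> follow \<open>G\<close> at finitely
    many points, and points near \<open>x\<close> at which \<open>G\<close> has dropped by
    \<open>\<eta>\<close> follow \<open>x\<close> on finitely many elements of \<open>W\<close>. It
    would give that \<open>\<eta>\<close> is at most \<open>3 * \<epsilon>\<close>.\<close>
  have "(G (eval_at x) - \<epsilon>) - \<epsilon> \<le> (G (eval_at x) - \<eta>) + \<epsilon>"
  proof (rule ladder_le[OF W(1), where \<Theta> = "range eval_at" and \<psi> = "\<lambda>w. apply_bcontfun w x" and G = G])
    show "norm \<theta> \<le> 1" if "\<theta> \<in> range eval_at" for \<theta> :: "('x \<Rightarrow>\<^sub>C real) \<Rightarrow>\<^sub>L real"
      using that norm_eval_at_le by auto
    fix \<Theta> :: "(('x \<Rightarrow>\<^sub>C real) \<Rightarrow>\<^sub>L real) set"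
    assume \<Theta>: "finite \<Theta>" "\<Theta> \<subseteq> range eval_at"
    have "\<forall>\<psi>\<in>insert (eval_at x) \<Theta>. norm \<psi> \<le> 1" using \<Theta>(2) norm_eval_at_le by auto
    from W(2)[OF _ this] obtain w where
      w: "w \<in> W" "\<forall>\<psi>\<in>insert (eval_at x) \<Theta>. \<bar>blinfun_apply \<psi> w - G \<psi>\<bar> \<le> \<epsilon>" using \<Theta>(1) by auto
    show "\<exists>w\<in>W. G (eval_at x) - \<epsilon> \<le> apply_bcontfun w x \<and> (\<forall>\<theta>\<in>\<Theta>. blinfun_apply \<theta> w \<le> G \<theta> + \<epsilon>)"
    proof (intro bexI[of _ w] conjI ballI w(1))
      show "G (eval_at x) - \<epsilon> \<le> apply_bcontfun w x" using w(2) by (simp add: abs_le_iff)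
      show "blinfun_apply \<theta> w \<le> G \<theta> + \<epsilon>" if "\<theta> \<in> \<Theta>" for \<theta>
        using bspec[OF w(2), of \<theta>] that by (simp add: abs_le_iff)
    qed
  next
    fix W\<^sub>0 assume W\<^sub>0: "finite W\<^sub>0" "W\<^sub>0 \<subseteq> W"
    have "\<forall>\<^sub>F y in nhds x. apply_bcontfun w x - \<epsilon> < apply_bcontfun w y" for w :: "'x \<Rightarrow>\<^sub>C real"
    proof (rule order_tendstoD)
      have "continuous_on UNIV (apply_bcontfun w)" by simp
      then show "(apply_bcontfun w \<longlongrightarrow> apply_bcontfun w x) (nhds x)"
        by (simp add: continuous_on_def tendsto_at_iff_tendsto_nhds)
    qed (use \<epsilon> in simp)
    then have "\<forall>\<^sub>F y in nhds x. \<forall>w\<in>W\<^sub>0. apply_bcontfun w x - \<epsilon> < apply_bcontfun w y"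
      using W\<^sub>0(1) by (simp add: eventually_ball_finite)
    from frequently_ex[OF frequently_eventually_frequently[OF freq this]] obtain y where
      "G (eval_at y) \<le> G (eval_at x) - \<eta>" "\<forall>w\<in>W\<^sub>0. apply_bcontfun w x - \<epsilon> < apply_bcontfun w y" by auto
    then show "\<exists>\<theta>\<in>range eval_at. G \<theta> \<le> G (eval_at x) - \<eta> \<and>
        (\<forall>w\<in>W\<^sub>0. apply_bcontfun w x - \<epsilon> \<le> blinfun_apply \<theta> w)"
      by (intro bexI[of _ "eval_at y"]) (auto simp: less_imp_le)
  qed
  then show False using \<eta> by (simp add: \<epsilon>_def)
qed

text \<open>A ladder as for lower semicontinuity, with members of \<open>eval_ball\<close> that tend
  weak* to \<open>\<psi>\<close> instead of points that tend to \<open>x\<close>. With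
  \<open>e\<close> among the test functions, \<open>G \<theta>\<close>, which is the value of
  \<open>\<theta>\<close> at \<open>e\<close>, stays close to the value of \<open>\<psi>\<close> at
  \<open>e\<close>. Applying the lemma to \<open>- \<psi>\<close> reverses the inequality.\<close>

lemma weak_star_limit_le:
  fixes G :: "(('x::topological_space \<Rightarrow>\<^sub>C real) \<Rightarrow>\<^sub>L real) \<Rightarrow> real"
  assumes approx: "\<And>\<eta>. 0 < \<eta> \<Longrightarrow> \<exists>W. no_ladder W \<and> (\<forall>\<Psi>. finite \<Psi> \<and> (\<forall>\<psi>\<in>\<Psi>. norm \<psi> \<le> 1) \<longrightarrow>
      (\<exists>w\<in>W. \<forall>\<psi>\<in>\<Psi>. \<bar>blinfun_apply \<psi> w - G \<psi>\<bar> \<le> \<eta>))"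
    and e: "\<And>\<theta>. \<theta> \<in> eval_ball \<Longrightarrow> G \<theta> = blinfun_apply \<theta> e" and \<psi>: "norm \<psi> \<le> 1"
  shows "G \<psi> \<le> blinfun_apply \<psi> e"
proof (rule field_le_epsilon)
  fix \<eta> :: real assume "0 < \<eta>"
  define \<epsilon> where "\<epsilon> = \<eta> / 4"
  have \<epsilon>: "0 < \<epsilon>" using \<open>0 < \<eta>\<close> by (simp add: \<epsilon>_def)
  from approx[OF \<epsilon>] obtain W where W: "no_ladder W" "\<And>\<Psi>. finite \<Psi> \<Longrightarrow> (\<forall>\<psi>\<in>\<Psi>. norm \<psi> \<le> 1) \<Longrightarrow>
      (\<exists>w\<in>W. \<forall>\<psi>\<in>\<Psi>. \<bar>blinfun_apply \<psi> w - G \<psi>\<bar> \<le> \<epsilon>)" by auto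
  have "(G \<psi> - \<epsilon>) - \<epsilon> \<le> (blinfun_apply \<psi> e + \<epsilon>) + \<epsilon>"
  proof (rule ladder_le[OF W(1), where \<Theta> = eval_ball and \<psi> = "blinfun_apply \<psi>" and G = G])
    show "norm \<theta> \<le> 1" if "\<theta> \<in> eval_ball" for \<theta> :: "('x \<Rightarrow>\<^sub>C real) \<Rightarrow>\<^sub>L real"
      using that by (simp add: eval_ball_def)
    fix \<Theta> :: "(('x \<Rightarrow>\<^sub>C real) \<Rightarrow>\<^sub>L real) set"
    assume \<Theta>: "finite \<Theta>" "\<Theta> \<subseteq> eval_ball"
    have "\<forall>\<psi>\<in>insert \<psi> \<Theta>. norm \<psi> \<le> 1" using \<Theta>(2) \<psi> by (auto simp: eval_ball_def)
    from W(2)[OF _ this] obtain w where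
      w: "w \<in> W" "\<forall>\<psi>\<in>insert \<psi> \<Theta>. \<bar>blinfun_apply \<psi> w - G \<psi>\<bar> \<le> \<epsilon>" using \<Theta>(1) by auto
    show "\<exists>w\<in>W. G \<psi> - \<epsilon> \<le> blinfun_apply \<psi> w \<and> (\<forall>\<theta>\<in>\<Theta>. blinfun_apply \<theta> w \<le> G \<theta> + \<epsilon>)"
    proof (intro bexI[of _ w] conjI ballI w(1))
      show "G \<psi> - \<epsilon> \<le> blinfun_apply \<psi> w" using w(2) by (simp add: abs_le_iff)
      show "blinfun_apply \<theta> w \<le> G \<theta> + \<epsilon>" if "\<theta> \<in> \<Theta>" for \<theta>
        using bspec[OF w(2), of \<theta>] that by (simp add: abs_le_iff)
    qed
  next
    fix W\<^sub>0 assume W\<^sub>0: "finite W\<^sub>0" "W\<^sub>0 \<subseteq> W"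
    from eval_ball_weak_star_dense[OF \<psi> _ \<epsilon>, of "insert e W\<^sub>0"] obtain \<theta> where
      \<theta>: "\<theta> \<in> eval_ball" "\<forall>f\<in>insert e W\<^sub>0. \<bar>blinfun_apply \<theta> f - blinfun_apply \<psi> f\<bar> \<le> \<epsilon>"
      using W\<^sub>0(1) by auto
    show "\<exists>\<theta>\<in>eval_ball. G \<theta> \<le> blinfun_apply \<psi> e + \<epsilon> \<and>
        (\<forall>w\<in>W\<^sub>0. blinfun_apply \<psi> w - \<epsilon> \<le> blinfun_apply \<theta> w)"
    proof (intro bexI[of _ \<theta>] conjI ballI \<theta>(1))
      show "G \<theta> \<le> blinfun_apply \<psi> e + \<epsilon>" using \<theta>(2) by (simp add: e[OF \<theta>(1)] abs_le_iff)
      show "blinfun_apply \<psi> w - \<epsilon> \<le> blinfun_apply \<theta> w" if "w \<in> W\<^sub>0" for w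
        using bspec[OF \<theta>(2), of w] that by (simp add: abs_le_iff)
    qed
  qed
  then show "G \<psi> \<le> blinfun_apply \<psi> e + \<eta>" by (simp add: \<epsilon>_def)
qed

text \<open>The values of \<open>G\<close> at evaluations determine the only candidate for
  \<open>e\<close>. This function is continuous because the hypothesis is invariant under a change
  of sign of \<open>G\<close>, so that semicontinuity holds on both sides.\<close>

lemma weak_star_limit_represented:
  fixes G :: "(('x::topological_space \<Rightarrow>\<^sub>C real) \<Rightarrow>\<^sub>L real) \<Rightarrow> real"
  assumes approx: "\<And>\<eta>. 0 < \<eta> \<Longrightarrow> \<exists>W. no_ladder W \<and> (\<forall>\<Psi>. finite \<Psi> \<and> (\<forall>\<psi>\<in>\<Psi>. norm \<psi> \<le> 1) \<longrightarrow>
      (\<exists>w\<in>W. \<forall>\<psi>\<in>\<Psi>. \<bar>blinfun_apply \<psi> w - G \<psi>\<bar> \<le> \<eta>))"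
    and G: "functional_on UNIV G" and bound: "\<And>\<psi>. \<bar>G \<psi>\<bar> \<le> C * norm \<psi>" and C: "0 \<le> C"
  shows "\<exists>e. \<forall>\<psi>. G \<psi> = blinfun_apply \<psi> e"
proof -
  define g where "g x = G (eval_at x)" for x
  have approx_minus: "\<exists>W. no_ladder W \<and> (\<forall>\<Psi>. finite \<Psi> \<and> (\<forall>\<psi>\<in>\<Psi>. norm \<psi> \<le> 1) \<longrightarrow>
      (\<exists>w\<in>W. \<forall>\<psi>\<in>\<Psi>. \<bar>blinfun_apply \<psi> w - - G \<psi>\<bar> \<le> \<eta>))" if "0 < \<eta>" for \<eta>
  proof -
    from approx[OF that] obtain W where W: "no_ladder W" "\<And>\<Psi>. finite \<Psi> \<Longrightarrow> (\<forall>\<psi>\<in>\<Psi>. norm \<psi> \<le> 1) \<Longrightarrow>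
      (\<exists>w\<in>W. \<forall>\<psi>\<in>\<Psi>. \<bar>blinfun_apply \<psi> w - G \<psi>\<bar> \<le> \<eta>)" by auto
    show ?thesis
    proof (intro exI[of _ "uminus ` W"] conjI no_ladder_uminus[OF W(1)] allI impI)
      fix \<Psi> :: "(('x \<Rightarrow>\<^sub>C real) \<Rightarrow>\<^sub>L real) set"
      assume "finite \<Psi> \<and> (\<forall>\<psi>\<in>\<Psi>. norm \<psi> \<le> 1)"
      then obtain w where w: "w \<in> W" "\<forall>\<psi>\<in>\<Psi>. \<bar>blinfun_apply \<psi> w - G \<psi>\<bar> \<le> \<eta>" using W(2) by blast
      have "\<bar>blinfun_apply \<psi> (- w) - - G \<psi>\<bar> \<le> \<eta>" if "\<psi> \<in> \<Psi>" for \<psi>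
        using bspec[OF w(2) that] by (simp add: blinfun.minus_right abs_le_iff)
      with w(1) show "\<exists>w\<in>uminus ` W. \<forall>\<psi>\<in>\<Psi>. \<bar>blinfun_apply \<psi> w - - G \<psi>\<bar> \<le> \<eta>" by blast
    qed
  qed
  have "continuous_on UNIV g"
    unfolding continuous_on_def tendsto_at_iff_tendsto_nhds
  proof (intro ballI order_tendstoI)
    fix x a assume "a < g x"
    then have "\<forall>\<^sub>F y in nhds x. G (eval_at x) - (g x - a) < G (eval_at y)"
      by (intro weak_star_limit_lower_semicontinuous[OF approx]) auto
    then show "\<forall>\<^sub>F y in nhds x. a < g y" by (simp add: g_def)
  next
    fix x a assume "g x < a"
    then have "\<forall>\<^sub>F y in nhds x. - G (eval_at x) - (a - g x) < - G (eval_at y)"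
      by (intro weak_star_limit_lower_semicontinuous[OF approx_minus]) auto
    then show "\<forall>\<^sub>F y in nhds x. g y < a" by (simp add: g_def)
  qed
  moreover have "norm (g x) \<le> C" for x
  proof -
    have "\<bar>G (eval_at x)\<bar> \<le> C * norm (eval_at x)" by (rule bound)
    also have "\<dots> \<le> C * 1" by (intro mult_left_mono norm_eval_at_le C)
    finally show ?thesis by (simp add: g_def)
  qed
  ultimately have "g \<in> bcontfun" by (rule bcontfun_normI)
  then obtain e where e: "\<And>x. apply_bcontfun e x = g x"
    by (intro that[of "Bcontfun g"]) (simp add: Bcontfun_inverse)
  have span: "G \<theta> = blinfun_apply \<theta> e" if "\<theta> \<in> span (range eval_at)" for \<theta>
    using that
  proof (induction rule: span_induct_alt)
    case base
    show ?case using functional_onD(2)[OF G UNIV_I, of 0 0] by simp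
  next
    case (step c \<theta> \<theta>')
    then obtain x where "\<theta> = eval_at x" by auto
    with step show ?case
      by (simp add: functional_onD[OF G] blinfun.add_left blinfun.scaleR_left e g_def)
  qed
  then have ball: "G \<theta> = blinfun_apply \<theta> e" if "\<theta> \<in> eval_ball" for \<theta>
    using that by (simp add: eval_ball_def)
  have eq1: "G \<psi> = blinfun_apply \<psi> e" if "norm \<psi> \<le> 1" for \<psi>
  proof (rule antisym)
    show "G \<psi> \<le> blinfun_apply \<psi> e" by (rule weak_star_limit_le[OF approx ball that])
    have "norm (- \<psi>) \<le> 1" using that by simp
    from weak_star_limit_le[OF approx ball this] show "blinfun_apply \<psi> e \<le> G \<psi>"
      using functional_on_minus[OF G UNIV_I, of \<psi>] by (simp add: blinfun.minus_left)
  qed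
  have "G \<psi> = blinfun_apply \<psi> e" for \<psi>
  proof (cases "\<psi> = 0")
    case False
    have "G ((1 / norm \<psi>) *\<^sub>R \<psi>) = blinfun_apply ((1 / norm \<psi>) *\<^sub>R \<psi>) e"
      using False by (intro eq1) simp
    then show ?thesis using False functional_onD(2)[OF G UNIV_I, of "1 / norm \<psi>" \<psi>]
      by (simp add: blinfun.scaleR_left)
  qed (simp add: eq1)
  then show ?thesis by blast
qed

text \<open>An element of the bidual is approximated from a ball of \<open>space\<close> by
  \<open>bidual_approx\<close>, and this ball from one multiple of \<open>W\<close> by
  \<open>space_near_W\<close>, each time up to \<open>\<eta> / 2\<close>.\<close>

lemma reflexive_space_bcontfun:
  fixes W :: "('x::topological_space \<Rightarrow>\<^sub>C real) set"
  assumes "interpolation W" and W: "no_ladder W"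
  shows "reflexive_on (interpolation.space W) (interpolation.nrm W)"
proof -
  interpret interpolation W by fact
  show ?thesis
  proof (rule reflexive_space)
    fix F assume F: "F \<in> bidual space nrm"
    define G where "G \<psi> = F (restrict (blinfun_apply \<psi>) space)" for \<psi>
    have "\<exists>C. \<forall>\<phi>\<in>dual space nrm. \<bar>F \<phi>\<bar> \<le> C * dual_norm space nrm \<phi>"
      using F by (simp add: bidual_def)
    then obtain C' where C': "\<And>\<phi>. \<phi> \<in> dual space nrm \<Longrightarrow> \<bar>F \<phi>\<bar> \<le> C' * dual_norm space nrm \<phi>" by blast
    define C where "C = \<bar>C'\<bar> + 1"
    have C0: "0 < C" by (simp add: C_def)
    have FC: "\<bar>F \<phi>\<bar> \<le> C * dual_norm space nrm \<phi>" if "\<phi> \<in> dual space nrm" for \<phi>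
    proof -
      have "C' * dual_norm space nrm \<phi> \<le> C * dual_norm space nrm \<phi>"
        using dual_norm_nonneg[OF that] by (intro mult_right_mono) (auto simp: C_def)
      with C'[OF that] show ?thesis by linarith
    qed
    have "\<exists>e. \<forall>\<psi>. G \<psi> = blinfun_apply \<psi> e"
    proof (rule weak_star_limit_represented)
      show "functional_on UNIV G"
        by (simp add: functional_on_def G_def bidual_linear[OF F])
      fix \<psi> :: "('x \<Rightarrow>\<^sub>C real) \<Rightarrow>\<^sub>L real"
      have "dual_norm space nrm (restrict (blinfun_apply \<psi>) space) \<le> norm \<psi>"
      proof (rule dual_norm_le)
        fix v assume v: "v \<in> space"
        have "\<bar>blinfun_apply \<psi> v\<bar> \<le> norm \<psi> * norm v" using norm_blinfun[of \<psi> v] by simp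
        also have "\<dots> \<le> norm \<psi> * nrm v" using norm_le_nrm[OF v] by (intro mult_left_mono) auto
        finally show "\<bar>restrict (blinfun_apply \<psi>) space v\<bar> \<le> norm \<psi> * nrm v" using v by simp
      qed simp
      then have "C * dual_norm space nrm (restrict (blinfun_apply \<psi>) space) \<le> C * norm \<psi>"
        using C0 by (intro mult_left_mono) auto
      then show "\<bar>G \<psi>\<bar> \<le> C * norm \<psi>"
        using FC[OF restrict_dual, of \<psi>] unfolding G_def by linarith
    next
      fix \<eta> :: real assume \<eta>: "0 < \<eta>"
      then obtain n where n: "(1/2) ^ n < \<eta> / (4 * C)"
        using real_arch_pow_inv[of "\<eta> / (4 * C)" "1/2"] C0 by auto
      show "\<exists>W. no_ladder W \<and> (\<forall>\<Psi>. finite \<Psi> \<and> (\<forall>\<psi>\<in>\<Psi>. norm \<psi> \<le> 1) \<longrightarrow>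
        (\<exists>w\<in>W. \<forall>\<psi>\<in>\<Psi>. \<bar>blinfun_apply \<psi> w - G \<psi>\<bar> \<le> \<eta>))"
      proof (intro exI[of _ "(*\<^sub>R) (2 ^ Suc n * C) ` W"] conjI allI impI)
        show "no_ladder ((*\<^sub>R) (2 ^ Suc n * C) ` W)" using C0 by (intro no_ladder_scale W) simp
        fix \<Psi> :: "(('x \<Rightarrow>\<^sub>C real) \<Rightarrow>\<^sub>L real) set"
        assume \<Psi>: "finite \<Psi> \<and> (\<forall>\<psi>\<in>\<Psi>. norm \<psi> \<le> 1)"
        have "0 < \<eta> / 2" using \<eta> by simp
        with bidual_approx[OF F C0 FC _ this, of \<Psi>] \<Psi> obtain v where
          v: "v \<in> space" "nrm v \<le> C" "\<forall>\<psi>\<in>\<Psi>. \<bar>blinfun_apply \<psi> v - G \<psi>\<bar> \<le> \<eta> / 2"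
          unfolding G_def by blast
        obtain w where w: "w \<in> (*\<^sub>R) (2 ^ Suc n * C) ` W" "norm (v - w) \<le> 2 * C * (1/2) ^ n"
          by (rule space_near_W[OF v(1,2) C0])
        have "2 * C * (1/2) ^ n \<le> \<eta> / 2" using n C0 by (simp add: field_simps)
        with w(2) have vw: "norm (v - w) \<le> \<eta> / 2" by linarith
        have "\<bar>blinfun_apply \<psi> w - G \<psi>\<bar> \<le> \<eta>" if "\<psi> \<in> \<Psi>" for \<psi>
        proof -
          have "norm \<psi> \<le> 1" using \<Psi> that by blast
          from blinfun_apply_le_norm[OF this, of "v - w"] vw bspec[OF v(3) that]
          show ?thesis unfolding blinfun.diff_right by linarith
        qed
        with w(1) show "\<exists>w\<in>(*\<^sub>R) (2 ^ Suc n * C) ` W. \<forall>\<psi>\<in>\<Psi>. \<bar>blinfun_apply \<psi> w - G \<psi>\<bar> \<le> \<eta>" by blast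
      qed
    qed (use C0 in simp)
    then show "\<exists>e. \<forall>\<psi>. F (restrict (blinfun_apply \<psi>) space) = blinfun_apply \<psi> e"
      by (simp add: G_def)
  qed
qed

section \<open>Weak continuity of translations\<close>

lemma continuous_on_uniform_approx:
  fixes f :: "'s::topological_space \<Rightarrow> real"
  assumes "\<And>\<epsilon>. 0 < \<epsilon> \<Longrightarrow> \<exists>g. continuous_on UNIV g \<and> (\<forall>s. \<bar>f s - g s\<bar> \<le> \<epsilon>)"
  shows "continuous_on UNIV f"
proof -
  have "\<forall>n. \<exists>g. continuous_on UNIV g \<and> (\<forall>s. \<bar>f s - g s\<bar> \<le> (1/2) ^ n)"
    using assms by simp
  from choice[OF this] obtain g where
    g: "\<And>n. continuous_on UNIV (g n)" "\<And>n s. \<bar>f s - g n s\<bar> \<le> (1/2) ^ n" by auto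
  have "uniform_limit UNIV g f sequentially"
  proof (rule uniform_limitI)
    fix e :: real assume "0 < e"
    then obtain N where N: "(1/2) ^ N < e" using real_arch_pow_inv[of e "1/2"] by auto
    show "\<forall>\<^sub>F n in sequentially. \<forall>s\<in>UNIV. dist (g n s) (f s) < e"
      using eventually_ge_at_top[of N]
    proof eventually_elim
      case (elim n)
      have le: "(1/2 :: real) ^ n \<le> (1/2) ^ N" using elim by (intro power_decreasing) auto
      have "dist (g n s) (f s) < e" for s
        using g(2)[of s n] N le unfolding dist_real_def by linarith
      then show ?case by blast
    qed
  qed
  from uniform_limit_theorem[OF _ this] show ?thesis using g(1) by simp
qed

lemma continuous_on_UNIV_tendsto_nhds: "continuous_on UNIV g \<Longrightarrow> (g \<longlongrightarrow> g x) (nhds x)"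
  using tendsto_at_iff_tendsto_nhds[of g x] by (simp add: continuous_on_def)

lemma continuous_translate_point:
  assumes "flow act"
  shows "continuous_on UNIV (\<lambda>s. apply_bcontfun f (act s x))"
  using assms by (intro continuous_on_compose2[OF continuous_on_apply_bcontfun[of UNIV f]])
    (auto simp: flow_def)

lemma eval_ball_continuous_translate:
  fixes act :: "'s::semitopological_semigroup \<Rightarrow> 'x \<Rightarrow> 'x::topological_space"
  assumes act: "flow act" and \<theta>: "\<theta> \<in> span (range eval_at)"
  shows "continuous_on UNIV (\<lambda>s. blinfun_apply \<theta> (translate act f s))"
  using \<theta>
proof (induction rule: span_induct_alt)
  case (step c \<theta> \<theta>')
  then obtain x where "\<theta> = eval_at x" by auto
  have "continuous_on UNIV (\<lambda>s. c * apply_bcontfun f (act s x) + blinfun_apply \<theta>' (translate act f s))"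
    by (intro continuous_on_add continuous_on_mult_left continuous_translate_point[OF act] step(2))
  then show ?case
    by (simp add: \<open>\<theta> = eval_at x\<close> blinfun.add_left blinfun.scaleR_left translate_apply[OF act])
qed simp

text \<open>Orbit maps are continuous, so s |-> fs is continuous against combinations of
  evaluations. A ladder formed by translates near \<open>s\<^sub>0\<close> and by combinations
  tending to \<open>\<psi>\<close> extends one half of this continuity to \<open>\<psi>\<close>; the
  case of \<open>- \<psi>\<close> is the other half.\<close>

lemma translate_upper_semicontinuous:
  fixes act :: "'s::semitopological_semigroup \<Rightarrow> 'x \<Rightarrow> 'x::topological_space"
    and \<psi> :: "('x \<Rightarrow>\<^sub>C real) \<Rightarrow>\<^sub>L real"
  assumes act: "flow act" and W: "no_ladder (range (translate act f))"
    and \<psi>: "norm \<psi> \<le> 1" and \<eta>: "0 < \<eta>"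
  shows "\<forall>\<^sub>F s in nhds s\<^sub>0. blinfun_apply \<psi> (translate act f s) < blinfun_apply \<psi> (translate act f s\<^sub>0) + \<eta>"
proof (rule ccontr)
  let ?e = "translate act f s\<^sub>0"
  assume "\<not> ?thesis"
  then have freq: "\<exists>\<^sub>F s in nhds s\<^sub>0. blinfun_apply \<psi> ?e + \<eta> \<le> blinfun_apply \<psi> (translate act f s)"
    by (simp add: not_eventually not_less)
  define \<epsilon> where "\<epsilon> = \<eta> / 4"
  have \<epsilon>: "0 < \<epsilon>" using \<eta> by (simp add: \<epsilon>_def)
  have "(blinfun_apply \<psi> ?e + \<eta>) - \<epsilon> \<le> (blinfun_apply \<psi> ?e + \<epsilon>) + \<epsilon>"
  proof (rule ladder_le[OF W, where \<Theta> = eval_ball and \<psi> = "blinfun_apply \<psi>" and G = "\<lambda>\<theta>. blinfun_apply \<theta> ?e"])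
    show "norm \<theta> \<le> 1" if "\<theta> \<in> eval_ball" for \<theta> :: "('x \<Rightarrow>\<^sub>C real) \<Rightarrow>\<^sub>L real"
      using that by (simp add: eval_ball_def)
    fix \<Theta> :: "(('x \<Rightarrow>\<^sub>C real) \<Rightarrow>\<^sub>L real) set"
    assume \<Theta>: "finite \<Theta>" "\<Theta> \<subseteq> eval_ball"
    have "\<forall>\<^sub>F s in nhds s\<^sub>0. blinfun_apply \<theta> (translate act f s) < blinfun_apply \<theta> ?e + \<epsilon>"
      if "\<theta> \<in> \<Theta>" for \<theta>
    proof (rule order_tendstoD)
      have "\<theta> \<in> span (range eval_at)" using that \<Theta>(2) by (auto simp: eval_ball_def)
      from eval_ball_continuous_translate[OF act this]
      show "((\<lambda>s. blinfun_apply \<theta> (translate act f s)) \<longlongrightarrow> blinfun_apply \<theta> ?e) (nhds s\<^sub>0)"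
        by (rule continuous_on_UNIV_tendsto_nhds)
    qed (use \<epsilon> in simp)
    then have "\<forall>\<^sub>F s in nhds s\<^sub>0. \<forall>\<theta>\<in>\<Theta>. blinfun_apply \<theta> (translate act f s) < blinfun_apply \<theta> ?e + \<epsilon>"
      using \<Theta>(1) by (simp add: eventually_ball_finite)
    from frequently_ex[OF frequently_eventually_frequently[OF freq this]] obtain s where
      "blinfun_apply \<psi> ?e + \<eta> \<le> blinfun_apply \<psi> (translate act f s)"
      "\<forall>\<theta>\<in>\<Theta>. blinfun_apply \<theta> (translate act f s) < blinfun_apply \<theta> ?e + \<epsilon>" by auto
    then show "\<exists>w\<in>range (translate act f). blinfun_apply \<psi> ?e + \<eta> \<le> blinfun_apply \<psi> w \<and>
        (\<forall>\<theta>\<in>\<Theta>. blinfun_apply \<theta> w \<le> blinfun_apply \<theta> ?e + \<epsilon>)"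
      by (intro bexI[of _ "translate act f s"]) (auto simp: less_imp_le)
  next
    fix W\<^sub>0 assume W\<^sub>0: "finite W\<^sub>0" "W\<^sub>0 \<subseteq> range (translate act f)"
    from eval_ball_weak_star_dense[OF \<psi> _ \<epsilon>, of "insert ?e W\<^sub>0"] obtain \<theta> where
      \<theta>: "\<theta> \<in> eval_ball" "\<forall>f\<in>insert ?e W\<^sub>0. \<bar>blinfun_apply \<theta> f - blinfun_apply \<psi> f\<bar> \<le> \<epsilon>"
      using W\<^sub>0(1) by auto
    show "\<exists>\<theta>\<in>eval_ball. blinfun_apply \<theta> ?e \<le> blinfun_apply \<psi> ?e + \<epsilon> \<and>
        (\<forall>w\<in>W\<^sub>0. blinfun_apply \<psi> w - \<epsilon> \<le> blinfun_apply \<theta> w)"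
    proof (intro bexI[of _ \<theta>] conjI ballI \<theta>(1))
      show "blinfun_apply \<theta> ?e \<le> blinfun_apply \<psi> ?e + \<epsilon>" using \<theta>(2) by (simp add: abs_le_iff)
      show "blinfun_apply \<psi> w - \<epsilon> \<le> blinfun_apply \<theta> w" if "w \<in> W\<^sub>0" for w
        using bspec[OF \<theta>(2), of w] that by (simp add: abs_le_iff)
    qed
  qed
  then show False using \<eta> by (simp add: \<epsilon>_def)
qed

lemma weakly_continuous_translate:
  fixes act :: "'s::semitopological_semigroup \<Rightarrow> 'x \<Rightarrow> 'x::topological_space"
    and \<psi> :: "('x \<Rightarrow>\<^sub>C real) \<Rightarrow>\<^sub>L real"
  assumes act: "flow act" and W: "no_ladder (range (translate act f))"
  shows "continuous_on UNIV (\<lambda>s. blinfun_apply \<psi> (translate act f s))"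
proof -
  have ball: "continuous_on UNIV (\<lambda>s. blinfun_apply \<psi> (translate act f s))" if \<psi>: "norm \<psi> \<le> 1"
    for \<psi> :: "('x \<Rightarrow>\<^sub>C real) \<Rightarrow>\<^sub>L real"
  proof -
    define g where "g s = blinfun_apply \<psi> (translate act f s)" for s
    have "continuous_on UNIV g"
      unfolding continuous_on_def tendsto_at_iff_tendsto_nhds unfolding g_def
    proof (intro ballI order_tendstoI)
      fix s\<^sub>0 a assume "a < blinfun_apply \<psi> (translate act f s\<^sub>0)"
      then have "\<forall>\<^sub>F s in nhds s\<^sub>0. blinfun_apply (- \<psi>) (translate act f s) <
          blinfun_apply (- \<psi>) (translate act f s\<^sub>0) + (blinfun_apply \<psi> (translate act f s\<^sub>0) - a)"
        using \<psi> by (intro translate_upper_semicontinuous[OF act W]) simp_all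
      then show "\<forall>\<^sub>F s in nhds s\<^sub>0. a < blinfun_apply \<psi> (translate act f s)"
        by (simp add: blinfun.minus_left)
    next
      fix s\<^sub>0 a assume "blinfun_apply \<psi> (translate act f s\<^sub>0) < a"
      then have "\<forall>\<^sub>F s in nhds s\<^sub>0. blinfun_apply \<psi> (translate act f s) <
          blinfun_apply \<psi> (translate act f s\<^sub>0) + (a - blinfun_apply \<psi> (translate act f s\<^sub>0))"
        using \<psi> by (intro translate_upper_semicontinuous[OF act W]) simp_all
      then show "\<forall>\<^sub>F s in nhds s\<^sub>0. blinfun_apply \<psi> (translate act f s) < a" by simp
    qed
    then show ?thesis by (simp add: g_def)
  qed
  show ?thesis
  proof (cases "\<psi> = 0")
    case False
    have "continuous_on UNIV (\<lambda>s. norm \<psi> * blinfun_apply ((1 / norm \<psi>) *\<^sub>R \<psi>) (translate act f s))"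
      using False by (intro continuous_on_mult_left ball) simp
    with False show ?thesis by (simp add: blinfun.scaleR_left)
  qed simp
qed

lemma translate_sum_scaleR_continuous:
  fixes act :: "'s::semitopological_semigroup \<Rightarrow> 'x \<Rightarrow> 'x::topological_space"
    and \<psi> :: "('x \<Rightarrow>\<^sub>C real) \<Rightarrow>\<^sub>L real"
  assumes act: "flow act"
    and A: "\<And>a. a \<in> A \<Longrightarrow> continuous_on UNIV (\<lambda>s. blinfun_apply \<psi> (translate act a s))"
    and f: "f \<in> span A"
  shows "continuous_on UNIV (\<lambda>s. blinfun_apply \<psi> (translate act f s))"
  using f
proof (induction rule: span_induct_alt)
  case base
  have "translate act 0 s = 0" for s
    using translate_scaleR[OF act, of 0 0 s] by simp
  then show ?case by simp
next
  case (step c a b)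
  have "continuous_on UNIV (\<lambda>s. c * blinfun_apply \<psi> (translate act a s) + blinfun_apply \<psi> (translate act b s))"
    by (intro continuous_on_add continuous_on_mult_left A step)
  then show ?case
    by (simp add: translate_add[OF act] translate_scaleR[OF act] blinfun.add_right blinfun.scaleR_right)
qed

text \<open>Each block \<open>P n\<close> consists of scaled translates of one wap function with
  both signs and has norm at most 2^-n. Up to any given error the union of the blocks is a finite
  one, so it keeps the double limit property; the scaling does not affect the topology
  generated.\<close>

lemma wap_generating_set:
  fixes act :: "'s::semitopological_semigroup \<Rightarrow> 'x \<Rightarrow> 'x::second_countable_topology"
  assumes act: "flow act" and wap: "wap act"
  obtains A where "no_ladder A" "0 \<in> A" "uminus ` A = A" "\<And>a. a \<in> A \<Longrightarrow> norm a \<le> 1"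
    "\<And>a s. a \<in> A \<Longrightarrow> translate act a s \<in> A"
    "\<And>U x. open U \<Longrightarrow> x \<in> U \<Longrightarrow> \<exists>f\<in>A. \<exists>\<epsilon>>0. \<forall>y. \<bar>apply_bcontfun f y - apply_bcontfun f x\<bar> < \<epsilon> \<longrightarrow> y \<in> U"
proof -
  obtain r :: "nat \<Rightarrow> 'x \<Rightarrow>\<^sub>C real" where r: "range r \<subseteq> WAP act"
    and base: "\<And>U x. open U \<Longrightarrow> x \<in> U \<Longrightarrow>
      \<exists>n. \<exists>G\<in>{apply_bcontfun (r n) -` Q | Q. open Q}. x \<in> G \<and> G \<subseteq> U"
  proof (rule countable_subfamily_basis[of "WAP act" "\<lambda>f. {apply_bcontfun f -` Q | Q. open Q}"])
    show "open G" if "G \<in> {apply_bcontfun f -` Q | Q. open Q}" for f :: "'x \<Rightarrow>\<^sub>C real" and G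
      using that by (auto intro!: open_vimage)
    fix U :: "'x set" and x assume "open U" "x \<in> U"
    then have "closed (- U) \<and> x \<notin> - U" by auto
    with wap obtain f where f: "f \<in> WAP act" "apply_bcontfun f x \<notin> closure (apply_bcontfun f ` (- U))"
      unfolding wap_def by blast
    let ?G = "apply_bcontfun f -` (- closure (apply_bcontfun f ` (- U)))"
    have "?G \<subseteq> U" using closure_subset[of "apply_bcontfun f ` (- U)"] by auto
    moreover have "?G \<in> {apply_bcontfun f -` Q | Q. open Q}" by auto
    ultimately show "\<exists>f\<in>WAP act. \<exists>G\<in>{apply_bcontfun f -` Q | Q. open Q}. x \<in> G \<and> G \<subseteq> U"
      using f by (intro bexI[OF _ f(1)] bexI[of _ ?G]) auto
  qed (rule that)
  define c where "c n = (1/2) ^ n / (1 + norm (r n))" for n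
  \<comment> \<open>The semigroup need not have an identity, so the orbit need not contain the
    function itself.\<close>
  define O' where "O' n = insert (r n) (range (translate act (r n)))" for n
  define P where "P n = (*\<^sub>R) (c n) ` O' n \<union> uminus ` (*\<^sub>R) (c n) ` O' n" for n
  define A where "A = insert 0 (\<Union>n. P n)"
  have c: "0 < c n" for n by (simp add: c_def add_pos_nonneg)
  have O'_norm: "norm f \<le> norm (r n)" if "f \<in> O' n" for f n
    using that norm_translate_le[OF act] by (auto simp: O'_def)
  have P_norm: "norm a \<le> (1/2) ^ n" if a: "a \<in> P n" for a n
  proof -
    from a obtain f where f: "f \<in> O' n" "norm a = c n * norm f"
      using c[of n] by (auto simp: P_def)
    have "c n * norm f \<le> c n * (1 + norm (r n))" using O'_norm[OF f(1)] c[of n] by (intro mult_left_mono) auto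
    also have "\<dots> = (1/2) ^ n" using norm_ge_zero[of "r n"] by (simp add: c_def add_nonneg_eq_0_iff)
    finally show ?thesis using f by simp
  qed
  have P_no_ladder: "no_ladder (P n)" for n
  proof -
    have "relatively_weakly_compact (range (translate act (r n)))" using r by (auto simp: WAP_def)
    from relatively_weakly_compact_no_ladder[OF this]
    have "no_ladder ({r n} \<union> range (translate act (r n)))"
      by (intro no_ladder_Un no_ladder_singleton)
    then have "no_ladder (O' n)" by (simp add: O'_def)
    then show ?thesis unfolding P_def
      using c by (intro no_ladder_Un no_ladder_uminus no_ladder_scale)
  qed
  show thesis
  proof
    show "no_ladder A"
    proof (rule no_ladder_approx)
      fix \<epsilon> :: real assume "0 < \<epsilon>"
      then obtain K where K: "(1/2) ^ K < \<epsilon>" using real_arch_pow_inv[of \<epsilon> "1/2"] by auto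
      have nl: "no_ladder (insert 0 (\<Union>n<k. P n))" for k
      proof (induction k)
        case 0
        show ?case by (simp add: no_ladder_singleton)
      next
        case (Suc k)
        have "insert 0 (\<Union>n<Suc k. P n) = insert 0 (\<Union>n<k. P n) \<union> P k" by (auto simp: less_Suc_eq)
        then show ?case using no_ladder_Un[OF Suc P_no_ladder] by simp
      qed
      have ap: "\<exists>b\<in>insert 0 (\<Union>n<K. P n). norm (a - b) \<le> \<epsilon>" if "a \<in> A" for a
      proof (cases "a \<in> insert 0 (\<Union>n<K. P n)")
        case True
        then show ?thesis using \<open>0 < \<epsilon>\<close> by (intro bexI[of _ a]) auto
      next
        case False
        with that obtain n where n: "a \<in> P n" by (auto simp: A_def)
        have "K \<le> n"
        proof (rule ccontr)
          assume "\<not> K \<le> n"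
          with n have "a \<in> (\<Union>n<K. P n)" by auto
          with False show False by simp
        qed
        have "norm a \<le> (1/2) ^ n" by (rule P_norm[OF n])
        also have "\<dots> \<le> (1/2) ^ K" using \<open>K \<le> n\<close> by (intro power_decreasing) auto
        finally show ?thesis using K by (intro bexI[of _ 0]) auto
      qed
      show "\<exists>B. no_ladder B \<and> (\<forall>a\<in>A. \<exists>b\<in>B. norm (a - b) \<le> \<epsilon>)"
        by (intro exI[of _ "insert 0 (\<Union>n<K. P n)"] conjI ballI nl ap)
    qed
    show "0 \<in> A" by (simp add: A_def)
    have "uminus ` P n = P n" for n by (simp add: P_def image_Un image_image Un_commute)
    then show "uminus ` A = A" by (simp add: A_def image_UN)
    show "norm a \<le> 1" if "a \<in> A" for a
    proof (cases "a = 0")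
      case False
      with that obtain n where "a \<in> P n" by (auto simp: A_def)
      from P_norm[OF this] show ?thesis by (rule order_trans) (simp add: power_le_one)
    qed simp
    have O'_inv: "translate act f s \<in> O' n" if "f \<in> O' n" for f s n
      using that by (auto simp: O'_def translate_translate[OF act])
    have minus: "translate act (- f) s = - translate act f s" for f :: "'x \<Rightarrow>\<^sub>C real" and s
      using translate_scaleR[OF act, of "-1" f s] by simp
    have zero: "translate act (0 :: 'x \<Rightarrow>\<^sub>C real) s = 0" for s
      using translate_scaleR[OF act, of 0 "0 :: 'x \<Rightarrow>\<^sub>C real" s] by simp
    have P_inv: "translate act a s \<in> P n" if a: "a \<in> P n" for a s n
    proof -
      from a obtain f where f: "f \<in> O' n" "a = c n *\<^sub>R f \<or> a = - (c n *\<^sub>R f)" by (auto simp: P_def)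
      then have "translate act a s = c n *\<^sub>R translate act f s \<or>
          translate act a s = - (c n *\<^sub>R translate act f s)"
        by (auto simp: minus translate_scaleR[OF act])
      with O'_inv[OF f(1)] show ?thesis by (auto simp: P_def)
    qed
    show "translate act a s \<in> A" if "a \<in> A" for a s
      using that P_inv by (auto simp: A_def zero)
    show "\<exists>f\<in>A. \<exists>\<epsilon>>0. \<forall>y. \<bar>apply_bcontfun f y - apply_bcontfun f x\<bar> < \<epsilon> \<longrightarrow> y \<in> U"
      if U: "open U" "x \<in> U" for U x
    proof -
      from base[OF U] obtain n Q where Q: "open Q" "apply_bcontfun (r n) x \<in> Q"
        "apply_bcontfun (r n) -` Q \<subseteq> U" by auto
      from Q(1,2) obtain e where e: "0 < e" "\<And>z. \<bar>z - apply_bcontfun (r n) x\<bar> < e \<Longrightarrow> z \<in> Q"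
        by (auto simp: open_real)
      show ?thesis
      proof (intro bexI[of _ "c n *\<^sub>R r n"] exI[of _ "c n * e"] conjI allI impI)
        show "0 < c n * e" using e c by simp
        fix y assume "\<bar>apply_bcontfun (c n *\<^sub>R r n) y - apply_bcontfun (c n *\<^sub>R r n) x\<bar> < c n * e"
        then have "c n * \<bar>apply_bcontfun (r n) y - apply_bcontfun (r n) x\<bar> < c n * e"
          using c[of n] by (simp add: right_diff_distrib[symmetric] abs_mult)
        then have "\<bar>apply_bcontfun (r n) y - apply_bcontfun (r n) x\<bar> < e" using c[of n] by simp
        from e(2)[OF this] show "y \<in> U" using Q(3) by auto
      next
        show "c n *\<^sub>R r n \<in> A" by (auto simp: A_def P_def O'_def)
      qed
    qed
  qed
qed

lemma wap_imp_eberlein_flow: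
  fixes act :: "'s::semitopological_semigroup \<Rightarrow> 'x \<Rightarrow> 'x::second_countable_topology"
  assumes act: "flow act" and wap: "wap act"
  shows "eberlein_flow act"
proof -
  obtain A where A: "no_ladder A" "0 \<in> A" "uminus ` A = A" "\<And>a. a \<in> A \<Longrightarrow> norm a \<le> 1"
    "\<And>a s. a \<in> A \<Longrightarrow> translate act a s \<in> A"
    and gen: "\<And>U x. open U \<Longrightarrow> x \<in> U \<Longrightarrow>
      \<exists>f\<in>A. \<exists>\<epsilon>>0. \<forall>y. \<bar>apply_bcontfun f y - apply_bcontfun f x\<bar> < \<epsilon> \<longrightarrow> y \<in> U"
    by (rule wap_generating_set[OF act wap]) (rule that)
  define W where "W = convex hull A"
  have W: "no_ladder W" unfolding W_def by (rule no_ladder_convex_hull[OF A(1,4)])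
  have AW: "A \<subseteq> W" by (simp add: W_def hull_subset)
  interpret interpolation W
  proof
    show "convex W" by (simp add: W_def convex_convex_hull)
    show "0 \<in> W" using AW A(2) by auto
    show "- w \<in> W" if "w \<in> W" for w
    proof -
      have "(\<lambda>x. (-1) *\<^sub>R x) ` W = W"
        unfolding W_def convex_hull_scaling[symmetric] using A(3) by simp
      then show ?thesis using that by force
    qed
    have "W \<subseteq> cball 0 1" unfolding W_def using A(4) by (intro hull_minimal) (auto simp: convex_cball)
    then show "norm w \<le> 1" if "w \<in> W" for w using that by auto
  qed
  have W_inv: "translate act w s \<in> W" if "w \<in> W" for w s
  proof -
    have "W \<subseteq> {w. translate act w s \<in> W}"
      unfolding W_def
    proof (rule hull_minimal)
      show "A \<subseteq> {w. translate act w s \<in> convex hull A}" using hull_inc[OF A(5)] by auto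
      show "convex {w. translate act w s \<in> convex hull A}"
      proof (rule convexI)
        fix x y and u v :: real
        assume "x \<in> {w. translate act w s \<in> convex hull A}" "y \<in> {w. translate act w s \<in> convex hull A}"
          and uv: "0 \<le> u" "0 \<le> v" "u + v = 1"
        then have "u *\<^sub>R translate act x s + v *\<^sub>R translate act y s \<in> convex hull A"
          by (intro convexD[OF convex_convex_hull] uv) simp_all
        then show "u *\<^sub>R x + v *\<^sub>R y \<in> {w. translate act w s \<in> convex hull A}"
          by (simp add: translate_add[OF act] translate_scaleR[OF act])
      qed
    qed
    with that show ?thesis by auto
  qed
  \<comment> \<open>Translations map \<open>W\<close> into itself and do not increase the supremum
    norm, so every gauge, and with it \<open>nrm\<close>, can only decrease.\<close>
  have gauge_inv: "gauge n (translate act f s) \<le> gauge n f" for n f s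
  proof (rule gauge_greatest)
    fix t :: real and w assume tw: "0 \<le> t" "w \<in> W"
    have "gauge n (translate act f s) \<le>
        (1/2) ^ n * t + 2 ^ n * norm (translate act f s - t *\<^sub>R translate act w s)"
      by (rule gauge_lower[OF tw(1) W_inv[OF tw(2)]])
    also have "translate act f s - t *\<^sub>R translate act w s = translate act (f - t *\<^sub>R w) s"
      by (simp add: translate_diff[OF act] translate_scaleR[OF act])
    also have "2 ^ n * norm \<dots> \<le> 2 ^ n * norm (f - t *\<^sub>R w)"
      by (intro mult_left_mono norm_translate_le[OF act]) simp
    finally show "gauge n (translate act f s) \<le> (1/2) ^ n * t + 2 ^ n * norm (f - t *\<^sub>R w)" by simp
  qed
  have inv: "translate act f s \<in> space \<and> nrm (translate act f s) \<le> nrm f" if f: "f \<in> space" for f s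
  proof -
    have "(\<Sum>n<m. (gauge n (translate act f s))\<^sup>2) \<le> (nrm f)\<^sup>2" for m
    proof -
      have "(\<Sum>n<m. (gauge n (translate act f s))\<^sup>2) \<le> (\<Sum>n<m. (gauge n f)\<^sup>2)"
        by (intro sum_mono power_mono gauge_inv gauge_nonneg)
      also have "\<dots> \<le> (nrm f)\<^sup>2" by (rule sum_gauge_le[OF f])
      finally show ?thesis .
    qed
    from space_nrm_leI[OF nrm_nonneg[OF f] this] show ?thesis by blast
  qed
  \<comment> \<open>The orbit of \<open>f\<close> is uniformly close to that of a multiple of an
    element of \<open>W\<close>. This multiple is a linear combination of elements of
    \<open>A\<close>, whose orbits stay in \<open>A\<close> and hence have the double limit
    property.\<close>
  have weak: "continuous_on UNIV (\<lambda>s. blinfun_apply \<psi> (translate act f s))" if f: "f \<in> space"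
    for f and \<psi> :: "('x \<Rightarrow>\<^sub>C real) \<Rightarrow>\<^sub>L real"
  proof (rule continuous_on_uniform_approx)
    fix \<epsilon> :: real assume \<epsilon>: "0 < \<epsilon>"
    define C where "C = nrm f + 1"
    have C: "0 < C" "nrm f \<le> C" using nrm_nonneg[OF f] by (simp_all add: C_def)
    define D where "D = 2 * C * (norm \<psi> + 1)"
    have D: "0 < D" using C by (simp add: D_def add_nonneg_pos)
    obtain n where n: "(1/2) ^ n < \<epsilon> / D"
      using real_arch_pow_inv[of "\<epsilon> / D" "1/2"] \<epsilon> D by auto
    obtain w where w: "w \<in> (*\<^sub>R) (2 ^ Suc n * C) ` W" "norm (f - w) \<le> 2 * C * (1/2) ^ n"
      by (rule space_near_W[OF f C(2,1)])
    have "w \<in> span A"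
      using w(1) convex_hull_subset_span[of A] by (auto simp: W_def intro!: span_scale)
    moreover have "continuous_on UNIV (\<lambda>s. blinfun_apply \<psi> (translate act a s))" if "a \<in> A" for a
      using that A(5) by (intro weakly_continuous_translate[OF act] no_ladder_subset[OF A(1)]) auto
    ultimately have cont: "continuous_on UNIV (\<lambda>s. blinfun_apply \<psi> (translate act w s))"
      using translate_sum_scaleR_continuous[OF act] by blast
    have "\<bar>blinfun_apply \<psi> (translate act f s) - blinfun_apply \<psi> (translate act w s)\<bar> \<le> \<epsilon>" for s
    proof -
      have "\<bar>blinfun_apply \<psi> (translate act f s) - blinfun_apply \<psi> (translate act w s)\<bar> =
          norm (blinfun_apply \<psi> (translate act (f - w) s))"
        by (simp add: translate_diff[OF act] blinfun.diff_right)
      also have "\<dots> \<le> norm \<psi> * norm (translate act (f - w) s)" by (rule norm_blinfun)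
      also have "\<dots> \<le> (norm \<psi> + 1) * (2 * C * (1/2) ^ n)"
        using norm_translate_le[OF act, of "f - w" s] w(2) by (intro mult_mono) auto
      also have "\<dots> = (1/2) ^ n * D" by (simp add: D_def)
      also have "\<dots> \<le> \<epsilon>" using n D by (simp only: pos_less_divide_eq less_imp_le)
      finally show ?thesis .
    qed
    with cont show "\<exists>g. continuous_on UNIV g \<and> (\<forall>s. \<bar>blinfun_apply \<psi> (translate act f s) - g s\<bar> \<le> \<epsilon>)"
      by (intro exI[of _ "\<lambda>s. blinfun_apply \<psi> (translate act w s)"]) simp
  qed
  \<comment> \<open>From ambient functionals to all functionals on \<open>space\<close>: the error
    in \<open>dual_approx\<close> is uniform along the orbit, on which \<open>nrm\<close> is bounded
    by \<open>nrm f\<close>.\<close>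
  have wot: "continuous_on UNIV (\<lambda>s. \<phi> (translate act f s))"
    if \<phi>: "\<phi> \<in> dual space nrm" and f: "f \<in> space" for \<phi> f
  proof (rule continuous_on_uniform_approx)
    fix \<epsilon> :: real assume \<epsilon>: "0 < \<epsilon>"
    define \<eta> where "\<eta> = \<epsilon> / (nrm f + 1)"
    have nf: "0 \<le> nrm f" by (rule nrm_nonneg[OF f])
    have \<eta>: "0 < \<eta>" using \<epsilon> nf by (simp add: \<eta>_def)
    obtain \<psi> :: "('x \<Rightarrow>\<^sub>C real) \<Rightarrow>\<^sub>L real" where
      \<psi>: "\<And>v. v \<in> space \<Longrightarrow> \<bar>\<phi> v - blinfun_apply \<psi> v\<bar> \<le> \<eta> * nrm v"
      by (rule dual_approx[OF \<phi> \<eta>]) (rule that)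
    have "\<bar>\<phi> (translate act f s) - blinfun_apply \<psi> (translate act f s)\<bar> \<le> \<epsilon>" for s
    proof -
      have "\<bar>\<phi> (translate act f s) - blinfun_apply \<psi> (translate act f s)\<bar> \<le> \<eta> * nrm (translate act f s)"
        using inv[OF f] by (intro \<psi>) blast
      also have "\<dots> \<le> \<eta> * (nrm f + 1)" using inv[OF f, of s] \<eta> by (intro mult_left_mono) auto
      also have "\<dots> = \<epsilon>" using nf by (simp add: \<eta>_def)
      finally show ?thesis .
    qed
    then show "\<exists>g. continuous_on UNIV g \<and> (\<forall>s. \<bar>\<phi> (translate act f s) - g s\<bar> \<le> \<epsilon>)"
      using weak[OF f, of \<psi>] by (intro exI[of _ "\<lambda>s. blinfun_apply \<psi> (translate act f s)"]) simp
  qed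
  have A_space: "a \<in> space" if "a \<in> A" for a using that AW W_subset_space by auto
  have "faithful_representation space nrm act (\<lambda>s. \<lambda>f\<in>space. translate act f s)
    (\<lambda>x. \<lambda>f\<in>space. apply_bcontfun f x)"
  proof (rule faithful_translation_representation[OF act])
    show "normed_on space nrm" by unfold_locales
    show "\<bar>apply_bcontfun f x\<bar> \<le> nrm f" if "f \<in> space" for f x
      using abs_apply_bcontfun_le[of f x] norm_le_nrm[OF that] by linarith
    show "translate act f s \<in> space" "nrm (translate act f s) \<le> nrm f" if "f \<in> space" for f s
      using inv[OF that] by auto
    show "\<exists>f\<in>space. apply_bcontfun f x \<noteq> apply_bcontfun f y" if "x \<noteq> y" for x y
    proof -
      have "\<exists>f\<in>WAP act. apply_bcontfun f x \<noteq> apply_bcontfun f y"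
        using wap that by (simp add: wap_def)
      then obtain f where f: "f \<in> WAP act" "apply_bcontfun f x \<noteq> apply_bcontfun f y" by (elim bexE)
      \<comment> \<open>The countable subfamily was chosen for the topology only. An open set
        defined by a wap function that distinguishes the points contains \<open>x\<close> and not
        \<open>y\<close>, and a member of \<open>A\<close> that isolates \<open>x\<close> inside
        this set must take different values at the two points.\<close>
      have "open {z. apply_bcontfun f z \<noteq> apply_bcontfun f y}"
        by (intro open_Collect_neq continuous_on_const continuous_on_apply_bcontfun)
      from gen[OF this, of x] f(2) have "\<exists>g\<in>A. \<exists>\<epsilon>>0. \<forall>z. \<bar>apply_bcontfun g z - apply_bcontfun g x\<bar> < \<epsilon> \<longrightarrow>
          apply_bcontfun f z \<noteq> apply_bcontfun f y"
        by simp
      then obtain g \<epsilon> where "g \<in> A" "0 < \<epsilon>"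
        "\<forall>z. \<bar>apply_bcontfun g z - apply_bcontfun g x\<bar> < \<epsilon> \<longrightarrow> apply_bcontfun f z \<noteq> apply_bcontfun f y"
        by (elim bexE exE conjE)
      from this(1,2) spec[OF this(3), of y] show ?thesis
        by (intro bexI[of _ g] A_space) auto
    qed
    show "\<exists>\<Phi> \<epsilon>. finite \<Phi> \<and> \<Phi> \<subseteq> space \<and> 0 < \<epsilon> \<and>
      (\<forall>y. (\<forall>f\<in>\<Phi>. \<bar>apply_bcontfun f y - apply_bcontfun f x\<bar> < \<epsilon>) \<longrightarrow> y \<in> U)"
      if U: "open U" "x \<in> U" for U x
    proof -
      from gen[OF U] obtain f \<epsilon> where "f \<in> A" "0 < \<epsilon>"
        "\<forall>y. \<bar>apply_bcontfun f y - apply_bcontfun f x\<bar> < \<epsilon> \<longrightarrow> y \<in> U" by (elim bexE exE conjE)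
      then show ?thesis by (intro exI[of _ "{f}"] exI[of _ \<epsilon>]) (simp add: A_space)
    qed
  qed (rule wot)
  with reflexive_space_bcontfun[OF interpolation_axioms W] show ?thesis
    unfolding eberlein_flow_def by (intro exI conjI)
qed

section \<open>Asplund spaces and sums\<close>

lemma (in Metric_space) separable_space_mtopology:
  "separable_space mtopology \<longleftrightarrow>
     (\<exists>D. countable D \<and> D \<subseteq> M \<and> (\<forall>x\<in>M. \<forall>\<epsilon>>0. \<exists>y\<in>D. d x y < \<epsilon>))"
proof -
  have "mtopology closure_of D = M \<longleftrightarrow> (\<forall>x\<in>M. \<forall>\<epsilon>>0. \<exists>y\<in>D. d x y < \<epsilon>)" if "D \<subseteq> M" for D
    using that by (fastforce simp: metric_closure_of in_mball)
  then show ?thesis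
    unfolding separable_space_def topspace_mtopology by (intro ex_cong1 conj_cong refl) simp
qed

section \<open>The metric of the dual and separable subspaces\<close>

context normed_on
begin

lemma dual_diff:
  assumes \<phi>: "\<phi> \<in> dual V N" and \<psi>: "\<psi> \<in> dual V N"
  shows "(\<lambda>v\<in>V. \<phi> v - \<psi> v) \<in> dual V N"
proof (rule dualI[where C = "dual_norm V N \<phi> + dual_norm V N \<psi>"])
  show "functional_on V (\<lambda>v. \<phi> v - \<psi> v)"
    using dual_functional[OF \<phi>] dual_functional[OF \<psi>]
    by (simp add: functional_on_def right_diff_distrib)
  show "\<bar>\<phi> v - \<psi> v\<bar> \<le> (dual_norm V N \<phi> + dual_norm V N \<psi>) * N v" if "v \<in> V" for v
    using dual_apply_le[OF \<phi> that] dual_apply_le[OF \<psi> that] by (simp add: distrib_right)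
qed

lemma dual_dist_apply_le:
  assumes "\<phi> \<in> dual V N" "\<psi> \<in> dual V N" "v \<in> V"
  shows "\<bar>\<phi> v - \<psi> v\<bar> \<le> dual_dist V N \<phi> \<psi> * N v"
  using dual_apply_le[OF dual_diff[OF assms(1,2)] assms(3)] assms by (simp add: dual_dist_def)

lemma dual_dist_le:
  assumes "\<phi> \<in> dual V N" "\<psi> \<in> dual V N" "0 \<le> C" "\<And>v. v \<in> V \<Longrightarrow> \<bar>\<phi> v - \<psi> v\<bar> \<le> C * N v"
  shows "dual_dist V N \<phi> \<psi> \<le> C"
  unfolding dual_dist_def using assms by (simp add: dual_norm_le)

lemma dual_dist_nonneg: "0 \<le> dual_dist V N \<phi> \<psi>"
  by (simp add: dual_dist_def dual_norm_nonneg dual_diff)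

lemma dual_metric: "Metric_space (dual V N) (dual_dist V N)"
proof
  show "0 \<le> dual_dist V N \<phi> \<psi>" for \<phi> \<psi> by (rule dual_dist_nonneg)
  have le: "dual_dist V N \<phi> \<psi> \<le> dual_dist V N \<psi> \<phi>" for \<phi> \<psi>
  proof (cases "\<phi> \<in> dual V N \<and> \<psi> \<in> dual V N")
    case True
    then show ?thesis
      using dual_dist_apply_le[of \<psi> \<phi>] by (intro dual_dist_le dual_dist_nonneg) (simp_all add: abs_minus_commute)
  qed (auto simp: dual_dist_def)
  show "dual_dist V N \<phi> \<psi> = dual_dist V N \<psi> \<phi>" for \<phi> \<psi>
    by (intro antisym le)
  show "dual_dist V N \<phi> \<psi> = 0 \<longleftrightarrow> \<phi> = \<psi>" if d: "\<phi> \<in> dual V N" "\<psi> \<in> dual V N" for \<phi> \<psi>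
  proof
    assume "dual_dist V N \<phi> \<psi> = 0"
    then have "\<phi> v = \<psi> v" if "v \<in> V" for v
      using dual_dist_apply_le[OF d that] by simp
    then show "\<phi> = \<psi>" using d by (intro extensionalityI[of _ V]) (auto simp: dual_def)
  next
    assume "\<phi> = \<psi>"
    then have "dual_dist V N \<phi> \<psi> \<le> 0" using d by (intro dual_dist_le) simp_all
    then show "dual_dist V N \<phi> \<psi> = 0" using dual_dist_nonneg[of \<phi> \<psi>] by linarith
  qed
  show "dual_dist V N \<phi> \<xi> \<le> dual_dist V N \<phi> \<psi> + dual_dist V N \<psi> \<xi>"
    if d: "\<phi> \<in> dual V N" "\<psi> \<in> dual V N" "\<xi> \<in> dual V N" for \<phi> \<psi> \<xi>
  proof (rule dual_dist_le[OF d(1,3)])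
    show "0 \<le> dual_dist V N \<phi> \<psi> + dual_dist V N \<psi> \<xi>" by (simp add: dual_dist_nonneg)
    fix v assume "v \<in> V"
    then show "\<bar>\<phi> v - \<xi> v\<bar> \<le> (dual_dist V N \<phi> \<psi> + dual_dist V N \<psi> \<xi>) * N v"
      using dual_dist_apply_le[OF d(1,2)] dual_dist_apply_le[OF d(2,3)]
      by (fastforce simp: distrib_right abs_le_iff)
  qed
qed

lemma separable_iff:
  "separable_space (Metric_space.mtopology V (norm_dist V N)) \<longleftrightarrow>
     (\<exists>D. countable D \<and> D \<subseteq> V \<and> (\<forall>v\<in>V. \<forall>\<epsilon>>0. \<exists>u\<in>D. N (v - u) < \<epsilon>))"
proof -
  have "(\<exists>y\<in>D. norm_dist V N v y < \<epsilon>) \<longleftrightarrow> (\<exists>u\<in>D. N (v - u) < \<epsilon>)"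
    if "D \<subseteq> V" "v \<in> V" for D v and \<epsilon> :: real
    using that by (auto simp: norm_dist_def)
  then show ?thesis
    unfolding Metric_space.separable_space_mtopology[OF metric] by (intro ex_cong1 conj_cong ball_cong) auto
qed

end

text \<open>The closure of the rational span of \<open>D\<close>. It makes the Asplund property,
  which concerns separable Banach subspaces, applicable to the coordinates of countably many
  lifts.\<close>

lemma (in banach_on) separable_banach_subspace:
  assumes D: "countable D" "D \<subseteq> V"
  obtains Y where "D \<subseteq> Y" "Y \<subseteq> V" "banach_on Y N"
    "separable_space (Metric_space.mtopology Y (norm_dist Y N))"
proof -
  define L where "L xs = sum_list (map (\<lambda>(r, v). of_rat r *\<^sub>R v) xs)" for xs :: "(rat \<times> 'v) list"
  define Q where "Q = L ` lists (UNIV \<times> D)"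
  have countQ: "countable Q"
    unfolding Q_def using D(1) by (intro countable_image countable_lists countable_SIGMA) auto
  have Q_add: "p + q \<in> Q" if "p \<in> Q" "q \<in> Q" for p q
  proof -
    from that obtain xs ys where "xs \<in> lists (UNIV \<times> D)" "p = L xs" "ys \<in> lists (UNIV \<times> D)" "q = L ys"
      unfolding Q_def by blast
    then show ?thesis unfolding Q_def by (intro image_eqI[of _ _ "xs @ ys"]) (auto simp: L_def)
  qed
  have Q_scale: "of_rat r *\<^sub>R q \<in> Q" if "q \<in> Q" for r q
  proof -
    from that obtain xs where xs: "xs \<in> lists (UNIV \<times> D)" "q = L xs" unfolding Q_def by blast
    have "of_rat r *\<^sub>R L xs = L (map (\<lambda>(r', v). (r * r', v)) xs)"
      by (induction xs) (auto simp: L_def scaleR_add_right of_rat_mult)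
    moreover have "map (\<lambda>(r', v). (r * r', v)) xs \<in> lists (UNIV \<times> D)" using xs(1) by auto
    ultimately show ?thesis unfolding Q_def xs(2) by (rule image_eqI)
  qed
  have Q_zero: "0 \<in> Q" unfolding Q_def by (intro image_eqI[of _ _ "[]"]) (auto simp: L_def)
  have DQ: "D \<subseteq> Q"
  proof
    fix v assume "v \<in> D"
    then show "v \<in> Q" unfolding Q_def by (intro image_eqI[of _ _ "[(1, v)]"]) (auto simp: L_def)
  qed
  have QV: "Q \<subseteq> V"
  proof -
    have "L xs \<in> V" if "xs \<in> lists (UNIV \<times> D)" for xs
      using that D(2) by (induction xs) (auto simp: L_def mem_simps)
    then show ?thesis by (auto simp: Q_def)
  qed
  define Y where "Y = {v \<in> V. \<forall>\<epsilon>>0. \<exists>q\<in>Q. N (v - q) < \<epsilon>}"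
  have YI: "v \<in> Y" if "v \<in> V" "\<And>\<epsilon>. 0 < \<epsilon> \<Longrightarrow> \<exists>q\<in>Q. N (v - q) < \<epsilon>" for v
    using that by (simp add: Y_def)
  have YD: "\<exists>q\<in>Q. N (v - q) < \<epsilon>" if "v \<in> Y" "0 < \<epsilon>" for v \<epsilon>
    using that by (simp add: Y_def)
  have YV: "Y \<subseteq> V" by (auto simp: Y_def)
  have QY: "Q \<subseteq> Y"
  proof
    fix q assume q: "q \<in> Q"
    then show "q \<in> Y" using QV by (intro YI bexI[OF _ q]) (auto simp: norm_zero)
  qed
  have Y_add: "u + v \<in> Y" if uv: "u \<in> Y" "v \<in> Y" for u v
  proof (rule YI)
    show "u + v \<in> V" using uv YV by (intro mem_simps) auto
    fix \<epsilon> :: real assume "0 < \<epsilon>"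
    then have "0 < \<epsilon> / 2" by simp
    obtain p q where pq: "p \<in> Q" "N (u - p) < \<epsilon> / 2" "q \<in> Q" "N (v - q) < \<epsilon> / 2"
      using YD[OF uv(1) \<open>0 < \<epsilon> / 2\<close>] YD[OF uv(2) \<open>0 < \<epsilon> / 2\<close>] by blast
    have "N ((u - p) + (v - q)) \<le> N (u - p) + N (v - q)"
      using uv pq YV QV by (intro norm_triangle mem_simps) auto
    then have "N ((u + v) - (p + q)) < \<epsilon>" using pq by (simp add: algebra_simps)
    then show "\<exists>q\<in>Q. N (u + v - q) < \<epsilon>" using Q_add[OF pq(1,3)] by blast
  qed
  have Y_scale: "c *\<^sub>R v \<in> Y" if v: "v \<in> Y" for c v
  proof (rule YI)
    have vV: "v \<in> V" using v YV by auto
    then show "c *\<^sub>R v \<in> V" by (rule mem_simps)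
    fix \<epsilon> :: real assume \<epsilon>: "0 < \<epsilon>"
    have Nv: "0 \<le> N v" by (rule norm_nonneg[OF vV])
    \<comment> \<open>The error of the rational coefficient is weighted by \<open>N v\<close>, that
      of \<open>q\<close> by the coefficient; each gets half of \<open>\<epsilon>\<close>, and the
      added 1 keeps the denominators positive.\<close>
    have "c < c + \<epsilon> / (2 * (N v + 1))" using \<epsilon> Nv by simp
    then obtain r where r: "c < of_rat r" "of_rat r < c + \<epsilon> / (2 * (N v + 1))"
      using of_rat_dense by blast
    define R where "R = \<bar>of_rat r :: real\<bar>"
    have R: "0 \<le> R" unfolding R_def by (rule abs_ge_zero)
    have "0 < \<epsilon> / (2 * (R + 1))" using \<epsilon> R by simp
    from YD[OF v this] obtain q where q: "q \<in> Q" "N (v - q) < \<epsilon> / (2 * (R + 1))" by blast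
    have qV: "q \<in> V" using q(1) QV by auto
    have "N ((c - of_rat r) *\<^sub>R v + of_rat r *\<^sub>R (v - q)) \<le>
        N ((c - of_rat r) *\<^sub>R v) + N (of_rat r *\<^sub>R (v - q))"
      using vV qV by (intro norm_triangle mem_simps)
    also have "\<dots> = \<bar>c - of_rat r\<bar> * N v + R * N (v - q)"
      unfolding R_def using vV qV by (simp only: norm_scaleR mem_simps)
    also have "\<bar>c - of_rat r\<bar> * N v \<le> \<epsilon> / (2 * (N v + 1)) * (N v + 1)"
      using r Nv by (intro mult_mono) auto
    also have "\<epsilon> / (2 * (N v + 1)) * (N v + 1) = \<epsilon> / 2" using Nv by (simp add: field_simps)
    also have "R * N (v - q) \<le> R * (\<epsilon> / (2 * (R + 1)))"
      using q R by (intro mult_left_mono) auto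
    also have "\<dots> < \<epsilon> / 2" using \<epsilon> R by (simp add: field_simps)
    finally have "N (c *\<^sub>R v - of_rat r *\<^sub>R q) < \<epsilon>"
      by (simp add: scaleR_left_diff_distrib scaleR_right_diff_distrib)
    then show "\<exists>q\<in>Q. N (c *\<^sub>R v - q) < \<epsilon>" using Q_scale[OF q(1)] by blast
  qed
  have "subspace Y" using Q_zero QY Y_add Y_scale by (auto simp: subspace_def)
  then interpret Y: normed_on Y N
    using YV norm_nonneg norm_eq_zero norm_scaleR norm_triangle by unfold_locales blast+
  have "banach_on Y N"
  proof (rule Y.banach_onI)
    fix u assume "\<And>k. u k \<in> Y \<and> N (u k) \<le> (1/2) ^ k"
    then have u: "u k \<in> Y" "N (u k) \<le> 1 * (1/2) ^ k" for k by auto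
    then have uV: "u k \<in> V" for k using YV by auto
    from series_converges[OF _ uV u(2)] obtain z where
      z: "z \<in> V" "\<And>K. N (z - (\<Sum>k<K. u k)) \<le> 2 * 1 * (1/2) ^ K" by auto
    have "z \<in> Y"
    proof (rule YI[OF z(1)])
      fix \<epsilon> :: real assume \<epsilon>: "0 < \<epsilon>"
      then obtain K where K: "(1/2) ^ K < \<epsilon> / 4" using real_arch_pow_inv[of "\<epsilon> / 4" "1/2"] by auto
      have "(\<Sum>k<K. u k) \<in> Y" using u by (intro Y.mem_simps)
      moreover have "0 < \<epsilon> / 2" using \<epsilon> by simp
      ultimately obtain q where q: "q \<in> Q" "N ((\<Sum>k<K. u k) - q) < \<epsilon> / 2" using YD by blast
      have "N (z - q) \<le> N (z - (\<Sum>k<K. u k)) + N ((\<Sum>k<K. u k) - q)"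
        using z q QV uV by (intro norm_diff_triangle mem_simps) auto
      also have "\<dots> < \<epsilon>" using z(2)[of K] K q(2) by linarith
      finally show "\<exists>q\<in>Q. N (z - q) < \<epsilon>" using q(1) by blast
    qed
    then show "\<exists>z\<in>Y. \<forall>K. N (z - (\<Sum>k<K. u k)) \<le> 2 * (1/2) ^ K" using z by (intro bexI[of _ z]) auto
  qed
  moreover have "separable_space (Metric_space.mtopology Y (norm_dist Y N))"
    unfolding Y.separable_iff using countQ QY YD by (intro exI[of _ Q]) blast
  moreover have "D \<subseteq> Y" using DQ QY by blast
  ultimately show thesis using that YV by blast
qed

lemma normed_on_if_banach_on: "banach_on V N \<Longrightarrow> normed_on V N"
proof -
  assume "banach_on V N"
  then interpret banach_on V N .
  show ?thesis by unfold_locales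
qed

section \<open>Quotients of c0-sums\<close>

lemma LIMSEQ_zero_squeeze:
  fixes f g :: "nat \<Rightarrow> real"
  assumes "\<And>n. 0 \<le> f n" "\<And>n. f n \<le> g n" "g \<longlonglongrightarrow> 0"
  shows "f \<longlonglongrightarrow> 0"
  using assms by (intro tendsto_sandwich[of "\<lambda>_. 0" f sequentially g 0]) simp_all

text \<open>A quotient of the \<open>c\<^sub>0\<close>-sum of the spaces \<open>Y n\<close>, realized as a subspace of \<open>'e\<close>.\<close>

locale c0_sum =
  fixes Y :: "nat \<Rightarrow> 'v::real_vector set" and M :: "nat \<Rightarrow> 'v \<Rightarrow> real" and T :: "nat \<Rightarrow> 'v \<Rightarrow> 'e::banach"
  assumes banach: "banach_on (Y n) (M n)"
    and T_add: "u \<in> Y n \<Longrightarrow> v \<in> Y n \<Longrightarrow> T n (u + v) = T n u + T n v"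
    and T_scaleR: "v \<in> Y n \<Longrightarrow> T n (c *\<^sub>R v) = c *\<^sub>R T n v"
    and T_le: "v \<in> Y n \<Longrightarrow> norm (T n v) \<le> M n v"
begin

interpretation Y: banach_on "Y n" "M n" for n by (rule banach)

lemma T_zero: "T n 0 = 0"
  using T_scaleR[OF Y.mem_simps(1), of n 0] by simp

definition csum :: "(nat \<Rightarrow> 'v) set" where
  "csum = {y. (\<forall>n. y n \<in> Y n) \<and> (\<lambda>n. M n (y n)) \<longlonglongrightarrow> 0}"

text \<open>Balls stand in for the norm of the sum: the supremum over the coordinates is never
  formed.\<close>

definition csum_ball :: "real \<Rightarrow> (nat \<Rightarrow> 'v) set" where
  "csum_ball C = {y \<in> csum. \<forall>n. M n (y n) \<le> C}"

text \<open>The weights add up to 1, so \<open>q\<close> is defined and contractive on bounded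
  families; as they are positive, every coordinate remains visible in \<open>'e\<close> up to a
  factor.\<close>

definition q :: "(nat \<Rightarrow> 'v) \<Rightarrow> 'e" where
  "q y = (\<Sum>n. (1/2) ^ Suc n *\<^sub>R T n (y n))"

definition space :: "'e set" where
  "space = q ` csum"

text \<open>The quotient norm of the sum modulo the kernel of \<open>q\<close>.\<close>

definition nrm :: "'e \<Rightarrow> real" where
  "nrm u = Inf {C. u \<in> q ` csum_ball C}"

lemma csum_mem: "y \<in> csum \<Longrightarrow> y n \<in> Y n"
  by (simp add: csum_def)

lemma csum_ball_nonneg: "y \<in> csum_ball C \<Longrightarrow> 0 \<le> C"
  using Y.norm_nonneg[of "y 0" 0] by (auto simp: csum_ball_def csum_def intro: order_trans)

lemma csum_ball_csum: "y \<in> csum_ball C \<Longrightarrow> y \<in> csum"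
  by (simp add: csum_ball_def)

lemma csum_ball_le: "y \<in> csum_ball C \<Longrightarrow> M n (y n) \<le> C"
  by (simp add: csum_ball_def)

lemma csum_bounded:
  assumes "y \<in> csum"
  obtains C where "y \<in> csum_ball C"
proof -
  have "(\<lambda>n. M n (y n)) \<longlonglongrightarrow> 0" using assms by (simp add: csum_def)
  then have "bounded (range (\<lambda>n. M n (y n)))" by (rule convergent_imp_bounded)
  then obtain C where "\<And>n. \<bar>M n (y n)\<bar> \<le> C" by (auto simp: bounded_iff)
  then have "M n (y n) \<le> C" for n by (simp add: abs_le_iff)
  with assms show thesis by (intro that[of C]) (simp add: csum_ball_def)
qed

lemma q_summable_norm_le:
  assumes "y \<in> csum_ball C"
  shows "summable (\<lambda>n. (1/2) ^ Suc n *\<^sub>R T n (y n))" "norm (q y) \<le> C"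
proof -
  have C: "(\<lambda>n. (1/2) ^ Suc n * C) sums (1 * C)" by (intro sums_mult2 power_half_series)
  have le: "norm ((1/2) ^ Suc n *\<^sub>R T n (y n)) \<le> (1/2) ^ Suc n * C" for n
    using order_trans[OF T_le[OF csum_mem[OF csum_ball_csum[OF assms]], of n] csum_ball_le[OF assms, of n]]
    by simp
  show "summable (\<lambda>n. (1/2) ^ Suc n *\<^sub>R T n (y n))"
    by (rule summable_comparison_test'[OF sums_summable[OF C] le])
  have "norm (q y) \<le> (\<Sum>n. (1/2) ^ Suc n * C)"
    unfolding q_def by (rule norm_suminf_le[OF le sums_summable[OF C]])
  then show "norm (q y) \<le> C" unfolding sums_unique[OF C, symmetric] by simp
qed

lemma q_summable: "y \<in> csum \<Longrightarrow> summable (\<lambda>n. (1/2) ^ Suc n *\<^sub>R T n (y n))"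
  by (erule csum_bounded) (rule q_summable_norm_le)

lemma csum_ball_add:
  assumes y: "y \<in> csum_ball C" and z: "z \<in> csum_ball D"
  shows "(\<lambda>n. y n + z n) \<in> csum_ball (C + D)"
proof -
  note m = csum_mem[OF csum_ball_csum[OF y]] csum_mem[OF csum_ball_csum[OF z]]
  have le: "M n (y n + z n) \<le> M n (y n) + M n (z n)" for n by (rule Y.norm_triangle[OF m])
  have "(\<lambda>n. M n (y n) + M n (z n)) \<longlonglongrightarrow> 0"
    using y z by (intro tendsto_add_zero) (auto simp: csum_ball_def csum_def)
  from LIMSEQ_zero_squeeze[OF Y.norm_nonneg[OF Y.mem_simps(2)[OF m]] le this]
  have "(\<lambda>n. M n (y n + z n)) \<longlonglongrightarrow> 0" .
  moreover have "M n (y n + z n) \<le> C + D" for n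
    using le[of n] csum_ball_le[OF y, of n] csum_ball_le[OF z, of n] by linarith
  ultimately show ?thesis using Y.mem_simps(2)[OF m] by (simp add: csum_ball_def csum_def)
qed

lemma csum_ball_scaleR:
  assumes y: "y \<in> csum_ball C"
  shows "(\<lambda>n. c *\<^sub>R y n) \<in> csum_ball (\<bar>c\<bar> * C)"
proof -
  note m = csum_mem[OF csum_ball_csum[OF y]]
  have "(\<lambda>n. \<bar>c\<bar> * M n (y n)) \<longlonglongrightarrow> 0"
    using y by (intro tendsto_mult_right_zero) (simp add: csum_ball_def csum_def)
  then show ?thesis
    using csum_ball_le[OF y] m by (simp add: csum_ball_def csum_def Y.norm_scaleR Y.mem_simps mult_left_mono)
qed

lemma zero_csum_ball: "0 \<le> C \<Longrightarrow> (\<lambda>n. 0) \<in> csum_ball C"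
  by (simp add: csum_ball_def csum_def Y.mem_simps Y.norm_zero)

lemma csum_add: "y \<in> csum \<Longrightarrow> z \<in> csum \<Longrightarrow> (\<lambda>n. y n + z n) \<in> csum"
  by (erule csum_bounded)+ (rule csum_ball_csum[OF csum_ball_add])

lemma csum_scaleR: "y \<in> csum \<Longrightarrow> (\<lambda>n. c *\<^sub>R y n) \<in> csum"
  by (erule csum_bounded) (rule csum_ball_csum[OF csum_ball_scaleR])

lemma q_add:
  assumes y: "y \<in> csum" and z: "z \<in> csum"
  shows "q (\<lambda>n. y n + z n) = q y + q z"
proof -
  have "q y + q z = (\<Sum>n. (1/2) ^ Suc n *\<^sub>R T n (y n) + (1/2) ^ Suc n *\<^sub>R T n (z n))"
    unfolding q_def by (rule suminf_add[OF q_summable[OF y] q_summable[OF z]])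
  also have "\<dots> = q (\<lambda>n. y n + z n)"
    unfolding q_def by (simp only: T_add[OF csum_mem[OF y] csum_mem[OF z]] scaleR_add_right)
  finally show ?thesis by (rule sym)
qed

lemma q_scaleR:
  assumes y: "y \<in> csum"
  shows "q (\<lambda>n. c *\<^sub>R y n) = c *\<^sub>R q y"
proof -
  have "c *\<^sub>R q y = (\<Sum>n. c *\<^sub>R (1/2) ^ Suc n *\<^sub>R T n (y n))"
    unfolding q_def by (rule suminf_scaleR_right[OF q_summable[OF y]])
  also have "\<dots> = q (\<lambda>n. c *\<^sub>R y n)"
    unfolding q_def T_scaleR[OF csum_mem[OF y]] by (simp only: scaleR_left_commute)
  finally show ?thesis by (rule sym)
qed

lemma q_zero: "q (\<lambda>n. 0) = 0"
  by (simp add: q_def T_zero)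

lemma nrm_bdd_below: "bdd_below {C. u \<in> q ` csum_ball C}"
  using csum_ball_nonneg by (intro bdd_belowI[of _ 0]) auto

lemma nrm_le: "y \<in> csum_ball C \<Longrightarrow> nrm (q y) \<le> C"
  unfolding nrm_def by (intro cInf_lower nrm_bdd_below) auto

lemma nrm_nonempty:
  assumes "u \<in> space"
  shows "{C. u \<in> q ` csum_ball C} \<noteq> {}"
proof -
  obtain y where y: "y \<in> csum" "u = q y" using assms by (auto simp: space_def)
  then obtain C where "y \<in> csum_ball C" by (elim csum_bounded)
  with y show ?thesis by auto
qed

lemma nrm_greatest:
  assumes "u \<in> space" "\<And>C y. y \<in> csum_ball C \<Longrightarrow> u = q y \<Longrightarrow> c \<le> C"
  shows "c \<le> nrm u"
  unfolding nrm_def using assms(2) by (intro cInf_greatest nrm_nonempty assms(1)) auto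

lemma nrm_less:
  assumes u: "u \<in> space" and less: "nrm u < C"
  obtains y where "y \<in> csum_ball C" "q y = u"
proof -
  obtain D where "u \<in> q ` csum_ball D" "D < C"
    using less cInf_less_iff[OF nrm_nonempty[OF u] nrm_bdd_below] by (auto simp: nrm_def)
  then obtain y where y: "y \<in> csum_ball D" "q y = u" by auto
  have "M n (y n) \<le> C" for n using csum_ball_le[OF y(1), of n] \<open>D < C\<close> by linarith
  then have "y \<in> csum_ball C" using y(1) by (simp add: csum_ball_def)
  then show thesis using y(2) by (rule that)
qed

lemma q_mem: "y \<in> csum \<Longrightarrow> q y \<in> space"
  by (simp add: space_def)

lemma norm_le_nrm: "u \<in> space \<Longrightarrow> norm u \<le> nrm u"
  by (rule nrm_greatest) (auto intro: q_summable_norm_le)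

lemma subspace_space: "subspace space"
  unfolding subspace_def
proof (intro conjI ballI allI)
  show "0 \<in> space"
    using q_mem[OF csum_ball_csum[OF zero_csum_ball[of 0]]] by (simp add: q_zero)
  show "x + y \<in> space" if "x \<in> space" "y \<in> space" for x y
    using that by (auto simp: space_def q_add[symmetric] intro!: imageI csum_add)
  show "c *\<^sub>R x \<in> space" if "x \<in> space" for c x
    using that by (auto simp: space_def q_scaleR[symmetric] intro!: imageI csum_scaleR)
qed

lemma nrm_triangle:
  assumes u: "u \<in> space" and v: "v \<in> space"
  shows "nrm (u + v) \<le> nrm u + nrm v"
proof (rule field_le_epsilon)
  fix e :: real assume "0 < e"
  obtain y where y: "y \<in> csum_ball (nrm u + e / 2)" "q y = u"
    by (rule nrm_less[OF u, of "nrm u + e / 2"]) (use \<open>0 < e\<close> in simp)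
  obtain z where z: "z \<in> csum_ball (nrm v + e / 2)" "q z = v"
    by (rule nrm_less[OF v, of "nrm v + e / 2"]) (use \<open>0 < e\<close> in simp)
  have "nrm (q (\<lambda>n. y n + z n)) \<le> (nrm u + e / 2) + (nrm v + e / 2)"
    by (intro nrm_le csum_ball_add y z)
  then show "nrm (u + v) \<le> nrm u + nrm v + e"
    using y z by (simp add: q_add csum_ball_csum)
qed

lemma nrm_zero: "nrm 0 = 0"
proof (rule antisym)
  show "nrm 0 \<le> 0" using nrm_le[OF zero_csum_ball[of 0]] by (simp add: q_zero)
  show "0 \<le> nrm 0"
    using norm_le_nrm[OF subspace_0[OF subspace_space]] by simp
qed

lemma nrm_scaleR_le:
  assumes u: "u \<in> space"
  shows "nrm (c *\<^sub>R u) \<le> \<bar>c\<bar> * nrm u"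
proof (cases "c = 0")
  case False
  have "nrm (c *\<^sub>R u) / \<bar>c\<bar> \<le> nrm u"
  proof (rule nrm_greatest[OF u])
    fix C y assume y: "y \<in> csum_ball C" "u = q y"
    have "nrm (q (\<lambda>n. c *\<^sub>R y n)) \<le> \<bar>c\<bar> * C" by (intro nrm_le csum_ball_scaleR y)
    then show "nrm (c *\<^sub>R u) / \<bar>c\<bar> \<le> C"
      using False y by (simp add: q_scaleR csum_ball_csum field_simps)
  qed
  then show ?thesis using False by (simp add: field_simps)
qed (simp add: nrm_zero)

sublocale normed_on space nrm
proof
  show "subspace space" by (rule subspace_space)
  show nonneg: "0 \<le> nrm u" if "u \<in> space" for u
    using norm_le_nrm[OF that] norm_ge_zero[of u] by linarith
  show "nrm u = 0 \<longleftrightarrow> u = 0" if "u \<in> space" for u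
  proof
    show "u = 0" if "nrm u = 0" using norm_le_nrm[OF \<open>u \<in> space\<close>] that by simp
  qed (simp add: nrm_zero)
  show "nrm (c *\<^sub>R u) = \<bar>c\<bar> * nrm u" if u: "u \<in> space" for c u
  proof (rule antisym[OF nrm_scaleR_le[OF u]])
    show "\<bar>c\<bar> * nrm u \<le> nrm (c *\<^sub>R u)"
    proof (cases "c = 0")
      case False
      then have "nrm u \<le> \<bar>1 / c\<bar> * nrm (c *\<^sub>R u)"
        using nrm_scaleR_le[OF subspace_scale[OF subspace_space u], of "1 / c" c] by simp
      with False show ?thesis by (simp add: field_simps)
    qed (simp add: nrm_zero)
  qed
qed (rule nrm_triangle)

lemma csum_sum:
  fixes K :: nat
  assumes "\<And>k. y k \<in> csum"
  shows "(\<lambda>n. \<Sum>k<K. y k n) \<in> csum \<and> q (\<lambda>n. \<Sum>k<K. y k n) = (\<Sum>k<K. q (y k))"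
proof (induction K)
  case 0
  show ?case using csum_ball_csum[OF zero_csum_ball[of 0]] by (simp add: q_zero)
next
  case (Suc K)
  then show ?case using assms by (simp add: csum_add q_add)
qed

text \<open>The terms are lifted to the sum and the lifts are added in each coordinate. The rate of
  convergence is the same in all coordinates, so that the result is again a null sequence.\<close>

lemma banach_space: "banach_on space nrm"
proof (rule banach_onI)
  fix u assume u: "\<And>k. u k \<in> space \<and> nrm (u k) \<le> (1/2) ^ k"
  have "\<forall>k. \<exists>y. y \<in> csum_ball (2 * (1/2) ^ k) \<and> q y = u k"
  proof
    fix k
    \<comment> \<open>The quotient norm need not be attained by a lift, hence the factor 2.\<close>
    have "(1/2 :: real) ^ k < 2 * (1/2) ^ k" by simp
    with u[of k] have "nrm (u k) < 2 * (1/2) ^ k" by linarith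
    with u[of k] obtain y where "y \<in> csum_ball (2 * (1/2) ^ k)" "q y = u k"
      by (elim conjE) (rule nrm_less)
    then show "\<exists>y. y \<in> csum_ball (2 * (1/2) ^ k) \<and> q y = u k" by (intro exI[of _ y] conjI)
  qed
  from choice[OF this] obtain y where "\<forall>k. y k \<in> csum_ball (2 * (1/2) ^ k) \<and> q (y k) = u k" ..
  then have y: "y k \<in> csum_ball (2 * (1/2) ^ k)" "q (y k) = u k" for k by simp_all
  note yc = csum_ball_csum[OF y(1)]
  have "\<forall>n. \<exists>z. z \<in> Y n \<and> (\<forall>K. M n (z - (\<Sum>k<K. y k n)) \<le> 2 * 2 * (1/2) ^ K)"
  proof
    fix n
    from Y.series_converges[of 2 "\<lambda>k. y k n" n] csum_mem[OF yc] csum_ball_le[OF y(1)]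
    show "\<exists>z. z \<in> Y n \<and> (\<forall>K. M n (z - (\<Sum>k<K. y k n)) \<le> 2 * 2 * (1/2) ^ K)" by auto
  qed
  from choice[OF this] obtain z where
    "\<forall>n. z n \<in> Y n \<and> (\<forall>K. M n (z n - (\<Sum>k<K. y k n)) \<le> 2 * 2 * (1/2) ^ K)" ..
  then have z: "z n \<in> Y n" "M n (z n - (\<Sum>k<K. y k n)) \<le> 4 * (1/2) ^ K" for n K by auto
  define s where "s K n = (\<Sum>k<K. y k n)" for K n
  have s: "s K \<in> csum" "q (s K) = (\<Sum>k<K. u k)" for K
    using csum_sum[of y K, OF yc] by (simp_all add: s_def[abs_def] y(2))
  have zs: "M n (z n - s K n) \<le> 4 * (1/2) ^ K" for n K using z(2) by (simp add: s_def)
  have "(\<lambda>n. M n (z n)) \<longlonglongrightarrow> 0"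
  proof (rule LIMSEQ_I)
    fix e :: real assume "0 < e"
    then obtain K where K: "(1/2) ^ K < e / 8" using real_arch_pow_inv[of "e / 8" "1/2"] by auto
    have "(\<lambda>n. M n (s K n)) \<longlonglongrightarrow> 0" using s(1)[of K] by (simp add: csum_def)
    from order_tendstoD(2)[OF this half_gt_zero[OF \<open>0 < e\<close>]]
    have "\<forall>\<^sub>F n in sequentially. M n (s K n) < e / 2" .
    then obtain n0 where n0: "\<And>n. n0 \<le> n \<Longrightarrow> M n (s K n) < e / 2" by (auto simp: eventually_sequentially)
    have "norm (M n (z n) - 0) < e" if "n0 \<le> n" for n
    proof -
      have "M n (z n) \<le> M n (z n - s K n) + M n (s K n)"
        using Y.norm_triangle[of "z n - s K n" n "s K n"] z(1)[of n] csum_mem[OF s(1)]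
        by (simp add: Y.mem_simps)
      then have "M n (z n) < e" using zs[of n K] n0[OF that] K by linarith
      then show ?thesis using Y.norm_nonneg[OF z(1), of n] by simp
    qed
    then show "\<exists>no. \<forall>n\<ge>no. norm (M n (z n) - 0) < e" by blast
  qed
  then have zc: "z \<in> csum" using z(1) by (simp add: csum_def)
  have "nrm (q z - (\<Sum>k<K. u k)) \<le> 4 * (1/2) ^ K" for K
  proof -
    have ms: "(\<lambda>n. (-1) *\<^sub>R s K n) \<in> csum" by (rule csum_scaleR[OF s(1)])
    have d: "(\<lambda>n. z n + (-1) *\<^sub>R s K n) \<in> csum" by (rule csum_add[OF zc ms])
    then have "(\<lambda>n. z n + (-1) *\<^sub>R s K n) \<in> csum_ball (4 * (1/2) ^ K)"
      using zs by (simp add: csum_ball_def)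
    from nrm_le[OF this] show ?thesis
      by (simp only: q_add[OF zc ms] q_scaleR[OF s(1)] s(2)) simp
  qed
  then show "\<exists>z\<in>space. \<forall>K. nrm (z - (\<Sum>k<K. u k)) \<le> 4 * (1/2) ^ K"
    using q_mem[OF zc] by blast
qed

definition coord :: "nat \<Rightarrow> 'v \<Rightarrow> 'e" where
  "coord n v = (1/2) ^ Suc n *\<^sub>R T n v"

lemma single_csum_ball:
  assumes v: "v \<in> Y n"
  shows "(\<lambda>i. if i = n then v else 0) \<in> csum_ball (M n v)"
proof -
  have "\<forall>\<^sub>F i in sequentially. 0 = M i (if i = n then v else 0)"
    using eventually_gt_at_top[of n] by eventually_elim (simp add: Y.norm_zero)
  then have "(\<lambda>i. M i (if i = n then v else 0)) \<longlonglongrightarrow> 0"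
    by (rule tendsto_eventually[OF eventually_mono]) simp
  then show ?thesis using v Y.norm_nonneg[OF v]
    by (simp add: csum_ball_def csum_def Y.mem_simps Y.norm_zero)
qed

lemma q_single: "q (\<lambda>i. if i = n then v else 0) = coord n v"
proof -
  have "(\<lambda>i. (1/2) ^ Suc i *\<^sub>R T i (if i = n then v else 0)) sums ((1/2) ^ Suc n *\<^sub>R T n v)"
    using sums_single[of n "\<lambda>i. (1/2) ^ Suc i *\<^sub>R T i v"] by (rule sums_cong[THEN iffD1, rotated]) (simp add: T_zero)
  then show ?thesis unfolding q_def coord_def by (rule sums_unique[symmetric])
qed

lemma coord_mem: "v \<in> Y n \<Longrightarrow> coord n v \<in> space"
  using q_mem[OF csum_ball_csum[OF single_csum_ball]] by (simp add: q_single)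

lemma nrm_coord_le: "v \<in> Y n \<Longrightarrow> nrm (coord n v) \<le> M n v"
  using nrm_le[OF single_csum_ball] by (simp add: q_single)

lemma coord_add: "u \<in> Y n \<Longrightarrow> v \<in> Y n \<Longrightarrow> coord n (u + v) = coord n u + coord n v"
  by (simp add: coord_def T_add scaleR_add_right)

lemma coord_scaleR: "v \<in> Y n \<Longrightarrow> coord n (c *\<^sub>R v) = c *\<^sub>R coord n v"
  by (simp add: coord_def T_scaleR)

lemma csum_ball_modify:
  assumes y: "y \<in> csum" and D: "0 \<le> D" "\<And>n. P n \<Longrightarrow> M n (y n) \<le> D"
  shows "(\<lambda>n. if P n then y n else 0) \<in> csum_ball D"
proof -
  have lim: "(\<lambda>n. M n (y n)) \<longlonglongrightarrow> 0" using y by (simp add: csum_def)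
  have "(\<lambda>n. M n (if P n then y n else 0)) \<longlonglongrightarrow> 0"
    by (rule LIMSEQ_zero_squeeze[OF _ _ lim])
      (simp_all add: Y.norm_zero Y.norm_nonneg[OF csum_mem[OF y]])
  then show ?thesis using D csum_mem[OF y]
    by (simp add: csum_ball_def csum_def Y.mem_simps Y.norm_zero)
qed

lemma csum_modify:
  assumes y: "y \<in> csum"
  shows "(\<lambda>n. if P n then y n else 0) \<in> csum"
proof -
  obtain C where C: "y \<in> csum_ball C" using y by (elim csum_bounded)
  show ?thesis
    by (rule csum_ball_csum[OF csum_ball_modify[OF y csum_ball_nonneg[OF C] csum_ball_le[OF C]]])
qed

lemma q_split:
  assumes y: "y \<in> csum"
  shows "q y = (\<Sum>n<m. coord n (y n)) + q (\<lambda>n. if m \<le> n then y n else 0)"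
proof (induction m)
  case (Suc m)
  have "(\<lambda>n. if m \<le> n then y n else 0) =
      (\<lambda>n. (if n = m then y m else 0) + (if Suc m \<le> n then y n else 0))"
  proof
    fix n
    show "(if m \<le> n then y n else 0) = (if n = m then y m else 0) + (if Suc m \<le> n then y n else 0)"
      by (cases n m rule: linorder_cases) auto
  qed
  then have "q (\<lambda>n. if m \<le> n then y n else 0) = coord m (y m) + q (\<lambda>n. if Suc m \<le> n then y n else 0)"
    by (simp only: q_add[OF csum_ball_csum[OF single_csum_ball[OF csum_mem[OF y]]] csum_modify[OF y]] q_single)
  with Suc show ?case by simp
qed simp

text \<open>Otherwise there are finitely supported elements with disjoint supports in the unit ball of
  the \<open>c\<^sub>0\<close>-sum on which \<open>\<Phi>\<close> is at least \<open>\<epsilon> / 2\<close>, and \<open>\<Phi>\<close> is unbounded on their sums.\<close>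

lemma functional_tail_unit:
  assumes \<Phi>: "functional_on space \<Phi>" and bound: "\<And>u. u \<in> space \<Longrightarrow> \<bar>\<Phi> u\<bar> \<le> B * nrm u"
    and \<epsilon>: "0 < \<epsilon>"
  shows "\<exists>m. \<forall>y\<in>csum_ball 1. (\<forall>n<m. y n = 0) \<longrightarrow> \<Phi> (q y) \<le> \<epsilon>"
proof (rule ccontr)
  assume neg: "\<not> ?thesis"
  have ex: "\<exists>y\<in>csum_ball 1. (\<forall>n<m. y n = 0) \<and> \<epsilon> < \<Phi> (q y)" for m
    using neg by (auto simp: not_le)
  have bound': "\<bar>\<Phi> (q y)\<bar> \<le> \<bar>B\<bar> * C" if y: "y \<in> csum_ball C" for y C
  proof -
    have "\<bar>\<Phi> (q y)\<bar> \<le> B * nrm (q y)" by (intro bound q_mem csum_ball_csum[OF y])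
    also have "\<dots> \<le> \<bar>B\<bar> * C"
      using nrm_le[OF y] norm_nonneg[OF q_mem[OF csum_ball_csum[OF y]]] by (intro mult_mono) auto
    finally show ?thesis .
  qed
  \<comment> \<open>Removing the coordinates of norm below \<open>\<delta>\<close> beyond some index
    changes \<open>\<Phi>\<close> by at most \<open>\<epsilon> / 2\<close>, so the finitely
    supported rest \<open>h\<close> keeps a value of at least \<open>\<epsilon> / 2\<close>.\<close>
  define \<delta> where "\<delta> = \<epsilon> / (2 * (\<bar>B\<bar> + 1))"
  have \<delta>: "0 < \<delta>" "\<bar>B\<bar> * \<delta> \<le> \<epsilon> / 2" using \<epsilon> by (simp_all add: \<delta>_def field_simps)
  \<comment> \<open>The beginning \<open>m\<close> of the support is left arbitrary, so that the
    induction hypothesis provides an element beyond the support of \<open>h\<close>.\<close>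
  have P: "\<exists>y\<in>csum_ball 1. (\<forall>n<m. y n = 0) \<and> real k * (\<epsilon> / 2) \<le> \<Phi> (q y)" for k m
  proof (induction k arbitrary: m)
    case 0
    have "\<Phi> 0 = 0" using functional_onD(2)[OF \<Phi> mem_simps(1), of 0] by simp
    then show ?case by (intro bexI[of _ "\<lambda>n. 0"] zero_csum_ball) (simp_all add: q_zero)
  next
    case (Suc k)
    from ex obtain y where y: "y \<in> csum_ball 1" "\<forall>n<m. y n = 0" "\<epsilon> < \<Phi> (q y)" by blast
    note yc = csum_ball_csum[OF y(1)]
    have "\<forall>\<^sub>F n in sequentially. M n (y n) < \<delta>"
      using yc \<delta>(1) by (intro order_tendstoD(2)[of _ 0]) (simp_all add: csum_def)
    then obtain m0 where m0: "\<And>n. m0 \<le> n \<Longrightarrow> M n (y n) < \<delta>" by (auto simp: eventually_sequentially)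
    define m' where "m' = max m m0"
    define t where "t n = (if m' \<le> n then y n else 0)" for n
    define h where "h n = (if n < m' then y n else 0)" for n
    have t: "t \<in> csum_ball \<delta>"
      unfolding t_def[abs_def] using m0 \<delta>(1) by (intro csum_ball_modify yc) (auto simp: m'_def less_imp_le)
    have h: "h \<in> csum_ball 1"
      unfolding h_def[abs_def] using csum_ball_le[OF y(1)] by (intro csum_ball_modify yc) auto
    have "y = (\<lambda>n. h n + t n)" by (auto simp: h_def t_def)
    then have "q y = q h + q t" using q_add[OF csum_ball_csum[OF h] csum_ball_csum[OF t]] by simp
    then have "\<Phi> (q y) = \<Phi> (q h) + \<Phi> (q t)"
      using functional_onD(1)[OF \<Phi> q_mem[OF csum_ball_csum[OF h]] q_mem[OF csum_ball_csum[OF t]]] by simp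
    then have ht: "\<epsilon> / 2 \<le> \<Phi> (q h)" using y(3) bound'[OF t] \<delta>(2) by linarith
    from Suc.IH[of m'] obtain z where z: "z \<in> csum_ball 1" "\<forall>n<m'. z n = 0"
      "real k * (\<epsilon> / 2) \<le> \<Phi> (q z)" by blast
    have "(\<lambda>n. h n + z n) \<in> csum" by (rule csum_add[OF csum_ball_csum[OF h] csum_ball_csum[OF z(1)]])
    \<comment> \<open>With disjoint supports each coordinate comes from one summand alone: the
      values of \<open>\<Phi>\<close> add up while the supremum stays at most 1.\<close>
    moreover have "M n (h n + z n) \<le> 1" for n
      using csum_ball_le[OF h, of n] csum_ball_le[OF z(1), of n] z(2) by (cases "n < m'") (simp_all add: h_def)
    ultimately have "(\<lambda>n. h n + z n) \<in> csum_ball 1" by (simp add: csum_ball_def)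
    moreover have "\<forall>n<m. h n + z n = 0" using y(2) z(2) by (simp add: h_def m'_def)
    moreover have "real (Suc k) * (\<epsilon> / 2) \<le> \<Phi> (q (\<lambda>n. h n + z n))"
      using ht z(3) q_add[OF csum_ball_csum[OF h] csum_ball_csum[OF z(1)]]
        functional_onD(1)[OF \<Phi> q_mem[OF csum_ball_csum[OF h]] q_mem[OF csum_ball_csum[OF z(1)]]]
      by (simp add: distrib_right)
    ultimately show ?case by (intro bexI[of _ "\<lambda>n. h n + z n"] conjI)
  qed
  obtain k :: nat where k: "\<bar>B\<bar> / (\<epsilon> / 2) < real k" using reals_Archimedean2 by blast
  from P[of 0 k] obtain y where "y \<in> csum_ball 1" "real k * (\<epsilon> / 2) \<le> \<Phi> (q y)" by blast
  with bound'[of y 1] have "real k * (\<epsilon> / 2) \<le> \<bar>B\<bar>" by simp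
  with k \<epsilon> show False by (simp add: field_simps)
qed

text \<open>One \<open>m\<close> serves all elements, with an error proportional to the radius; this
  uniformity is used over all lifts of a dense set in \<open>functional_approx\<close> and along a
  whole orbit in \<open>RN_approximable_imp_RN_flow\<close>.\<close>

lemma functional_tail:
  assumes \<Phi>: "functional_on space \<Phi>" and bound: "\<And>u. u \<in> space \<Longrightarrow> \<bar>\<Phi> u\<bar> \<le> B * nrm u"
    and \<epsilon>: "0 < \<epsilon>"
  obtains m where "\<And>y C. y \<in> csum_ball C \<Longrightarrow> \<bar>\<Phi> (q (\<lambda>n. if m \<le> n then y n else 0))\<bar> \<le> \<epsilon> * C"
proof -
  obtain m where m: "\<And>y. y \<in> csum_ball 1 \<Longrightarrow> (\<forall>n<m. y n = 0) \<Longrightarrow> \<Phi> (q y) \<le> \<epsilon>"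
    using functional_tail_unit[OF assms] by blast
  show thesis
  proof (rule that[of m])
    fix y C assume y: "y \<in> csum_ball C"
    define t where "t n = (if m \<le> n then y n else 0)" for n
    have t: "t \<in> csum_ball C"
      unfolding t_def[abs_def] by (intro csum_ball_modify csum_ball_csum[OF y] csum_ball_nonneg[OF y] csum_ball_le[OF y])
    note qt = q_mem[OF csum_ball_csum[OF t]]
    have "\<bar>\<Phi> (q t)\<bar> \<le> \<epsilon> * C"
    proof (cases "C = 0")
      case True
      have "nrm (q t) \<le> 0" using nrm_le[OF t] True by simp
      then have "nrm (q t) = 0" using norm_nonneg[OF qt] by linarith
      then show ?thesis using bound[OF qt] True by simp
    next
      case False
      then have C: "0 < C" using csum_ball_nonneg[OF y] by linarith
      have "c * \<Phi> (q t) \<le> \<epsilon>" if "\<bar>c\<bar> * C = 1" for c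
      proof -
        have "(\<lambda>n. c *\<^sub>R t n) \<in> csum_ball 1" using csum_ball_scaleR[OF t, of c] that by simp
        then have "\<Phi> (q (\<lambda>n. c *\<^sub>R t n)) \<le> \<epsilon>" by (rule m) (simp add: t_def)
        then show ?thesis
          using q_scaleR[OF csum_ball_csum[OF t], of c] functional_onD(2)[OF \<Phi> qt, of c] by simp
      qed
      from this[of "1 / C"] this[of "- (1 / C)"] C show ?thesis
        by (simp add: abs_le_iff field_simps)
    qed
    then show "\<bar>\<Phi> (q (\<lambda>n. if m \<le> n then y n else 0))\<bar> \<le> \<epsilon> * C" by (simp add: t_def[abs_def])
  qed
qed

end

section \<open>Separability of duals for subspaces of the sum\<close>

lemma functional_on_subset: "functional_on V f \<Longrightarrow> W \<subseteq> V \<Longrightarrow> functional_on W f"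
  unfolding functional_on_def by blast

lemma functional_on_sum:
  assumes "functional_on V f" "subspace V" "finite I" "\<And>i. i \<in> I \<Longrightarrow> g i \<in> V"
  shows "f (\<Sum>i\<in>I. g i) = (\<Sum>i\<in>I. f (g i))"
  using assms(3,4)
proof (induction I rule: finite_induct)
  case empty
  show ?case using functional_onD(2)[OF assms(1) subspace_0[OF assms(2)], of 0] by simp
next
  case (insert i I)
  then have "f (g i + (\<Sum>i\<in>I. g i)) = f (g i) + f (\<Sum>i\<in>I. g i)"
    by (intro functional_onD(1)[OF assms(1)] subspace_sum[OF assms(2)]) auto
  with insert show ?case by simp
qed

text \<open>The functional is extended from the span of \<open>D\<close> to the image of the \<open>c\<^sub>0\<close>-sum of the
  separable subspaces \<open>Z n\<close>; there it is nearly determined by finitely many restrictions to the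
  \<open>Z n\<close>.\<close>

lemma (in c0_sum) functional_approx:
  assumes W: "normed_on W nrm" "W \<subseteq> space" and DW: "D \<subseteq> W"
    and y: "\<And>d. d \<in> D \<Longrightarrow> y d \<in> csum_ball (2 * nrm d) \<and> q (y d) = d"
    and Z: "\<And>n. banach_on (Z n) (M n)" "\<And>n. Z n \<subseteq> Y n" "\<And>n d. d \<in> D \<Longrightarrow> y d n \<in> Z n"
    and \<Xi>: "\<And>n. \<Xi> n \<subseteq> dual (Z n) (M n)"
      "\<And>n \<zeta> \<epsilon>. \<zeta> \<in> dual (Z n) (M n) \<Longrightarrow> 0 < \<epsilon> \<Longrightarrow> \<exists>\<xi>\<in>\<Xi> n. dual_dist (Z n) (M n) \<zeta> \<xi> < \<epsilon>"
    and \<Phi>: "\<Phi> \<in> dual W nrm" and \<epsilon>: "0 < \<epsilon>"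
  obtains xs where "\<And>n. n < length xs \<Longrightarrow> xs ! n \<in> \<Xi> n"
    "\<And>d. d \<in> D \<Longrightarrow> \<bar>\<Phi> d - (\<Sum>n<length xs. (xs ! n) (y d n))\<bar> \<le> \<epsilon> * nrm d"
proof -
  interpret W: normed_on W nrm by fact
  \<comment> \<open>The maps \<open>q\<close> and \<open>coord\<close> depend on \<open>T\<close>
    only and are shared with the smaller sum. Its quotient norm is the larger one, since it admits
    fewer lifts.\<close>
  interpret Z: c0_sum Z M T
  proof (rule c0_sum.intro)
    show "banach_on (Z n) (M n)" for n by (rule Z(1))
    show "T n (u + v) = T n u + T n v" if "u \<in> Z n" "v \<in> Z n" for n u v
      using that Z(2)[of n] by (intro T_add) auto
    show "T n (c *\<^sub>R v) = c *\<^sub>R T n v" if "v \<in> Z n" for n c v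
      using that Z(2)[of n] by (intro T_scaleR) auto
    show "norm (T n v) \<le> M n v" if "v \<in> Z n" for n v
      using that Z(2)[of n] by (intro T_le) auto
  qed
  have Z_normed: "normed_on (Z n) (M n)" for n by (rule normed_on_if_banach_on[OF Z(1)])
  have Z_ball: "z \<in> csum_ball C" if "z \<in> Z.csum_ball C" for z C
    using that Z(2) by (auto simp: Z.csum_ball_def Z.csum_def csum_ball_def csum_def)
  have yZ: "y d \<in> Z.csum_ball (2 * nrm d)" if "d \<in> D" for d
    using y[OF that] Z(3)[OF that] by (simp add: Z.csum_ball_def Z.csum_def csum_ball_def csum_def)
  have nrm_le_Z: "nrm u \<le> Z.nrm u" if "u \<in> Z.space" for u
    by (rule Z.nrm_greatest[OF that]) (simp add: nrm_le Z_ball)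
  have DZ: "D \<subseteq> Z.space"
  proof
    fix d assume "d \<in> D"
    from Z.q_mem[OF Z.csum_ball_csum[OF yZ[OF this]]] y[OF this] show "d \<in> Z.space" by simp
  qed
  have span: "span D \<subseteq> W" "span D \<subseteq> Z.space"
    using DW DZ by (simp_all add: span_minimal W.subspace Z.subspace)
  define B where "B = dual_norm W nrm \<Phi>"
  have B: "0 \<le> B" unfolding B_def by (rule W.dual_norm_nonneg[OF \<Phi>])
  have sub: "sublinear_on Z.space (\<lambda>u. B * Z.nrm u)"
    unfolding sublinear_on_def
  proof (intro conjI ballI allI impI)
    show "B * Z.nrm (u + v) \<le> B * Z.nrm u + B * Z.nrm v" if "u \<in> Z.space" "v \<in> Z.space" for u v
      using mult_left_mono[OF Z.norm_triangle[OF that] B] by (simp add: distrib_left)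
    show "B * Z.nrm (c *\<^sub>R v) \<le> c * (B * Z.nrm v)" if "0 < c" "v \<in> Z.space" for c v
      using that by (simp add: Z.norm_scaleR)
  qed
  \<comment> \<open>The elements of \<open>D\<close> have lifts with coordinates in the
    \<open>Z n\<close>, but those of \<open>W\<close> need not, so the extension starts from the
    span of \<open>D\<close>.\<close>
  have lin: "functional_on (span D) \<Phi>"
    by (rule functional_on_subset[OF W.dual_functional[OF \<Phi>] span(1)])
  have le: "\<Phi> w \<le> B * Z.nrm w" if "w \<in> span D" for w
  proof -
    have "\<Phi> w \<le> B * nrm w" using W.dual_apply_le[OF \<Phi>, of w] that span(1) by (auto simp: B_def)
    also have "\<dots> \<le> B * Z.nrm w" using that span(2) B by (intro mult_left_mono nrm_le_Z) auto
    finally show ?thesis .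
  qed
  obtain \<Psi> where \<Psi>: "functional_on Z.space \<Psi>" "\<And>u. u \<in> Z.space \<Longrightarrow> \<Psi> u \<le> B * Z.nrm u"
    "\<And>w. w \<in> span D \<Longrightarrow> \<Psi> w = \<Phi> w"
    by (rule hahn_banach[OF Z.subspace sub subspace_span span(2) lin le]) (assumption, rule that)
  have \<Psi>_abs: "\<bar>\<Psi> u\<bar> \<le> B * Z.nrm u" if "u \<in> Z.space" for u
    using \<Psi>(2)[OF that] \<Psi>(2)[OF Z.mem_simps(5)[OF that]] functional_on_minus[OF \<Psi>(1) that]
      Z.norm_minus[OF that] by (simp add: abs_le_iff)
  have "0 < \<epsilon> / 4" using \<epsilon> by simp
  obtain m where m: "\<And>z C. z \<in> Z.csum_ball C \<Longrightarrow> \<bar>\<Psi> (q (\<lambda>n. if m \<le> n then z n else 0))\<bar> \<le> \<epsilon> / 4 * C"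
    by (rule Z.functional_tail[OF \<Psi>(1) \<Psi>_abs \<open>0 < \<epsilon> / 4\<close>]) (assumption, rule that)
  define \<zeta> where "\<zeta> n = restrict (\<lambda>v. \<Psi> (coord n v)) (Z n)" for n
  have \<zeta>: "\<zeta> n \<in> dual (Z n) (M n)" for n
    unfolding \<zeta>_def
  proof (rule normed_on.dualI[OF Z_normed])
    show "functional_on (Z n) (\<lambda>v. \<Psi> (coord n v))"
      by (simp add: functional_on_def Z.coord_add Z.coord_scaleR functional_onD[OF \<Psi>(1)] Z.coord_mem)
    fix v assume v: "v \<in> Z n"
    have "\<bar>\<Psi> (coord n v)\<bar> \<le> B * Z.nrm (coord n v)" by (intro \<Psi>_abs Z.coord_mem v)
    also have "\<dots> \<le> B * M n v" by (intro mult_left_mono Z.nrm_coord_le v B)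
    finally show "\<bar>\<Psi> (coord n v)\<bar> \<le> B * M n v" .
  qed
  \<comment> \<open>The lift of \<open>d\<close> has radius \<open>2 * nrm d\<close>. The first
    \<open>m\<close> coordinates together and the tail each contribute at most
    \<open>\<epsilon> / 2 * nrm d\<close>.\<close>
  define \<eta> where "\<eta> = \<epsilon> / (4 * (real m + 1))"
  have \<eta>: "0 < \<eta>" "real m * \<eta> \<le> \<epsilon> / 4" using \<epsilon> by (simp_all add: \<eta>_def field_simps)
  have "\<forall>n. \<exists>\<xi>. \<xi> \<in> \<Xi> n \<and> dual_dist (Z n) (M n) (\<zeta> n) \<xi> < \<eta>" using \<Xi>(2)[OF \<zeta> \<eta>(1)] by blast
  from choice[OF this] obtain \<xi> where "\<forall>n. \<xi> n \<in> \<Xi> n \<and> dual_dist (Z n) (M n) (\<zeta> n) (\<xi> n) < \<eta>" ..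
  then have \<xi>: "\<xi> n \<in> \<Xi> n" "dual_dist (Z n) (M n) (\<zeta> n) (\<xi> n) < \<eta>" for n by simp_all
  have \<xi>d: "\<xi> n \<in> dual (Z n) (M n)" for n using \<xi>(1) \<Xi>(1) by blast
  show thesis
  proof (rule that[of "map \<xi> [0..<m]"])
    show "map \<xi> [0..<m] ! n \<in> \<Xi> n" if "n < length (map \<xi> [0..<m])" for n using that \<xi>(1) by simp
    fix d assume d: "d \<in> D"
    note yd = yZ[OF d]
    have C: "0 \<le> nrm d" using csum_ball_nonneg[OF conjunct1[OF y[OF d]]] by simp
    have "\<Phi> d = \<Psi> (q (y d))" using \<Psi>(3)[OF span_base[OF d]] y[OF d] by simp
    also have "\<dots> = \<Psi> ((\<Sum>n<m. coord n (y d n)) + q (\<lambda>n. if m \<le> n then y d n else 0))"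
      by (rule arg_cong[OF Z.q_split[OF Z.csum_ball_csum[OF yd]]])
    also have "\<dots> = \<Psi> (\<Sum>n<m. coord n (y d n)) + \<Psi> (q (\<lambda>n. if m \<le> n then y d n else 0))"
      by (intro functional_onD(1)[OF \<Psi>(1)] Z.mem_simps Z.coord_mem Z(3)[OF d] Z.q_mem
          Z.csum_modify[OF Z.csum_ball_csum[OF yd]])
    also have "\<Psi> (\<Sum>n<m. coord n (y d n)) = (\<Sum>n<m. \<Psi> (coord n (y d n)))"
      by (intro functional_on_sum[OF \<Psi>(1) Z.subspace] Z.coord_mem Z(3)[OF d]) simp
    also have "\<dots> = (\<Sum>n<m. \<zeta> n (y d n))" using Z(3)[OF d] by (simp add: \<zeta>_def)
    finally have eq: "\<Phi> d - (\<Sum>n<m. \<xi> n (y d n)) =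
        (\<Sum>n<m. \<zeta> n (y d n) - \<xi> n (y d n)) + \<Psi> (q (\<lambda>n. if m \<le> n then y d n else 0))"
      by (simp add: sum_subtractf)
    have "\<bar>\<Sum>n<m. \<zeta> n (y d n) - \<xi> n (y d n)\<bar> \<le> (\<Sum>n<m. \<bar>\<zeta> n (y d n) - \<xi> n (y d n)\<bar>)" by (rule sum_abs)
    also have "\<dots> \<le> (\<Sum>n<m. \<eta> * (2 * nrm d))"
    proof (rule sum_mono)
      fix n
      have "\<bar>\<zeta> n (y d n) - \<xi> n (y d n)\<bar> \<le> dual_dist (Z n) (M n) (\<zeta> n) (\<xi> n) * M n (y d n)"
        by (rule normed_on.dual_dist_apply_le[OF Z_normed \<zeta> \<xi>d Z(3)[OF d]])
      also have "\<dots> \<le> \<eta> * (2 * nrm d)"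
        using \<xi>(2)[of n] Z.csum_ball_le[OF yd, of n] \<eta>(1)
          normed_on.norm_nonneg[OF Z_normed Z(3)[OF d], of n] by (intro mult_mono) auto
      finally show "\<bar>\<zeta> n (y d n) - \<xi> n (y d n)\<bar> \<le> \<eta> * (2 * nrm d)" .
    qed
    also have "\<dots> = (real m * \<eta>) * (2 * nrm d)" by simp
    also have "\<dots> \<le> \<epsilon> / 4 * (2 * nrm d)" using \<eta>(2) C by (intro mult_right_mono) auto
    finally have "\<bar>\<Phi> d - (\<Sum>n<m. \<xi> n (y d n))\<bar> \<le> \<epsilon> / 4 * (2 * nrm d) + \<epsilon> / 4 * (2 * nrm d)"
      unfolding eq using m[OF yd] by linarith
    then show "\<bar>\<Phi> d - (\<Sum>n<length (map \<xi> [0..<m]). (map \<xi> [0..<m] ! n) (y d n))\<bar> \<le> \<epsilon> * nrm d" by simp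
  qed
qed

text \<open>By \<open>functional_approx\<close>, a list from a countable set describes a functional
  on \<open>W\<close> up to a small error. The list itself does not define a functional, because the
  chosen lift \<open>y d\<close> need not be linear in \<open>d\<close>. So for each list and each
  precision some functional described by them is picked, if there is one; two functionals with the
  same description are close.\<close>

lemma (in c0_sum) separable_dual:
  assumes asplund: "\<And>n. asplund_on (Y n) (M n)"
    and W: "W \<subseteq> space" "banach_on W nrm"
    and sep: "separable_space (Metric_space.mtopology W (norm_dist W nrm))"
  shows "separable_space (Metric_space.mtopology (dual W nrm) (dual_dist W nrm))"
proof -
  have Wn: "normed_on W nrm" by (rule normed_on_if_banach_on[OF W(2)])
  then interpret W: normed_on W nrm .
  obtain D where D: "countable D" "D \<subseteq> W" and dense: "\<forall>v\<in>W. \<forall>\<epsilon>>0. \<exists>u\<in>D. nrm (v - u) < \<epsilon>"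
    using sep unfolding W.separable_iff by (elim exE conjE)
  have "\<forall>d\<in>D. \<exists>y. y \<in> csum_ball (2 * nrm d) \<and> q y = d"
  proof
    fix d assume "d \<in> D"
    then have d: "d \<in> space" using D(2) W(1) by auto
    show "\<exists>y. y \<in> csum_ball (2 * nrm d) \<and> q y = d"
    proof (cases "d = 0")
      case True
      then show ?thesis by (intro exI[of _ "\<lambda>n. 0"]) (simp add: zero_csum_ball nrm_zero q_zero)
    next
      case False
      then have "nrm d < 2 * nrm d" using norm_eq_zero[OF d] norm_nonneg[OF d] by linarith
      then obtain y where "y \<in> csum_ball (2 * nrm d)" "q y = d" by (rule nrm_less[OF d])
      then show ?thesis by (intro exI conjI)
    qed
  qed
  from bchoice[OF this] obtain y where y: "\<forall>d\<in>D. y d \<in> csum_ball (2 * nrm d) \<and> q (y d) = d" ..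
  have "\<forall>n. \<exists>Z. (\<lambda>d. y d n) ` D \<subseteq> Z \<and> Z \<subseteq> Y n \<and> banach_on Z (M n) \<and>
      separable_space (Metric_space.mtopology Z (norm_dist Z (M n)))"
  proof
    fix n
    interpret Yn: banach_on "Y n" "M n" by (rule banach)
    have "countable ((\<lambda>d. y d n) ` D)" using D(1) by simp
    moreover have "(\<lambda>d. y d n) ` D \<subseteq> Y n" using y by (auto intro: csum_mem csum_ball_csum)
    ultimately obtain Z where "(\<lambda>d. y d n) ` D \<subseteq> Z" "Z \<subseteq> Y n" "banach_on Z (M n)"
      "separable_space (Metric_space.mtopology Z (norm_dist Z (M n)))"
      by (rule Yn.separable_banach_subspace)
    then show "\<exists>Z. (\<lambda>d. y d n) ` D \<subseteq> Z \<and> Z \<subseteq> Y n \<and> banach_on Z (M n) \<and>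
      separable_space (Metric_space.mtopology Z (norm_dist Z (M n)))" by (intro exI conjI)
  qed
  from choice[OF this] obtain Z where "\<forall>n. (\<lambda>d. y d n) ` D \<subseteq> Z n \<and> Z n \<subseteq> Y n \<and> banach_on (Z n) (M n) \<and>
      separable_space (Metric_space.mtopology (Z n) (norm_dist (Z n) (M n)))" ..
  then have Z: "(\<lambda>d. y d n) ` D \<subseteq> Z n" "Z n \<subseteq> Y n" "banach_on (Z n) (M n)"
    "separable_space (Metric_space.mtopology (Z n) (norm_dist (Z n) (M n)))" for n by simp_all
  have "\<forall>n. \<exists>\<Xi>. countable \<Xi> \<and> \<Xi> \<subseteq> dual (Z n) (M n) \<and>
      (\<forall>\<zeta>\<in>dual (Z n) (M n). \<forall>\<epsilon>>0. \<exists>\<xi>\<in>\<Xi>. dual_dist (Z n) (M n) \<zeta> \<xi> < \<epsilon>)"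
  proof
    fix n
    interpret Zn: Metric_space "dual (Z n) (M n)" "dual_dist (Z n) (M n)"
      by (rule normed_on.dual_metric[OF normed_on_if_banach_on[OF Z(3)]])
    have "separable_space Zn.mtopology"
      using asplund[of n] Z(2-4)[of n] unfolding asplund_on_def by blast
    then show "\<exists>\<Xi>. countable \<Xi> \<and> \<Xi> \<subseteq> dual (Z n) (M n) \<and>
      (\<forall>\<zeta>\<in>dual (Z n) (M n). \<forall>\<epsilon>>0. \<exists>\<xi>\<in>\<Xi>. dual_dist (Z n) (M n) \<zeta> \<xi> < \<epsilon>)"
      unfolding Zn.separable_space_mtopology .
  qed
  from choice[OF this] obtain \<Xi> where "\<forall>n. countable (\<Xi> n) \<and> \<Xi> n \<subseteq> dual (Z n) (M n) \<and>
      (\<forall>\<zeta>\<in>dual (Z n) (M n). \<forall>\<epsilon>>0. \<exists>\<xi>\<in>\<Xi> n. dual_dist (Z n) (M n) \<zeta> \<xi> < \<epsilon>)" ..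
  then have \<Xi>: "countable (\<Xi> n)" "\<Xi> n \<subseteq> dual (Z n) (M n)"
    "\<zeta> \<in> dual (Z n) (M n) \<Longrightarrow> 0 < \<epsilon> \<Longrightarrow> \<exists>\<xi>\<in>\<Xi> n. dual_dist (Z n) (M n) \<zeta> \<xi> < \<epsilon>" for n \<zeta> \<epsilon>
    by simp_all
  define Q where "Q = {xs. \<forall>n<length xs. xs ! n \<in> \<Xi> n}"
  have "Q \<subseteq> lists (\<Union>n. \<Xi> n)"
  proof
    fix xs assume "xs \<in> Q"
    then have "x \<in> (\<Union>n. \<Xi> n)" if "x \<in> set xs" for x
      using that unfolding Q_def in_set_conv_nth by blast
    then show "xs \<in> lists (\<Union>n. \<Xi> n)" by auto
  qed
  moreover have "countable (lists (\<Union>n. \<Xi> n))" using \<Xi>(1) by (intro countable_lists countable_UN) auto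
  ultimately have Q: "countable Q" by (rule countable_subset)
  define P where "P xs k \<Phi> \<longleftrightarrow> \<Phi> \<in> dual W nrm \<and>
    (\<forall>d\<in>D. \<bar>\<Phi> d - (\<Sum>n<length xs. (xs ! n) (y d n))\<bar> \<le> (1/2) ^ k * nrm d)" for xs and k :: nat and \<Phi>
  define pick where "pick xs k = (SOME \<Phi>. P xs k \<Phi>)" for xs k
  have pick: "P xs k (pick xs k)" if "P xs k \<Phi>" for xs k \<Phi>
    unfolding pick_def using that by (rule someI[of "P xs k"])
  define S where "S = (\<lambda>(xs, k). pick xs k) ` {(xs, k). xs \<in> Q \<and> (\<exists>\<Phi>. P xs k \<Phi>)}"
  have "countable (Q \<times> (UNIV :: nat set))" using Q by simp
  then have "countable {(xs, k :: nat). xs \<in> Q \<and> (\<exists>\<Phi>. P xs k \<Phi>)}"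
    by (rule countable_subset[rotated]) auto
  then have "countable S" unfolding S_def by (rule countable_image)
  moreover have "S \<subseteq> dual W nrm" using pick by (auto simp: S_def P_def)
  moreover have "\<exists>\<Phi>'\<in>S. dual_dist W nrm \<Phi> \<Phi>' < \<epsilon>" if \<Phi>: "\<Phi> \<in> dual W nrm" and \<epsilon>: "0 < \<epsilon>" for \<Phi> \<epsilon>
  proof -
    obtain k where k: "(1/2) ^ k < \<epsilon> / 2" using real_arch_pow_inv[of "\<epsilon> / 2" "1/2"] \<epsilon> by auto
    have k0: "0 < (1/2 :: real) ^ k" by simp
    obtain xs where xs: "\<And>n. n < length xs \<Longrightarrow> xs ! n \<in> \<Xi> n"
      "\<And>d. d \<in> D \<Longrightarrow> \<bar>\<Phi> d - (\<Sum>n<length xs. (xs ! n) (y d n))\<bar> \<le> (1/2) ^ k * nrm d"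
    proof (rule functional_approx[OF Wn W(1) D(2) _ Z(3,2) _ \<Xi>(2,3) \<Phi> k0])
      show "y d \<in> csum_ball (2 * nrm d) \<and> q (y d) = d" if "d \<in> D" for d using y that by blast
      show "y d n \<in> Z n" if "d \<in> D" for n d using Z(1)[of n] that by auto
    qed (assumption | rule that)+
    have P: "P xs k \<Phi>" using \<Phi> xs(2) by (simp add: P_def)
    define \<Phi>' where "\<Phi>' = pick xs k"
    have P': "P xs k \<Phi>'" unfolding \<Phi>'_def by (rule pick[OF P])
    have \<Phi>': "\<Phi>' \<in> dual W nrm" using P' by (simp add: P_def)
    have "xs \<in> Q" using xs(1) by (simp add: Q_def)
    with P have "\<Phi>' \<in> S" unfolding S_def \<Phi>'_def by (intro image_eqI[of _ _ "(xs, k)"]) auto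
    moreover have "dual_dist W nrm \<Phi> \<Phi>' \<le> 2 * (1/2) ^ k"
    proof (rule W.dual_dist_le[OF \<Phi> \<Phi>'])
      fix v assume v: "v \<in> W"
      show "\<bar>\<Phi> v - \<Phi>' v\<bar> \<le> 2 * (1/2) ^ k * nrm v"
      proof (rule field_le_epsilon)
        fix e :: real assume e: "0 < e"
        \<comment> \<open>\<open>L\<close> collects what is lost in moving from \<open>v\<close> to
          a nearby \<open>d\<close> in the dense set: the distance of the two functionals and the
          change of \<open>nrm\<close> on the right-hand side.\<close>
        define L where "L = dual_dist W nrm \<Phi> \<Phi>' + 2 * (1/2) ^ k"
        have L: "0 < L" using W.dual_dist_nonneg[of \<Phi> \<Phi>'] k0 by (simp add: L_def add_nonneg_pos)
        then have "0 < e / L" using e by simp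
        then obtain d where d: "d \<in> D" "nrm (v - d) < e / L" using dense v by blast
        have dW: "d \<in> W" using d(1) D(2) by auto
        have vd: "v - d \<in> W" using v dW by (rule W.mem_simps)
        have "\<bar>\<Phi> v - \<Phi>' v\<bar> \<le> \<bar>\<Phi> (v - d) - \<Phi>' (v - d)\<bar> + \<bar>\<Phi> d - \<Phi>' d\<bar>"
          using functional_on_diff[OF W.dual_functional[OF \<Phi>] W.subspace v dW]
            functional_on_diff[OF W.dual_functional[OF \<Phi>'] W.subspace v dW] by linarith
        also have "\<bar>\<Phi> (v - d) - \<Phi>' (v - d)\<bar> \<le> dual_dist W nrm \<Phi> \<Phi>' * nrm (v - d)"
          by (rule W.dual_dist_apply_le[OF \<Phi> \<Phi>' vd])
        also have "\<bar>\<Phi> d - \<Phi>' d\<bar> \<le> 2 * (1/2) ^ k * nrm d"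
        proof -
          define X where "X = (\<Sum>n<length xs. (xs ! n) (y d n))"
          have "\<bar>\<Phi> d - X\<bar> \<le> (1/2) ^ k * nrm d" "\<bar>\<Phi>' d - X\<bar> \<le> (1/2) ^ k * nrm d"
            using P P' d(1) by (simp_all add: P_def X_def)
          then show ?thesis by linarith
        qed
        also have "2 * (1/2) ^ k * nrm d \<le> 2 * (1/2) ^ k * (nrm v + nrm (v - d))"
          using W.norm_diff_le[OF v vd] by (intro mult_left_mono) auto
        finally have "\<bar>\<Phi> v - \<Phi>' v\<bar> \<le> 2 * (1/2) ^ k * nrm v + L * nrm (v - d)"
          by (simp add: L_def algebra_simps)
        also have "L * nrm (v - d) \<le> L * (e / L)" using d(2) L by (intro mult_left_mono) auto
        also have "L * (e / L) = e" using L by simp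
        finally show "\<bar>\<Phi> v - \<Phi>' v\<bar> \<le> 2 * (1/2) ^ k * nrm v + e" by simp
      qed
    qed simp
    ultimately show ?thesis using k by (intro bexI[of _ \<Phi>']) linarith
  qed
  ultimately have "\<exists>S. countable S \<and> S \<subseteq> dual W nrm \<and>
      (\<forall>\<Phi>\<in>dual W nrm. \<forall>\<epsilon>>0. \<exists>\<Phi>'\<in>S. dual_dist W nrm \<Phi> \<Phi>' < \<epsilon>)"
    by (intro exI[of _ S] conjI ballI allI impI)
  then show ?thesis
    unfolding Metric_space.separable_space_mtopology[OF W.dual_metric] .
qed

lemma (in c0_sum) asplund_space:
  assumes "\<And>n. asplund_on (Y n) (M n)"
  shows "asplund_on space nrm"
  unfolding asplund_on_def using banach_space separable_dual[OF assms] by blast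

section \<open>Properties of a single representation\<close>

context
  fixes V :: "'v::real_vector set" and N
    and act :: "'s::semitopological_semigroup \<Rightarrow> 'x::topological_space \<Rightarrow> 'x" and h \<alpha>
  assumes normed: "normed_on V N" and rep: "representation V N act h \<alpha>"
begin

lemma representation_ball: "\<alpha> x \<in> dual V N" "dual_norm V N (\<alpha> x) \<le> 1"
proof -
  have "\<alpha> ` topspace euclidean \<subseteq> {\<phi> \<in> dual V N. dual_norm V N \<phi> \<le> 1}"
    using rep unfolding representation_def weak_star_ball_def continuous_map_initial_topology
    by (elim conjE)
  from subsetD[OF this, of "\<alpha> x"] show "\<alpha> x \<in> dual V N" "dual_norm V N (\<alpha> x) \<le> 1" by simp_all
qed

lemma representation_abs_le:
  assumes v: "v \<in> V"
  shows "\<bar>\<alpha> x v\<bar> \<le> N v"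
proof -
  have "\<bar>\<alpha> x v\<bar> \<le> dual_norm V N (\<alpha> x) * N v"
    by (rule normed_on.dual_apply_le[OF normed representation_ball(1) v])
  also have "\<dots> \<le> 1 * N v"
    by (intro mult_right_mono representation_ball normed_on.norm_nonneg[OF normed v])
  finally show ?thesis by simp
qed

lemma representation_continuous:
  assumes v: "v \<in> V"
  shows "continuous_on UNIV (\<lambda>x. \<alpha> x v)"
proof -
  have all: "\<forall>g\<in>{\<lambda>\<phi>. \<phi> v | v. v \<in> V}. continuous_map euclidean euclideanreal (\<lambda>x. g (\<alpha> x))"
    using rep unfolding representation_def weak_star_ball_def continuous_map_initial_topology
    by (elim conjE)
  have "(\<lambda>\<phi>. \<phi> v) \<in> {\<lambda>\<phi> :: 'v \<Rightarrow> real. \<phi> v | v. v \<in> V}" using v by blast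
  from bspec[OF all this] show ?thesis by simp
qed

lemma representation_contraction:
  assumes v: "v \<in> V"
  shows "h s v \<in> V" "N (h s v) \<le> N v"
proof -
  have "h ` topspace euclidean \<subseteq> contractions V N"
    using rep
    unfolding representation_def weak_operator_topology_def continuous_map_initial_topology
    by (elim conjE)
  from subsetD[OF this, of "h s"] have "h s \<in> contractions V N" by simp
  with v show "h s v \<in> V" "N (h s v) \<le> N v" by (auto simp: contractions_def)
qed

lemma representation_wot_continuous:
  assumes \<phi>: "\<phi> \<in> dual V N" and v: "v \<in> V"
  shows "continuous_on UNIV (\<lambda>s. \<phi> (h s v))"
proof -
  have all: "\<forall>g\<in>{\<lambda>\<sigma>. \<phi> (\<sigma> v) | \<phi> v. \<phi> \<in> dual V N \<and> v \<in> V}.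
      continuous_map euclidean euclideanreal (\<lambda>s. g (h s))"
    using rep
    unfolding representation_def weak_operator_topology_def continuous_map_initial_topology
    by (elim conjE)
  have "(\<lambda>\<sigma>. \<phi> (\<sigma> v)) \<in> {\<lambda>\<sigma> :: 'v \<Rightarrow> 'v. \<phi> (\<sigma> v) | \<phi> v. \<phi> \<in> dual V N \<and> v \<in> V}"
    using assms by blast
  from bspec[OF all this] show ?thesis by simp
qed

lemma representation_equivariant: "v \<in> V \<Longrightarrow> \<alpha> (act s x) v = \<alpha> x (h s v)"
  using rep by (simp add: representation_def)

end

section \<open>RN-approximable flows\<close>

lemma asplund_on_normed_on: "asplund_on V N \<Longrightarrow> normed_on V N"
  by (simp add: asplund_on_def normed_on_if_banach_on)

lemma RN_approximable_imp_RN_flow: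
  fixes act :: "'s::semitopological_semigroup \<Rightarrow> 'x \<Rightarrow> 'x::second_countable_topology"
  assumes act: "flow act" and RN: "RN_approximable TYPE('v::real_vector) act"
  shows "RN_flow act"
proof -
  obtain R :: "('v set \<times> ('v \<Rightarrow> real) \<times> ('s \<Rightarrow> 'v \<Rightarrow> 'v) \<times> ('x \<Rightarrow> 'v \<Rightarrow> real)) set" where
    R1: "\<forall>(V, N, h, \<alpha>)\<in>R. asplund_on V N \<and> representation V N act h \<alpha>"
    and R2: "\<forall>x y. x \<noteq> y \<longrightarrow> (\<exists>(V, N, h, \<alpha>)\<in>R. \<alpha> x \<noteq> \<alpha> y)"
    and R3: "\<forall>F x. closed F \<and> x \<notin> F \<longrightarrow>
      (\<exists>(V, N, h, \<alpha>)\<in>R. \<alpha> x \<notin> weak_star_ball V N closure_of (\<alpha> ` F))"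
    using RN unfolding RN_approximable_def by (elim exE conjE)
  define V where "V \<rho> = fst \<rho>" for \<rho> :: "'v set \<times> ('v \<Rightarrow> real) \<times> ('s \<Rightarrow> 'v \<Rightarrow> 'v) \<times> ('x \<Rightarrow> 'v \<Rightarrow> real)"
  define N where "N \<rho> = fst (snd \<rho>)"
    for \<rho> :: "'v set \<times> ('v \<Rightarrow> real) \<times> ('s \<Rightarrow> 'v \<Rightarrow> 'v) \<times> ('x \<Rightarrow> 'v \<Rightarrow> real)"
  define h where "h \<rho> = fst (snd (snd \<rho>))"
    for \<rho> :: "'v set \<times> ('v \<Rightarrow> real) \<times> ('s \<Rightarrow> 'v \<Rightarrow> 'v) \<times> ('x \<Rightarrow> 'v \<Rightarrow> real)"
  define \<alpha> where "\<alpha> \<rho> = snd (snd (snd \<rho>))"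
    for \<rho> :: "'v set \<times> ('v \<Rightarrow> real) \<times> ('s \<Rightarrow> 'v \<Rightarrow> 'v) \<times> ('x \<Rightarrow> 'v \<Rightarrow> real)"
  note defs = V_def N_def h_def \<alpha>_def
  have asp: "asplund_on (V \<rho>) (N \<rho>)" and rep: "representation (V \<rho>) (N \<rho>) act (h \<rho>) (\<alpha> \<rho>)"
    if "\<rho> \<in> R" for \<rho>
    using bspec[OF R1 that] by (auto simp: defs split_beta)
  note nrmd = asplund_on_normed_on[OF asp]
  have point_sep: "\<exists>\<rho>\<in>R. \<alpha> \<rho> x \<noteq> \<alpha> \<rho> y" if "x \<noteq> y" for x y
    using R2[rule_format, OF that] by (auto simp: defs split_beta)
  have closed_sep: "\<exists>\<rho>\<in>R. \<alpha> \<rho> x \<notin> weak_star_ball (V \<rho>) (N \<rho>) closure_of (\<alpha> \<rho> ` F)"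
    if "closed F" "x \<notin> F" for F x
    using R3[rule_format, of F x] that by (auto simp: defs split_beta)
  let ?B = "\<lambda>\<rho>. {\<alpha> \<rho> -` Q | Q. openin (weak_star_ball (V \<rho>) (N \<rho>)) Q}"
  have cont: "continuous_map euclidean (weak_star_ball (V \<rho>) (N \<rho>)) (\<alpha> \<rho>)" if "\<rho> \<in> R" for \<rho>
    using rep[OF that] by (simp add: representation_def)
  obtain r where r: "range r \<subseteq> R"
    and base: "\<And>U x. open U \<Longrightarrow> x \<in> U \<Longrightarrow> \<exists>n :: nat. \<exists>G\<in>?B (r n). x \<in> G \<and> G \<subseteq> U"
  proof (rule countable_subfamily_basis[of R ?B])
    show "open G" if \<rho>: "\<rho> \<in> R" and "G \<in> ?B \<rho>" for \<rho> G
    proof -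
      from that obtain Q where Q: "openin (weak_star_ball (V \<rho>) (N \<rho>)) Q" "G = \<alpha> \<rho> -` Q" by auto
      from openin_continuous_map_preimage[OF cont[OF \<rho>] Q(1)] show ?thesis
        by (simp add: Q(2) vimage_def)
    qed
    fix U :: "'x set" and x assume U: "open U" "x \<in> U"
    then have "\<exists>\<rho>\<in>R. \<alpha> \<rho> x \<notin> weak_star_ball (V \<rho>) (N \<rho>) closure_of (\<alpha> \<rho> ` (- U))"
      by (intro closed_sep) (simp_all add: closed_Compl)
    then obtain \<rho> where \<rho>: "\<rho> \<in> R"
      "\<alpha> \<rho> x \<notin> weak_star_ball (V \<rho>) (N \<rho>) closure_of (\<alpha> \<rho> ` (- U))" by (elim bexE)
    let ?S = "weak_star_ball (V \<rho>) (N \<rho>)"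
    have top: "\<alpha> \<rho> y \<in> topspace ?S" for y
      using continuous_map_image_subset_topspace[OF cont[OF \<rho>(1)]] by auto
    let ?Q = "topspace ?S - ?S closure_of (\<alpha> \<rho> ` (- U))"
    have "\<alpha> \<rho> ` (- U) \<subseteq> ?S closure_of (\<alpha> \<rho> ` (- U))"
      using top by (intro closure_of_subset) auto
    then have "\<alpha> \<rho> -` ?Q \<subseteq> U" by auto
    moreover have "openin ?S ?Q" by (intro openin_diff closedin_closure_of) simp
    moreover have "x \<in> \<alpha> \<rho> -` ?Q" using top \<rho>(2) by simp
    ultimately show "\<exists>\<rho>\<in>R. \<exists>G\<in>?B \<rho>. x \<in> G \<and> G \<subseteq> U"
      using \<rho>(1) by (intro bexI[of _ \<rho>] bexI[of _ "\<alpha> \<rho> -` ?Q"] conjI) auto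
  qed (rule that)
  have rR: "r n \<in> R" for n using r by auto
  note asp = asp[OF rR] and nrmd = nrmd[OF rR]
  note rp = nrmd rep[OF rR]
  \<comment> \<open>A vector is sent to the function that it induces on X, so vectors on which all
    \<open>\<alpha> (r n) x\<close> vanish become 0. In this way the quotient of the sum is a space
    of functions, as \<open>RN_flow\<close> demands.\<close>
  define T where "T n v = Bcontfun (\<lambda>x. \<alpha> (r n) x v)" for n v
  have T_apply: "apply_bcontfun (T n v) x = \<alpha> (r n) x v" if v: "v \<in> V (r n)" for n v x
  proof -
    have "(\<lambda>x. \<alpha> (r n) x v) \<in> bcontfun"
      using representation_continuous[OF rp v] representation_abs_le[OF rp v]
      by (intro bcontfun_normI[of _ "N (r n) v"]) auto
    then show ?thesis by (simp add: T_def Bcontfun_inverse)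
  qed
  have lin: "functional_on (V (r n)) (\<alpha> (r n) x)" for n x
    by (rule normed_on.dual_functional[OF nrmd representation_ball(1)[OF rp]])
  interpret c0_sum "\<lambda>n. V (r n)" "\<lambda>n. N (r n)" T
  proof (rule c0_sum.intro)
    fix n
    show "banach_on (V (r n)) (N (r n))" using asp[of n] by (simp add: asplund_on_def)
    note mem = normed_on.mem_simps[OF nrmd[of n]]
    show "T n (u + v) = T n u + T n v" if "u \<in> V (r n)" "v \<in> V (r n)" for u v
      using that by (intro bcontfun_eqI) (simp add: T_apply mem functional_onD[OF lin])
    show "T n (c *\<^sub>R v) = c *\<^sub>R T n v" if "v \<in> V (r n)" for c v
      using that by (intro bcontfun_eqI) (simp add: T_apply mem functional_onD[OF lin])
    show "norm (T n v) \<le> N (r n) v" if "v \<in> V (r n)" for v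
      using representation_abs_le[OF rp that] by (intro norm_bound) (simp add: T_apply that)
  qed
  have q_apply: "apply_bcontfun (q y) x = (\<Sum>n. (1/2) ^ Suc n * \<alpha> (r n) x (y n))" if y: "y \<in> csum" for y x
    using bounded_linear.suminf[OF blinfun.bounded_linear_right q_summable[OF y], of "eval_at x"]
    unfolding q_def by (simp add: T_apply csum_mem[OF y])
  \<comment> \<open>Translation lifts to the coordinatewise action of the \<open>h (r n)\<close>,
    which preserves the balls of the sum. Hence the quotient is invariant and its norm does not
    increase.\<close>
  have trans: "(\<lambda>n. h (r n) s (y n)) \<in> csum_ball C \<and> q (\<lambda>n. h (r n) s (y n)) = translate act (q y) s"
    if y: "y \<in> csum_ball C" for y C s
  proof
    note m = csum_mem[OF csum_ball_csum[OF y]]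
    note hm = representation_contraction[OF rp m]
    have "(\<lambda>n. N (r n) (h (r n) s (y n))) \<longlonglongrightarrow> 0"
    proof (rule LIMSEQ_zero_squeeze)
      show "0 \<le> N (r n) (h (r n) s (y n))" for n by (rule normed_on.norm_nonneg[OF nrmd hm(1)])
      show "N (r n) (h (r n) s (y n)) \<le> N (r n) (y n)" for n by (rule hm(2))
      show "(\<lambda>n. N (r n) (y n)) \<longlonglongrightarrow> 0" using csum_ball_csum[OF y] by (simp add: csum_def)
    qed
    moreover have "N (r n) (h (r n) s (y n)) \<le> C" for n
      using hm(2)[of n s] csum_ball_le[OF y, of n] by linarith
    ultimately show ball: "(\<lambda>n. h (r n) s (y n)) \<in> csum_ball C"
      using hm(1) by (simp add: csum_ball_def csum_def)
    show "q (\<lambda>n. h (r n) s (y n)) = translate act (q y) s"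
      by (rule bcontfun_eqI)
        (simp add: translate_apply[OF act] q_apply csum_ball_csum[OF y] csum_ball_csum[OF ball]
          representation_equivariant[OF rp m])
  qed
  have inv: "translate act f s \<in> space" if "f \<in> space" for f s
  proof -
    from that obtain y where y: "y \<in> csum" "f = q y" by (auto simp: space_def)
    obtain C where "y \<in> csum_ball C" by (rule csum_bounded[OF y(1)])
    note t = trans[OF this, of s]
    from q_mem[OF csum_ball_csum[OF conjunct1[OF t]]] conjunct2[OF t] y(2) show ?thesis by simp
  qed
  \<comment> \<open>The orbit of a lift stays in one ball, so the tail of \<open>\<phi>\<close> is
    small uniformly in \<open>s\<close>. What remains is a finite sum of functions that are
    continuous by the weak operator continuity of the summands.\<close>
  have wot: "continuous_on UNIV (\<lambda>s. \<phi> (translate act f s))"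
    if \<phi>: "\<phi> \<in> dual space nrm" and f: "f \<in> space" for \<phi> f
  proof (rule continuous_on_uniform_approx)
    fix \<epsilon> :: real assume \<epsilon>: "0 < \<epsilon>"
    note \<phi>_lin = dual_functional[OF \<phi>]
    from f obtain y where y: "y \<in> csum" "f = q y" by (auto simp: space_def)
    obtain C where C: "y \<in> csum_ball C" by (rule csum_bounded[OF y(1)])
    have C0: "0 \<le> C" by (rule csum_ball_nonneg[OF C])
    have "0 < \<epsilon> / (C + 1)" using \<epsilon> C0 by simp
    obtain m where m: "\<And>z D. z \<in> csum_ball D \<Longrightarrow>
        \<bar>\<phi> (q (\<lambda>n. if m \<le> n then z n else 0))\<bar> \<le> \<epsilon> / (C + 1) * D"
      by (rule functional_tail[OF \<phi>_lin dual_apply_le[OF \<phi>] \<open>0 < \<epsilon> / (C + 1)\<close>])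
        (assumption, rule that)
    define g where "g s = (\<Sum>n<m. \<phi> (coord n (h (r n) s (y n))))" for s
    note hm = representation_contraction(1)[OF rp csum_mem[OF y(1)]]
    have "continuous_on UNIV (\<lambda>s. \<phi> (coord n (h (r n) s (y n))))" for n
    proof -
      have "restrict (\<lambda>v. \<phi> (coord n v)) (V (r n)) \<in> dual (V (r n)) (N (r n))"
      proof (rule normed_on.dualI[OF nrmd])
        show "functional_on (V (r n)) (\<lambda>v. \<phi> (coord n v))"
          by (simp add: functional_on_def coord_add coord_scaleR functional_onD[OF \<phi>_lin] coord_mem)
        fix v assume v: "v \<in> V (r n)"
        have "\<bar>\<phi> (coord n v)\<bar> \<le> dual_norm space nrm \<phi> * nrm (coord n v)"
          by (rule dual_apply_le[OF \<phi> coord_mem[OF v]])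
        also have "\<dots> \<le> dual_norm space nrm \<phi> * N (r n) v"
          by (intro mult_left_mono nrm_coord_le v dual_norm_nonneg \<phi>)
        finally show "\<bar>\<phi> (coord n v)\<bar> \<le> dual_norm space nrm \<phi> * N (r n) v" .
      qed
      from representation_wot_continuous[OF rp this csum_mem[OF y(1)]] show ?thesis
        by (simp add: hm)
    qed
    then have "continuous_on UNIV g" unfolding g_def by (intro continuous_on_sum)
    moreover have "\<bar>\<phi> (translate act f s) - g s\<bar> \<le> \<epsilon>" for s
    proof -
      let ?z = "\<lambda>n. h (r n) s (y n)"
      have z: "?z \<in> csum_ball C" "q ?z = translate act f s" using trans[OF C, of s] y(2) by simp_all
      have "\<phi> (translate act f s) = \<phi> ((\<Sum>n<m. coord n (?z n)) + q (\<lambda>n. if m \<le> n then ?z n else 0))"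
        unfolding z(2)[symmetric] by (rule arg_cong[OF q_split[OF csum_ball_csum[OF z(1)]]])
      also have "\<dots> = \<phi> (\<Sum>n<m. coord n (?z n)) + \<phi> (q (\<lambda>n. if m \<le> n then ?z n else 0))"
        by (intro functional_onD(1)[OF \<phi>_lin] mem_simps coord_mem hm q_mem
            csum_modify[OF csum_ball_csum[OF z(1)]])
      also have "\<phi> (\<Sum>n<m. coord n (?z n)) = g s"
        unfolding g_def by (intro functional_on_sum[OF \<phi>_lin subspace] coord_mem hm) simp
      finally have "\<bar>\<phi> (translate act f s) - g s\<bar> \<le> \<epsilon> / (C + 1) * C"
        using m[OF z(1)] by simp
      also have "\<dots> \<le> \<epsilon>" using \<epsilon> C0 by (simp add: field_simps)
      finally show ?thesis .
    qed
    ultimately show "\<exists>g. continuous_on UNIV g \<and> (\<forall>s. \<bar>\<phi> (translate act f s) - g s\<bar> \<le> \<epsilon>)"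
      by (intro exI[of _ g] conjI allI)
  qed
  have coord_apply: "apply_bcontfun (coord n v) x = (1/2) ^ Suc n * \<alpha> (r n) x v"
    if "v \<in> V (r n)" for n v x
    using that by (simp add: coord_def T_apply)
  have gen: "\<exists>\<Phi> \<epsilon>. finite \<Phi> \<and> \<Phi> \<subseteq> space \<and> 0 < \<epsilon> \<and>
      (\<forall>y. (\<forall>f\<in>\<Phi>. \<bar>apply_bcontfun f y - apply_bcontfun f x\<bar> < \<epsilon>) \<longrightarrow> y \<in> U)"
    if U: "open U" "x \<in> U" for U x
  proof -
    from base[OF U] obtain n Q where Q: "openin (weak_star_ball (V (r n)) (N (r n))) Q"
      "\<alpha> (r n) x \<in> Q" "\<alpha> (r n) -` Q \<subseteq> U" by auto
    let ?V = "V (r n)" and ?N = "N (r n)"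
    obtain \<Phi> \<epsilon> where \<Phi>: "finite \<Phi>" "\<Phi> \<subseteq> {\<lambda>\<phi>. \<phi> v | v. v \<in> ?V}" "0 < \<epsilon>"
      "\<forall>b\<in>{\<phi> \<in> dual ?V ?N. dual_norm ?V ?N \<phi> \<le> 1}.
        (\<forall>g\<in>\<Phi>. \<bar>g b - g (\<alpha> (r n) x)\<bar> < \<epsilon>) \<longrightarrow> b \<in> Q"
      by (rule initial_topology_basis[OF Q(1)[unfolded weak_star_ball_def] Q(2)]) (rule that)
    have "\<Phi> \<subseteq> (\<lambda>v \<phi>. \<phi> v) ` ?V" using \<Phi>(2) by auto
    from finite_subset_image[OF \<Phi>(1) this] obtain vs where
      vs: "vs \<subseteq> ?V" "finite vs" "\<Phi> = (\<lambda>v \<phi>. \<phi> v) ` vs" by (elim exE conjE)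
    show ?thesis
    proof (intro exI[of _ "coord n ` vs"] exI[of _ "(1/2) ^ Suc n * \<epsilon>"] conjI allI impI)
      show "finite (coord n ` vs)" using vs(2) by simp
      show "coord n ` vs \<subseteq> space" using vs(1) by (auto intro: coord_mem)
      show "0 < (1/2) ^ Suc n * \<epsilon>" using \<Phi>(3) by simp
      fix y assume y: "\<forall>f\<in>coord n ` vs. \<bar>apply_bcontfun f y - apply_bcontfun f x\<bar> < (1/2) ^ Suc n * \<epsilon>"
      have "\<alpha> (r n) y \<in> Q"
      proof (rule \<Phi>(4)[rule_format])
        show "\<alpha> (r n) y \<in> {\<phi> \<in> dual ?V ?N. dual_norm ?V ?N \<phi> \<le> 1}"
          using representation_ball[OF rp] by simp
        fix g assume "g \<in> \<Phi>"
        then obtain v where v: "v \<in> vs" "g = (\<lambda>\<phi>. \<phi> v)" using vs(3) by auto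
        have vV: "v \<in> ?V" using v(1) vs(1) by auto
        have "(1/2) ^ Suc n * \<bar>\<alpha> (r n) y v - \<alpha> (r n) x v\<bar> < (1/2) ^ Suc n * \<epsilon>"
          using bspec[OF y imageI[OF v(1)]] unfolding coord_apply[OF vV] right_diff_distrib[symmetric]
          by (simp add: abs_mult)
        then show "\<bar>g (\<alpha> (r n) y) - g (\<alpha> (r n) x)\<bar> < \<epsilon>" by (simp add: v(2))
      qed
      then show "y \<in> U" using Q(3) by auto
    qed
  qed
  have "faithful_representation space nrm act (\<lambda>s. \<lambda>f\<in>space. translate act f s)
    (\<lambda>x. \<lambda>f\<in>space. apply_bcontfun f x)"
  proof (rule faithful_translation_representation[OF act])
    show "normed_on space nrm" by unfold_locales
    show "\<bar>apply_bcontfun f x\<bar> \<le> nrm f" if "f \<in> space" for f x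
      using abs_apply_bcontfun_le[of f x] norm_le_nrm[OF that] by linarith
    show "nrm (translate act f s) \<le> nrm f" if "f \<in> space" for f s
    proof (rule nrm_greatest[OF that])
      fix C y assume y: "y \<in> csum_ball C" "f = q y"
      note t = trans[OF y(1), of s]
      from nrm_le[OF conjunct1[OF t]] conjunct2[OF t] y(2) show "nrm (translate act f s) \<le> C" by simp
    qed
    show "\<exists>f\<in>space. apply_bcontfun f x \<noteq> apply_bcontfun f y" if xy: "x \<noteq> y" for x y
    proof (rule ccontr)
      assume "\<not> ?thesis"
      then have eq: "apply_bcontfun f x = apply_bcontfun f y" if "f \<in> space" for f using that by blast
      obtain \<rho> where \<rho>: "\<rho> \<in> R" "\<alpha> \<rho> x \<noteq> \<alpha> \<rho> y" using point_sep[OF xy] by blast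
      have n: "normed_on (V \<rho>) (N \<rho>)" using bspec[OF R1 \<rho>(1)]
        by (auto simp: defs split_beta intro: asplund_on_normed_on)
      have "\<exists>v\<in>V \<rho>. \<alpha> \<rho> x v \<noteq> \<alpha> \<rho> y v"
      proof (rule ccontr)
        assume "\<not> ?thesis"
        then have "\<alpha> \<rho> x = \<alpha> \<rho> y"
          using representation_ball(1)[OF n rep[OF \<rho>(1)]]
          by (intro extensionalityI[of _ "V \<rho>"]) (auto simp: dual_def)
        with \<rho>(2) show False by simp
      qed
      then obtain v where v: "v \<in> V \<rho>" "\<alpha> \<rho> x v \<noteq> \<alpha> \<rho> y v" by blast
      \<comment> \<open>The sequence \<open>r\<close> was chosen to generate the topology. A
        representation of the full family \<open>R\<close> is used only to find an open set that
        contains \<open>x\<close> and not \<open>y\<close>; by \<open>gen\<close>, functions in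
        \<open>space\<close> then distinguish the points.\<close>
      have op: "open {z. \<alpha> \<rho> z v \<noteq> \<alpha> \<rho> y v}"
        by (intro open_Collect_neq continuous_on_const representation_continuous[OF n rep[OF \<rho>(1)] v(1)])
      have "x \<in> {z. \<alpha> \<rho> z v \<noteq> \<alpha> \<rho> y v}" using v(2) by simp
      from gen[OF op this] obtain \<Phi> \<epsilon> where "finite \<Phi>" "\<Phi> \<subseteq> space" "0 < \<epsilon>"
        "\<forall>z. (\<forall>f\<in>\<Phi>. \<bar>apply_bcontfun f z - apply_bcontfun f x\<bar> < \<epsilon>) \<longrightarrow> z \<in> {z. \<alpha> \<rho> z v \<noteq> \<alpha> \<rho> y v}"
        by (elim exE conjE)
      moreover from this have "\<forall>f\<in>\<Phi>. \<bar>apply_bcontfun f y - apply_bcontfun f x\<bar> < \<epsilon>"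
        using eq by auto
      ultimately show False by blast
    qed
  qed (fact inv, fact wot, fact gen)
  with asplund_space[OF asp] show ?thesis
    unfolding RN_flow_def by (intro exI conjI)
qed

theorem corollary4p10:
  fixes act :: "'s::semitopological_semigroup \<Rightarrow> 'x::second_countable_topology \<Rightarrow> 'x"
  assumes "flow act"
  shows "(wap act \<longrightarrow> eberlein_flow act) \<and>
         (RN_approximable TYPE('v::real_vector) act \<longrightarrow> RN_flow act)"
  using wap_imp_eberlein_flow[OF assms] RN_approximable_imp_RN_flow[OF assms] by blast

end
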